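(* Let $g$ be monotone increasing and satisfy hypothesis (H), let $h\ge0$, and assume the equation $u_t=u_{xx}-u+g(u(t-h,x))$ has a pushed traveling front $u=\phi(x+c_*t)$, $c_*>c_\#$. Let $w_0$ satisfy conditions (IC) with constants $A,B>0$, $\sigma\in(0,\kappa)$, $\mu>\lambda_1(c_* )$, and fix $\lambda\in(\lambda_1(c_* ),\lambda_2(c_* ))$ with $\lambda<\mu$. Then the solution $u(t,x)$ of the initial value problem $u_t(t,x)=u_{xx}(t,x)-u(t,x)+g(u(t-h,x))$ ($t>0$, $x\in\mathbb{R}$), $u(s,x)=w_0(s,x)$ ($s\in[-h,0]$), satisfies, for some $s_0\in\mathbb{R}$, $$\lim_{t\to\infty}\sup_{x\in\mathbb{R}}\frac{|u(t,x)-\phi(x+c_*t+s_0)|}{\eta(x+c_*t)}=0.$$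
   Context: Hypothesis (H) on $g:\mathbb{R}_+\to\mathbb{R}_+$: $g(x)=x$ has exactly two nonnegative solutions $0$ and $\kappa>0$; $g$ is $C^1$ in a $\delta_0$-neighbourhood of $0$ and of $\kappa$, with $g'(0)>1$, $g'(\kappa)<1$; $|g(u)-g(v)|\le L_g|u-v|$ for $u,v\in[0,\kappa]$; there are $C>0,\theta\in(0,1]$ with $|g'(u)-g'(0)|+|g'(\kappa)-g'(\kappa-u)|\le Cu^\theta$ for $u\in(0,\delta_0]$; $g$ is extended linearly and $C^1$-smoothly to $(-\infty,0]$ and $[\kappa,\infty)$. Characteristic function $\chi(z,c)=z^2-cz-1+g'(0)e^{-zch}$; $c_\#$ is the unique real $c$ for which $\chi(\cdot,c)$ has a positive double zero; for $c>c_\#$ its two positive simple zeros are $\lambda_1(c)<\lambda_2(c)$. A wavefront is a solution $u=\phi(x+ct)$ with $\phi>0$, $\phi(-\infty)=0$, $\phi(+\infty)=\kappa$; $c_*$ is the minimal wavefront speed and the minimal wavefront is pushed if $c_*>c_\#$. The initial function $w_0:[-h,0]\times\mathbb{R}\to\mathbb{R}$ is continuous and locally Hölder continuous in $x$ uniformly in $s$. Conditions (IC): (IC1) $0\le w_0(s,x)\le\kappa$ for all $x\in\mathbb{R}$, $s\in[-h,0]$; (IC2) $w_0(s,x)\le Ae^{\mu x}$ for all $x$, $s\in[-h,0]$; (IC3) $w_0(s,x)>\kappa-\sigma$ for $s\in[-h,0]$, $x\ge B$. The initial value problem then has a unique classical solution with values in $[0,\kappa]$. $\eta(x)=\min\{e^{\lambda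 x},1\}$. *)

theory Defs
  imports "HOL-Analysis.Analysis"
begin

text \<open>Hypothesis (H). The function g is given already extended to the whole real line.\<close>
definition hyp_H :: "(real \<Rightarrow> real) \<Rightarrow> real \<Rightarrow> bool" where
  "hyp_H g \<kappa> \<longleftrightarrow> \<kappa> > 0 \<and>
     {x. x \<ge> 0 \<and> g x = x} = {0, \<kappa>} \<and>
     (\<forall>x\<in>{0..\<kappa>}. g x \<ge> 0) \<and>
     (\<exists>\<delta>0 > 0.
        (\<forall>x \<in> cball 0 \<delta>0 \<union> cball \<kappa> \<delta>0. g differentiable (at x)) \<and>
        continuous_on (cball 0 \<delta>0 \<union> cball \<kappa> \<delta>0) (deriv g) \<and>
        (\<exists>C > 0. \<exists>\<theta>. 0 < \<theta> \<and> \<theta> \<le> 1 \<and>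
           (\<forall>u. 0 < u \<and> u \<le> \<delta>0 \<longrightarrow>
              \<bar>deriv g u - deriv g 0\<bar> + \<bar>deriv g \<kappa> - deriv g (\<kappa> - u)\<bar> \<le> C * u powr \<theta>))) \<and>
     deriv g 0 > 1 \<and> deriv g \<kappa> < 1 \<and>
     (\<exists>Lg. \<forall>u\<in>{0..\<kappa>}. \<forall>v\<in>{0..\<kappa>}. \<bar>g u - g v\<bar> \<le> Lg * \<bar>u - v\<bar>) \<and>
     (\<forall>x \<le> 0. g x = g 0 + deriv g 0 * x) \<and>
     (\<forall>x \<ge> \<kappa>. g x = g \<kappa> + deriv g \<kappa> * (x - \<kappa>))"

definition chi :: "(real \<Rightarrow> real) \<Rightarrow> real \<Rightarrow> real \<Rightarrow> real \<Rightarrow> real" where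
  "chi g h z c = z\<^sup>2 - c * z - 1 + deriv g 0 * exp (- z * c * h)"

definition c_sharp :: "(real \<Rightarrow> real) \<Rightarrow> real \<Rightarrow> real" where
  "c_sharp g h = (THE c. \<exists>z > 0. chi g h z c = 0 \<and> deriv (\<lambda>w. chi g h w c) z = 0)"

definition lambda1 :: "(real \<Rightarrow> real) \<Rightarrow> real \<Rightarrow> real \<Rightarrow> real" where
  "lambda1 g h c = (THE l1. \<exists>l2. l1 < l2 \<and> {z. z > 0 \<and> chi g h z c = 0} = {l1, l2})"

definition lambda2 :: "(real \<Rightarrow> real) \<Rightarrow> real \<Rightarrow> real \<Rightarrow> real" where
  "lambda2 g h c = (THE l2. \<exists>l1. l1 < l2 \<and> {z. z > 0 \<and> chi g h z c = 0} = {l1, l2})"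

definition pde_sol_on :: "(real \<Rightarrow> real) \<Rightarrow> real \<Rightarrow> real set \<Rightarrow> (real \<Rightarrow> real \<Rightarrow> real) \<Rightarrow> bool" where
  "pde_sol_on g h S u \<longleftrightarrow>
     (\<forall>t\<in>S. \<forall>x.
        (\<lambda>s. u s x) differentiable (at t) \<and>
        (\<lambda>y. u t y) differentiable (at x) \<and>
        deriv (\<lambda>y. u t y) differentiable (at x) \<and>
        deriv (\<lambda>s. u s x) t = deriv (deriv (\<lambda>y. u t y)) x - u t x + g (u (t - h) x))"

definition wavefront :: "(real \<Rightarrow> real) \<Rightarrow> real \<Rightarrow> real \<Rightarrow> real \<Rightarrow> (real \<Rightarrow> real) \<Rightarrow> bool" where
  "wavefront g h \<kappa> c \<phi> \<longleftrightarrow>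
     pde_sol_on g h UNIV (\<lambda>t x. \<phi> (x + c * t)) \<and>
     (\<forall>s. \<phi> s > 0) \<and> (\<phi> \<longlongrightarrow> 0) at_bot \<and> (\<phi> \<longlongrightarrow> \<kappa>) at_top"

definition eta :: "real \<Rightarrow> real \<Rightarrow> real" where
  "eta lam x = min (exp (lam * x)) 1"

definition admissible_initial :: "real \<Rightarrow> (real \<Rightarrow> real \<Rightarrow> real) \<Rightarrow> bool" where
  "admissible_initial h w0 \<longleftrightarrow>
     continuous_on ({-h..0} \<times> UNIV) (\<lambda>(s, x). w0 s x) \<and>
     (\<forall>a b. \<exists>K \<alpha>. 0 < \<alpha> \<and> \<alpha> \<le> 1 \<and>
        (\<forall>s\<in>{-h..0}. \<forall>x\<in>{a..b}. \<forall>y\<in>{a..b}. \<bar>w0 s x - w0 s y\<bar> \<le> K * \<bar>x - y\<bar> powr \<alpha>))"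

definition ivp_solution :: "(real \<Rightarrow> real) \<Rightarrow> real \<Rightarrow> real \<Rightarrow> (real \<Rightarrow> real \<Rightarrow> real)
    \<Rightarrow> (real \<Rightarrow> real \<Rightarrow> real) \<Rightarrow> bool" where
  "ivp_solution g h \<kappa> w0 u \<longleftrightarrow>
     continuous_on ({-h..} \<times> UNIV) (\<lambda>(t, x). u t x) \<and>
     (\<forall>s\<in>{-h..0}. \<forall>x. u s x = w0 s x) \<and>
     pde_sol_on g h {0<..} u \<and>
     (\<forall>t \<ge> -h. \<forall>x. 0 \<le> u t x \<and> u t x \<le> \<kappa>)"

end

theory Submission
  imports Defs "HOL-Probability.Probability" "HOL-Real_Asymp.Real_Asymp"
begin

text \<open>
  A minimal front with \<open>c > c_sharp\<close> must decay at \<open>- \<infinity>\<close> faster than \<open>exp (l z)\<close> for every \<open>l\<close> between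
  the two characteristic roots: otherwise cutting it off by \<open>A exp (l z)\<close> gives a strict supersolution of
  the profile equation, which survives a small decrease of the speed and yields a slower front.
  In the space weighted by \<open>exp (lam z)\<close> the pushed front therefore behaves like a bistable one: the
  linearisation is strictly stable near both ends and \<open>\<phi>'\<close> is small compared with the weight there.
  Sliding gives \<open>\<phi>' > 0\<close>, and Fife--McLeod barriers trap the solution between two translates of \<open>\<phi>\<close>.
  If the optimal upper and lower translates differed, the solution would leave a gap to one of them at the
  centre of the front at arbitrarily large times; positivity spreads the gap over a large compact range, and
  that translate could be improved.
\<close>

section \<open>Comparison, smoothing and positivity for the heat operator\<close>

text \<open>The equation enters through one operator: \<open>Kop c\<close>, the inverse of 1 + cD -
  D^2 on bounded functions, preserves order and turns a bound exp(l z) into exp(l z) / (1 + c l -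
  l^2). Composed with the delay shift and the linearisation at 0 it contracts exp(l z) exactly when
  chi(l, c) < 0; this is where the interval between the two roots comes from. Treating fronts as
  fixed points of an integral operator replaces asymptotic expansions at - infinity and bounds
  derivatives in the same weight. The weight \<open>eta\<close> has a corner at 0, so the barriers
  use \<open>Kop c (eta lam)\<close>: it is smooth, comparable with \<open>eta lam\<close> from both
  sides, and its defect in the profile operator is exactly \<open>eta lam\<close>. Upper and lower
  estimates are proved together with a sign \<open>s\<close> in {1, -1}. Because of the delay, the
  starting condition of a barrier has to be verified on a whole time interval of length
  \<open>h\<close>. Improving the best translate takes the place of compactness of the
  orbit.\<close>

definition heat_jet :: "(real \<Rightarrow> real \<Rightarrow> real) \<Rightarrow> real \<Rightarrow> real \<Rightarrow> real \<Rightarrow> real \<Rightarrow> bool" where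
  "heat_jet w t x p r \<longleftrightarrow> ((\<lambda>s. w s x) has_real_derivative p) (at t) \<and>
     (\<exists>d. (\<forall>y. (w t has_real_derivative d y) (at y)) \<and> (d has_real_derivative r) (at x))"

lemma heat_jetI:
  assumes "((\<lambda>s. w s x) has_real_derivative p) (at t)"
    and "\<And>y. (w t has_real_derivative d y) (at y)" and "(d has_real_derivative r) (at x)"
  shows "heat_jet w t x p r"
  using assms unfolding heat_jet_def by blast

lemma heat_jet_add:
  assumes "heat_jet v t x p r" and "heat_jet w t x p' r'"
  shows "heat_jet (\<lambda>t x. v t x + w t x) t x (p + p') (r + r')"
proof -
  obtain d d' where
    "\<And>y. (v t has_real_derivative d y) (at y)" "(d has_real_derivative r) (at x)"
    "\<And>y. (w t has_real_derivative d' y) (at y)" "(d' has_real_derivative r') (at x)"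
    using assms unfolding heat_jet_def by blast
  then show ?thesis
    using assms unfolding heat_jet_def
    by (intro conjI exI[of _ "\<lambda>y. d y + d' y"] allI DERIV_add) auto
qed

lemma heat_jet_cmult:
  assumes "heat_jet v t x p r"
  shows "heat_jet (\<lambda>t x. c * v t x) t x (c * p) (c * r)"
proof -
  obtain d where
    "\<And>y. (v t has_real_derivative d y) (at y)" "(d has_real_derivative r) (at x)"
    using assms unfolding heat_jet_def by blast
  then show ?thesis
    using assms unfolding heat_jet_def
    by (intro conjI exI[of _ "\<lambda>y. c * d y"] allI DERIV_cmult) auto
qed

lemma heat_jet_diff:
  assumes "heat_jet v t x p r" and "heat_jet w t x p' r'"
  shows "heat_jet (\<lambda>t x. v t x - w t x) t x (p - p') (r - r')"
  using heat_jet_add[OF assms(1) heat_jet_cmult[OF assms(2), of "-1"]] by simp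

lemma heat_jet_const: "heat_jet (\<lambda>t x. k) t x 0 0"
  unfolding heat_jet_def by (intro conjI exI[of _ "\<lambda>y. 0"] allI) auto

lemma heat_jet_time:
  assumes "(f has_real_derivative p) (at t)"
  shows "heat_jet (\<lambda>t x. f t) t x p 0"
  unfolding heat_jet_def using assms by (intro conjI exI[of _ "\<lambda>y. 0"] allI) auto

section \<open>Interior minima and the comparison principle with delay\<close>

lemma second_deriv_nonneg_at_min:
  fixes f :: "real \<Rightarrow> real"
  assumes f: "\<And>y. (f has_real_derivative d y) (at y)" and d: "(d has_real_derivative r) (at x)"
    and e: "e > 0" and min: "\<And>y. \<bar>y - x\<bar> < e \<Longrightarrow> f x \<le> f y"
  shows "0 \<le> r"
proof (rule ccontr)
  assume "\<not> 0 \<le> r"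
  then obtain e' where e': "e' > 0" "\<And>h. 0 < h \<Longrightarrow> h < e' \<Longrightarrow> d (x + h) < d x"
    using DERIV_neg_dec_right[OF d] by (meson linorder_not_le)
  have d0: "d x = 0"
    by (rule DERIV_local_min[OF f[of x] e]) (use min in \<open>auto simp: abs_minus_commute\<close>)
  define k where "k = min e e' / 2"
  have k: "0 < k" "k < e" "k < e'" using e e' by (auto simp: k_def)
  obtain z where z: "z > x" "z < x + k" "f (x + k) - f x = (x + k - x) * d z"
    using MVT2[of x "x + k" f d] f k by auto
  have "d (x + (z - x)) < d x" using z k by (intro e'(2)) auto
  then have "d z < 0" using d0 by simp
  then have "f (x + k) < f x" using z k by (simp add: mult_pos_neg algebra_simps)
  moreover have "f x \<le> f (x + k)" using k by (intro min) auto
  ultimately show False by simp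
qed

text \<open>Only times s \<le> t are compared, so the minimum may lie on the last time slice of a
  window. The time derivative then has a sign and need not vanish.\<close>

lemma heat_jet_min:
  assumes j: "heat_jet w t x p r" and e: "e > 0"
    and x: "\<And>y. \<bar>y - x\<bar> < e \<Longrightarrow> w t x \<le> w t y"
    and t: "\<And>s. t - e < s \<Longrightarrow> s \<le> t \<Longrightarrow> w t x \<le> w s x"
  shows "p \<le> 0" and "0 \<le> r"
proof -
  obtain d where d: "\<And>y. (w t has_real_derivative d y) (at y)" "(d has_real_derivative r) (at x)"
    and p: "((\<lambda>s. w s x) has_real_derivative p) (at t)"
    using j unfolding heat_jet_def by blast
  show "0 \<le> r" using second_deriv_nonneg_at_min[OF d e] x by blast
  show "p \<le> 0"
  proof (rule ccontr)
    assume "\<not> p \<le> 0"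
    then obtain e' where e': "e' > 0" "\<And>h. 0 < h \<Longrightarrow> h < e' \<Longrightarrow> w (t - h) x < w t x"
      using DERIV_pos_inc_left[OF p] by (meson linorder_not_le)
    define k where "k = min e e' / 2"
    have k: "0 < k" "k < e" "k < e'" using e e' by (auto simp: k_def)
    have "w (t - k) x < w t x" using e'(2) k by blast
    moreover have "w t x \<le> w (t - k) x" using k by (intro t) auto
    ultimately show False by simp
  qed
qed

text \<open>The delayed term enters through its negative part, which is all that a monotone
  Lipschitz nonlinearity leaves of the difference of two solutions. The lower bound and a quadratic
  penalty in space make any negative value produce an attained minimum, although the line is
  unbounded.\<close>

lemma parabolic_comparison:
  fixes w :: "real \<Rightarrow> real \<Rightarrow> real"
  assumes h: "0 \<le> h" and L: "0 \<le> L"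
    and cont: "continuous_on ({t0-h..t1} \<times> UNIV) (\<lambda>(t,x). w t x)"
    and bdd: "\<And>t x. t \<in> {t0-h..t1} \<Longrightarrow> - N \<le> w t x"
    and init: "\<And>t x. t \<in> {t0-h..t0} \<Longrightarrow> 0 \<le> w t x"
    and jet: "\<And>t x. t0 < t \<Longrightarrow> t \<le> t1 \<Longrightarrow>
       \<exists>p r. heat_jet w t x p r \<and> r - w t x - L * max 0 (- w (t - h) x) \<le> p"
    and t: "t \<in> {t0-h..t1}"
  shows "0 \<le> w t x"
proof (rule ccontr)
  assume neg: "\<not> 0 \<le> w t x"
  \<comment> \<open>With this rate the minimum satisfies r \<le> 3 w. As exp(-K s) w < -\<epsilon>
    there, this beats the 2\<epsilon> coming from the second derivative of the penalty.\<close>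
  define K where "K = L + 2"
  \<comment> \<open>The penalty eats exactly half of the negative value at
    \<open>(t, x)\<close>.\<close>
  define \<epsilon> where "\<epsilon> = - (exp (-K * t) * w t x) / (2 * (1 + x\<^sup>2))"
  have px: "1 + x\<^sup>2 > 0" by (smt (verit) zero_le_power2)
  have \<epsilon>: "\<epsilon> > 0" unfolding \<epsilon>_def using neg px
    by (intro divide_pos_pos) (auto simp: mult_pos_neg)
  define W where "W s y = exp (-K * s) * w s y + \<epsilon> * (1 + y\<^sup>2)" for s y
  have "\<epsilon> * (1 + x\<^sup>2) = - (exp (-K * t) * w t x) / 2" unfolding \<epsilon>_def using px by (simp add: field_simps)
  moreover have "exp (-K * t) * w t x < 0" using neg by (simp add: mult_pos_neg)
  ultimately have Wt: "W t x < 0" unfolding W_def by linarith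
  define E where "E = exp (-K * (t0-h))"
  have E: "exp (-K * s) \<le> E" if "s \<ge> t0 - h" for s
    unfolding E_def using that L by (simp add: K_def mult_left_mono)
  define M where "M = \<bar>N\<bar> * E"
  have M: "- M \<le> exp (-K * s) * w s y" if "s \<in> {t0-h..t1}" for s y
  proof -
    have "exp (-K * s) * w s y \<ge> exp (-K * s) * (-\<bar>N\<bar>)"
      using bdd[OF that, of y] by (intro mult_left_mono) auto
    moreover have "exp (-K * s) * \<bar>N\<bar> \<le> E * \<bar>N\<bar>" using E that by (intro mult_right_mono) auto
    ultimately show ?thesis unfolding M_def by (simp add: algebra_simps)
  qed
  define R where "R = \<bar>x\<bar> + M / \<epsilon> + 1"
  have M0: "M \<ge> 0" unfolding M_def E_def by simp
  have R: "R \<ge> 1" "R \<ge> \<bar>x\<bar>" "\<epsilon> * R \<ge> M" unfolding R_def using M0 \<epsilon> by (auto simp: field_simps)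
  have far: "W s y > 0" if "s \<in> {t0-h..t1}" "\<bar>y\<bar> > R" for s y
  proof -
    have "y\<^sup>2 = \<bar>y\<bar> * \<bar>y\<bar>" by (simp add: power2_eq_square)
    also have "\<dots> \<ge> 1 * R" using that R by (intro mult_mono) auto
    finally have "y\<^sup>2 \<ge> R" by simp
    then have "\<epsilon> * (1 + y\<^sup>2) > M" using R \<epsilon> by (smt (verit, best) mult_left_mono mult_less_cancel_left_pos)
    then show ?thesis using M[OF that(1), of y] unfolding W_def by linarith
  qed
  have cW: "continuous_on ({t0-h..t1} \<times> {-R..R}) (\<lambda>p. W (fst p) (snd p))"
  proof -
    have "continuous_on ({t0-h..t1} \<times> {-R..R}) (\<lambda>(t,x). w t x)"
      by (rule continuous_on_subset[OF cont]) auto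
    then show ?thesis unfolding W_def case_prod_unfold by (intro continuous_intros) auto
  qed
  have "(t, x) \<in> {t0-h..t1} \<times> {-R..R}" using t R by auto
  then have "\<exists>q\<in>{t0-h..t1} \<times> {-R..R}. \<forall>q'\<in>{t0-h..t1} \<times> {-R..R}. W (fst q) (snd q) \<le> W (fst q') (snd q')"
    by (intro continuous_attains_inf compact_Times cW) auto
  then obtain s y where sy: "s \<in> {t0-h..t1}" "y \<in> {-R..R}"
    and min0: "\<And>s' y'. s' \<in> {t0-h..t1} \<Longrightarrow> y' \<in> {-R..R} \<Longrightarrow> W s y \<le> W s' y'"
    by fastforce
  have Wneg: "W s y < 0" using min0[of t x] Wt t R by force
  have min: "W s y \<le> W s' y'" if "s' \<in> {t0-h..t1}" for s' y'
    using min0[OF that, of y'] far[OF that, of y'] Wneg by (cases "\<bar>y'\<bar> > R") (auto simp: abs_le_iff not_less)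
  have wneg: "exp (-K * s) * w s y < - \<epsilon>"
    using Wneg \<epsilon> unfolding W_def by (smt (verit) mult_left_mono zero_le_power2 mult_cancel_left1)
  have "s > t0"
  proof (rule ccontr)
    assume "\<not> s > t0"
    then have "0 \<le> w s y" using sy init by auto
    then show False using wneg \<epsilon> by (smt (verit) exp_ge_zero mult_nonneg_nonneg)
  qed
  then obtain p r where j: "heat_jet w s y p r" and pr: "r - w s y - L * max 0 (- w (s - h) y) \<le> p"
    using jet[of s y] sy by auto
  obtain d where d: "((\<lambda>s. w s y) has_real_derivative p) (at s)"
      "\<And>z. (w s has_real_derivative d z) (at z)" "(d has_real_derivative r) (at y)"
    using j unfolding heat_jet_def by blast
  have jW: "heat_jet W s y (exp (-K * s) * (p - K * w s y)) (exp (-K * s) * r + 2 * \<epsilon>)"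
  proof (rule heat_jetI)
    show "((\<lambda>s. W s y) has_real_derivative exp (-K * s) * (p - K * w s y)) (at s)"
      unfolding W_def by (auto intro!: derivative_eq_intros d simp: algebra_simps)
    show "(W s has_real_derivative (exp (-K * s) * d z + 2 * \<epsilon> * z)) (at z)" for z
      unfolding W_def[abs_def] by (auto intro!: derivative_eq_intros d)
    show "((\<lambda>z. exp (-K * s) * d z + 2 * \<epsilon> * z) has_real_derivative (exp (-K * s) * r + 2 * \<epsilon>)) (at y)"
      by (auto intro!: derivative_eq_intros d)
  qed
  have "exp (-K * s) * (p - K * w s y) \<le> 0"
    by (rule heat_jet_min(1)[OF jW, of "s - t0"]) (use \<open>s > t0\<close> sy h in \<open>auto intro!: min\<close>)
  then have p: "p \<le> K * w s y" by (simp add: mult_le_0_iff)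
  have r: "exp (-K * s) * r + 2 * \<epsilon> \<ge> 0"
    by (rule heat_jet_min(2)[OF jW, of "s - t0"]) (use \<open>s > t0\<close> sy h in \<open>auto intro!: min\<close>)
  have sh: "s - h \<in> {t0-h..t1}" using \<open>s > t0\<close> sy h by auto
  have wn: "w s y < 0" using wneg \<epsilon> by (smt (verit) exp_ge_zero mult_nonneg_nonneg)
  \<comment> \<open>The penalty does not depend on time and cancels between s and s - h; the factor
    exp(K h) \<ge> 1 then bounds the delayed negative part by - w at the minimum.\<close>
  have "exp (-K * s) * w s y \<le> exp (-K * (s-h)) * w (s-h) y"
    using min[OF sh, of y] unfolding W_def by simp
  also have "exp (-K * (s-h)) = exp (-K * s) * exp (K * h)" by (simp add: exp_add[symmetric] algebra_simps)
  finally have "exp (-K * s) * w s y \<le> exp (-K * s) * (exp (K * h) * w (s-h) y)" by (simp add: mult.assoc)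
  then have wsh: "w s y \<le> exp (K * h) * w (s-h) y" by simp
  have "max 0 (- w (s - h) y) \<le> - w s y"
  proof (cases "w (s-h) y < 0")
    case True
    have "1 * (- w (s-h) y) \<le> exp (K * h) * (- w (s-h) y)"
      using True h L by (intro mult_right_mono) (auto simp: K_def)
    then show ?thesis using wsh wn by auto
  qed (use wn in auto)
  then have "L * max 0 (- w (s - h) y) \<le> L * (- w s y)" using L by (rule mult_left_mono)
  then have "r \<le> 3 * w s y" using pr p unfolding K_def by (simp add: algebra_simps)
  then have "exp (-K * s) * r \<le> exp (-K * s) * (3 * w s y)" by (intro mult_left_mono) auto
  also have "\<dots> = 3 * (exp (-K * s) * w s y)" by simp
  finally show False using r wneg \<epsilon> by linarith
qed

text \<open>Doubling of variables: \<open>v t x - v t y\<close> is compared with \<open>2 N (T + 1 - t) + K N ((x - y) - (x - y)\<^sup>2)\<close>,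
  which dominates at the initial time for \<open>x > y\<close> and is Lipschitz in \<open>x - y\<close> one unit of time later.\<close>

lemma lipschitz_smoothing_aux:
  fixes v :: "real \<Rightarrow> real \<Rightarrow> real"
  assumes N: "N > 0" and K1: "K1 \<ge> 0"
    and cont: "continuous_on ({T..T+1} \<times> UNIV) (\<lambda>(t,x). v t x)"
    and bdd: "\<And>t x. t \<in> {T..T+1} \<Longrightarrow> \<bar>v t x\<bar> \<le> N"
    and jet: "\<And>t x. T < t \<Longrightarrow> t \<le> T+1 \<Longrightarrow> \<exists>p r. heat_jet v t x p r \<and> \<bar>p - r\<bar> \<le> K1 * N"
    and xy: "0 < x - y" "x - y < 1/2"
  shows "v (T+1) x - v (T+1) y \<le> (8 + K1) * N * (x - y)"
proof (rule ccontr)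
  \<comment> \<open>At x - y = 1/2 the barrier is K N / 4 \<ge> 2 N, the largest possible
    oscillation of v. The summand K1 absorbs the error 2 K1 N of the two heat inequalities.\<close>
  define K where "K = 8 + K1"
  assume "\<not> ?thesis"
  then have neg: "\<not> v (T+1) x - v (T+1) y \<le> K * N * (x - y)" by (simp add: K_def)
  have "v (T+1) x - v (T+1) y > K * N * ((x - y) - (x - y)\<^sup>2)"
  proof -
    have "K * N * ((x - y) - (x - y)\<^sup>2) \<le> K * N * (x - y)"
      using N K1 by (intro mult_left_mono) (auto simp: K_def)
    then show ?thesis using neg by linarith
  qed
  then obtain \<delta> where \<delta>: "\<delta> = v (T+1) x - v (T+1) y - K * N * ((x - y) - (x - y)\<^sup>2)" "\<delta> > 0" by simp
  have px: "1 + x\<^sup>2 > 0" by (smt (verit) zero_le_power2)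
  define \<epsilon> where "\<epsilon> = min (\<delta> / (2 * (1 + x\<^sup>2))) (N/4)"
  have \<epsilon>: "\<epsilon> > 0" "\<epsilon> \<le> N/4" unfolding \<epsilon>_def using \<delta>(2) N px by (simp, intro min.cobounded2)
  have "\<epsilon> * (1 + x\<^sup>2) \<le> \<delta> / (2 * (1 + x\<^sup>2)) * (1 + x\<^sup>2)"
    unfolding \<epsilon>_def using px by (intro mult_right_mono) auto
  also have "\<dots> = \<delta>/2" using px by (simp add: field_simps)
  finally have \<epsilon>\<delta>: "\<epsilon> * (1 + x\<^sup>2) < \<delta>" using \<delta> by linarith
  define W where "W t x y = 2 * N * (T + 1 - t) + K * N * ((x - y) - (x - y)\<^sup>2) - v t x + v t y + \<epsilon> * (1 + x\<^sup>2)"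
    for t x y
  have W0: "W (T+1) x y < 0" using \<epsilon>\<delta> \<delta> unfolding W_def by simp
  define R where "R = \<bar>x\<bar> + 2 * N / \<epsilon> + 1"
  have R: "R \<ge> 1" "R \<ge> \<bar>x\<bar>" "\<epsilon> * R \<ge> 2 * N" unfolding R_def using N \<epsilon> by (auto simp: field_simps)
  have far: "W t x y > 0" if "t \<in> {T..T+1}" "x - y \<in> {0..1/2}" "\<bar>x\<bar> > R" for t x y
  proof -
    have "x\<^sup>2 = \<bar>x\<bar> * \<bar>x\<bar>" by (simp add: power2_eq_square)
    also have "\<dots> \<ge> 1 * R" using that R by (intro mult_mono) auto
    finally have "x\<^sup>2 \<ge> R" by simp
    then have a: "\<epsilon> * (1 + x\<^sup>2) > 2 * N"
      using R \<epsilon> by (smt (verit, best) mult_left_mono mult_less_cancel_left_pos)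
    have b: "2 * N * (T + 1 - t) \<ge> 0" using that N by auto
    have "(x - y) - (x - y)\<^sup>2 \<ge> 0" using that by (simp add: power2_eq_square mult_left_le)
    then have c: "K * N * ((x - y) - (x - y)\<^sup>2) \<ge> 0" using N K1 by (auto simp: K_def)
    have "v t x \<le> N" "- N \<le> v t y" using bdd[OF that(1), of x] bdd[OF that(1), of y] by auto
    then show ?thesis using a b c unfolding W_def by linarith
  qed
  define S where "S = {T..T+1} \<times> ({-R..R} \<times> {0..1/2::real})"
  have cont1: "continuous_on S (\<lambda>p. v (fst p) (fst (snd p)))"
  proof -
    have "continuous_on S ((\<lambda>p. (case p of (t,x) \<Rightarrow> v t x)) \<circ> (\<lambda>p. (fst p, fst (snd p))))"
      by (intro continuous_on_compose continuous_intros continuous_on_subset[OF cont]) (auto simp: S_def)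
    then show ?thesis by (simp add: o_def)
  qed
  have cont2: "continuous_on S (\<lambda>p. v (fst p) (fst (snd p) - snd (snd p)))"
  proof -
    have "continuous_on S ((\<lambda>p. (case p of (t,x) \<Rightarrow> v t x)) \<circ> (\<lambda>p. (fst p, fst (snd p) - snd (snd p))))"
      by (intro continuous_on_compose continuous_intros continuous_on_subset[OF cont]) (auto simp: S_def)
    then show ?thesis by (simp add: o_def)
  qed
  have cW: "continuous_on S (\<lambda>p. W (fst p) (fst (snd p)) (fst (snd p) - snd (snd p)))"
    unfolding W_def by (intro continuous_intros cont1 cont2)
  have inS: "(T+1, x, x - y) \<in> S" using R xy by (auto simp: S_def)
  then have "\<exists>q\<in>S. \<forall>q'\<in>S. W (fst q) (fst (snd q)) (fst (snd q) - snd (snd q)) \<le> W (fst q') (fst (snd q')) (fst (snd q') - snd (snd q'))"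
    by (intro continuous_attains_inf cW) (auto simp: S_def intro!: compact_Times)
  then obtain s a k where sak: "(s, a, k) \<in> S"
    and min0: "\<And>s' a' k'. (s', a', k') \<in> S \<Longrightarrow> W s a (a - k) \<le> W s' a' (a' - k')"
    by fastforce
  define b where "b = a - k"
  have sab: "s \<in> {T..T+1}" "a - b \<in> {0..1/2}" using sak by (auto simp: S_def b_def)
  have Wneg: "W s a b < 0" using min0[OF inS] W0 by (simp add: b_def)
  have min: "W s a b \<le> W s' a' b'" if "s' \<in> {T..T+1}" "a' - b' \<in> {0..1/2}" for s' a' b'
  proof (cases "\<bar>a'\<bar> > R")
    case True
    then show ?thesis using far[OF that] Wneg by linarith
  next
    case False
    then show ?thesis using min0[of s' a' "a' - b'"] that unfolding S_def b_def by (auto simp: abs_le_iff not_less)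
  qed
  have v: "\<bar>v s a\<bar> \<le> N" "\<bar>v s b\<bar> \<le> N" using bdd sab by auto
  have \<epsilon>a: "\<epsilon> * (1 + a\<^sup>2) > 0" using \<epsilon> by (smt (verit) mult_pos_pos zero_le_power2)
  have rr: "(a - b) - (a - b)\<^sup>2 \<ge> 0" using sab by (simp add: power2_eq_square mult_left_le)
  then have Krr: "K * N * ((a - b) - (a - b)\<^sup>2) \<ge> 0" using N K1 by (auto simp: K_def)
  have st: "2 * N * (T + 1 - s) \<ge> 0" using sab N by auto
  have "a \<noteq> b" using Wneg \<epsilon>a st unfolding W_def by auto
  moreover have "a - b \<noteq> 1/2"
  proof
    assume *: "a - b = 1/2"
    have "K * N * ((a - b) - (a - b)\<^sup>2) = K * N / 4" unfolding * by (simp add: power2_eq_square)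
    also have "\<dots> \<ge> 2 * N" using N K1 unfolding K_def by (simp add: field_simps)
    finally show False using Wneg \<epsilon>a st v unfolding W_def by linarith
  qed
  ultimately have ab: "0 < a - b" "a - b < 1/2" using sab by auto
  have "s \<noteq> T" using Wneg \<epsilon>a Krr v unfolding W_def by auto
  then have s: "T < s" "s \<le> T + 1" using sab by auto
  obtain p1 r1 where j1: "heat_jet v s a p1 r1" "\<bar>p1 - r1\<bar> \<le> K1 * N" using jet s by blast
  obtain p2 r2 where j2: "heat_jet v s b p2 r2" "\<bar>p2 - r2\<bar> \<le> K1 * N" using jet s by blast
  obtain d1 where d1: "((\<lambda>s. v s a) has_real_derivative p1) (at s)"
    "\<And>z. (v s has_real_derivative d1 z) (at z)" "(d1 has_real_derivative r1) (at a)"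
    using j1 unfolding heat_jet_def by blast
  obtain d2 where d2: "((\<lambda>s. v s b) has_real_derivative p2) (at s)"
    "\<And>z. (v s has_real_derivative d2 z) (at z)" "(d2 has_real_derivative r2) (at b)"
    using j2 unfolding heat_jet_def by blast
  define e where "e = min (s - T) (min (a - b) (1/2 - (a - b)))"
  have e: "e > 0" unfolding e_def using s ab by auto
  \<comment> \<open>The barrier is strictly concave in x - y, so minimality in \<open>a\<close> and
    in \<open>b\<close> separately suffices: it forces r1 \<le> - 2 K N + 2\<epsilon> and r2 \<ge> 2
    K N, against p1 - p2 \<ge> - 2 N.\<close>
  have jW1: "heat_jet (\<lambda>s x. W s x b) s a (- 2 * N - p1 + p2) (- 2 * K * N - r1 + 2 * \<epsilon>)"
  proof (rule heat_jetI)
    show "((\<lambda>s. W s a b) has_real_derivative - 2 * N - p1 + p2) (at s)"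
      unfolding W_def by (auto intro!: derivative_eq_intros d1 d2)
    show "((\<lambda>x. W s x b) has_real_derivative K * N * (1 - 2 * (z - b)) - d1 z + 2 * \<epsilon> * z) (at z)" for z
      unfolding W_def by (auto intro!: derivative_eq_intros d1 simp: algebra_simps)
    show "((\<lambda>z. K * N * (1 - 2 * (z - b)) - d1 z + 2 * \<epsilon> * z) has_real_derivative - 2 * K * N - r1 + 2 * \<epsilon>) (at a)"
      by (auto intro!: derivative_eq_intros d1)
  qed
  have jW2: "heat_jet (\<lambda>s y. W s a y) s b (- 2 * N - p1 + p2) (- 2 * K * N + r2)"
  proof (rule heat_jetI)
    show "((\<lambda>s. W s a b) has_real_derivative - 2 * N - p1 + p2) (at s)"
      unfolding W_def by (auto intro!: derivative_eq_intros d1 d2)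
    show "((\<lambda>y. W s a y) has_real_derivative K * N * (- 1 + 2 * (a - z)) + d2 z) (at z)" for z
      unfolding W_def by (auto intro!: derivative_eq_intros d2 simp: algebra_simps)
    show "((\<lambda>z. K * N * (- 1 + 2 * (a - z)) + d2 z) has_real_derivative - 2 * K * N + r2) (at b)"
      by (auto intro!: derivative_eq_intros d2)
  qed
  have "- 2 * N - p1 + p2 \<le> 0" "- 2 * K * N - r1 + 2 * \<epsilon> \<ge> 0"
    by (rule heat_jet_min[OF jW1 e]; use s ab in \<open>auto intro!: min simp: e_def\<close>)+
  moreover have "- 2 * K * N + r2 \<ge> 0"
    by (rule heat_jet_min[OF jW2 e]; use s ab in \<open>auto intro!: min simp: e_def\<close>)
  ultimately have "4 * K * N - 2 * N - 2 * \<epsilon> \<le> 2 * (K1 * N)" using j1(2) j2(2) by linarith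
  then have "30 * N + 2 * (K1 * N) - 2 * \<epsilon> \<le> 0" unfolding K_def by (simp add: algebra_simps)
  moreover have "K1 * N \<ge> 0" using K1 N by simp
  ultimately show False using \<epsilon> N by linarith
qed

text \<open>The one-sided estimate is applied to v and to - v; points at distance at least 1/2 are
  covered by the bound N alone. Nothing about the regularity of v at time T enters the constant, so
  the estimate is uniform in T.\<close>

lemma lipschitz_smoothing:
  fixes v :: "real \<Rightarrow> real \<Rightarrow> real"
  assumes N: "N > 0" and K1: "K1 \<ge> 0"
    and cont: "continuous_on ({T..T+1} \<times> UNIV) (\<lambda>(t,x). v t x)"
    and bdd: "\<And>t x. t \<in> {T..T+1} \<Longrightarrow> \<bar>v t x\<bar> \<le> N"
    and jet: "\<And>t x. T < t \<Longrightarrow> t \<le> T+1 \<Longrightarrow> \<exists>p r. heat_jet v t x p r \<and> \<bar>p - r\<bar> \<le> K1 * N"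
  shows "\<bar>v (T+1) x - v (T+1) y\<bar> \<le> (8 + K1) * N * \<bar>x - y\<bar>"
proof -
  have main: "\<bar>v (T+1) x - v (T+1) y\<bar> \<le> (8 + K1) * N * (x - y)" if xy: "x > y" for x y
  proof (cases "x - y < 1/2")
    case True
    have "v (T+1) x - v (T+1) y \<le> (8 + K1) * N * (x - y)"
      using lipschitz_smoothing_aux[OF N K1 cont bdd jet _ True] xy by simp
    moreover have "- v (T+1) x - (- v (T+1) y) \<le> (8 + K1) * N * (x - y)"
    proof (rule lipschitz_smoothing_aux[OF N K1, where v = "\<lambda>t x. - v t x"])
      show "continuous_on ({T..T+1} \<times> UNIV) (\<lambda>(t,x). - v t x)"
        using continuous_on_minus[OF cont] by (simp add: case_prod_unfold)
      fix t x assume "T < t" "t \<le> T+1"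
      then obtain p r where "heat_jet v t x p r" "\<bar>p - r\<bar> \<le> K1 * N" using jet by blast
      then show "\<exists>p r. heat_jet (\<lambda>t x. - v t x) t x p r \<and> \<bar>p - r\<bar> \<le> K1 * N"
        using heat_jet_cmult[of v t x p r "-1"] by (intro exI[of _ "-p"] exI[of _ "-r"]) auto
    qed (use bdd xy True in auto)
    ultimately show ?thesis by linarith
  next
    case False
    have "(8 + K1) * N * (x - y) \<ge> 8 * N * (1/2)" using False N K1 by (intro mult_mono) auto
    moreover have "\<bar>v (T+1) x\<bar> \<le> N" "\<bar>v (T+1) y\<bar> \<le> N" using bdd by auto
    ultimately show ?thesis using N by linarith
  qed
  show ?thesis
    using main[of x y] main[of y x] by (cases "x > y"; cases "x = y") (auto simp: abs_minus_commute)
qed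

section \<open>Heat kernels and quantitative positivity\<close>

definition gauss :: "real \<Rightarrow> real \<Rightarrow> real" where
  "gauss s y = exp (- y\<^sup>2 / (4 * s) - ln s / 2)"

text \<open>\<open>gauss\<close> is the heat kernel without its factor (4 pi)^(-1/2), so the time
  derivative and the second space derivative agree. Keeping s^(-1/2) in the exponent reduces later
  comparisons to comparisons of exponents.\<close>

lemma heat_jet_gauss:
  assumes "t + s > 0"
  shows "heat_jet (\<lambda>t x. gauss (t + s) (x - a)) t x
    (gauss (t + s) (x - a) * ((x - a)\<^sup>2 / (4 * (t + s)\<^sup>2) - 1 / (2 * (t + s))))
    (gauss (t + s) (x - a) * ((x - a)\<^sup>2 / (4 * (t + s)\<^sup>2) - 1 / (2 * (t + s))))"
proof (rule heat_jetI)
  show "((\<lambda>t. gauss (t + s) (x - a)) has_real_derivative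
    gauss (t + s) (x - a) * ((x - a)\<^sup>2 / (4 * (t + s)\<^sup>2) - 1 / (2 * (t + s)))) (at t)"
  proof -
    have "((\<lambda>r. gauss r y) has_real_derivative gauss r y * (y\<^sup>2 / (4 * r\<^sup>2) - 1 / (2 * r))) (at r)"
      if "r > 0" for r y
      unfolding gauss_def using that
      by (auto intro!: derivative_eq_intros) (simp add: field_simps power2_eq_square)
    from this[OF assms, of "x - a"] show ?thesis by (rule DERIV_shift[THEN iffD1])
  qed
  show d: "((\<lambda>x. gauss (t + s) (x - a)) has_real_derivative
      gauss (t + s) (y - a) * (- (y - a) / (2 * (t + s)))) (at y)" for y
    unfolding gauss_def using assms
    by (auto intro!: derivative_eq_intros simp: divide_simps) (simp add: algebra_simps)
  have alg: "G * (- e / (2 * S)) * (- e / (2 * S)) + - 1 / (2 * S) * G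
      = G * (e\<^sup>2 / (4 * S\<^sup>2) - 1 / (2 * S))" for G e S :: real
    by (simp add: power2_eq_square algebra_simps)
  have "((\<lambda>y. gauss (t + s) (y - a) * (- (y - a) / (2 * (t + s)))) has_real_derivative
     gauss (t + s) (x - a) * (- (x - a) / (2 * (t + s))) * (- (x - a) / (2 * (t + s)))
       + - 1 / (2 * (t + s)) * gauss (t + s) (x - a)) (at x)"
  proof (rule DERIV_mult[OF d])
    have "((\<lambda>y. - (y - a)) has_real_derivative - 1) (at x)" by (auto intro!: derivative_eq_intros)
    then show "((\<lambda>y. - (y - a) / (2 * (t + s))) has_real_derivative - 1 / (2 * (t + s))) (at x)"
      by (rule DERIV_cdivide)
  qed
  also note alg[of "gauss (t + s) (x - a)" "x - a" "t + s"]
  finally show "((\<lambda>y. gauss (t + s) (y - a) * (- (y - a) / (2 * (t + s)))) has_real_derivative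
    gauss (t + s) (x - a) * ((x - a)\<^sup>2 / (4 * (t + s)\<^sup>2) - 1 / (2 * (t + s)))) (at x)" .
qed

text \<open>The lower barrier is a heat kernel started at a small time, minus a constant that makes it
  nonpositive outside \<open>[x0 - r, x0 + r]\<close>.\<close>

lemma positivity_spreads:
  fixes r R h :: real
  assumes r: "r > 0" and R: "R > 0" and h: "h \<ge> 0"
  shows "\<exists>\<epsilon>0>0. \<forall>w T x0 m. 0 \<le> m \<longrightarrow> continuous_on ({T..T+1+h} \<times> UNIV) (\<lambda>(t,x). w t x) \<longrightarrow>
     (\<forall>t\<in>{T..T+1+h}. \<forall>x. 0 \<le> w t x) \<longrightarrow>
     (\<forall>t\<in>{T<..T+1+h}. \<forall>x. \<exists>p r. heat_jet w t x p r \<and> r - w t x \<le> p) \<longrightarrow>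
     (\<forall>x. \<bar>x - x0\<bar> \<le> r \<longrightarrow> m \<le> w T x) \<longrightarrow>
     (\<forall>t\<in>{T+1..T+1+h}. \<forall>x. \<bar>x - x0\<bar> \<le> R \<longrightarrow> \<epsilon>0 * m \<le> w t x)"
proof -
  \<comment> \<open>A lower bound for the kernel at distance at most R and at ages between 1 and 2 +
    h.\<close>
  define b where "b = exp (- R\<^sup>2 / 4 - ln (2 + h) / 2)"
  have b: "b > 0" by (simp add: b_def)
  \<comment> \<open>At a small enough starting age the kernel at distance r is below b / 2, so
    subtracting that value costs at most half of the later lower bound.\<close>
  have "((\<lambda>s. exp (- r\<^sup>2 / (4 * s) - ln s / 2)) \<longlongrightarrow> 0) (at_right 0)"
    using r by real_asymp
  then have "\<forall>\<^sub>F s in at_right 0. exp (- r\<^sup>2 / (4 * s) - ln s / 2) < b / 2"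
    using b by (intro order_tendstoD) auto
  moreover have "\<forall>\<^sub>F s in at_right (0::real). s < 1" "\<forall>\<^sub>F s in at_right (0::real). s > 0"
    by (auto simp: eventually_at_right_less eventually_at_right[OF zero_less_one] intro: exI[of _ 1])
  ultimately have "\<forall>\<^sub>F s in at_right 0. gauss s r < b / 2 \<and> s < 1 \<and> s > 0"
    unfolding gauss_def by eventually_elim auto
  then obtain s where s: "gauss s r < b / 2" "s < 1" "0 < s"
    using eventually_happens'[OF trivial_limit_at_right_real] by blast
  \<comment> \<open>The reciprocal of the kernel's maximum at age s, so that the normalised kernel
    never exceeds 1. All constants so far depend on r, R and h alone.\<close>
  define C where "C = exp (ln s / 2)"
  have C: "C > 0" by (simp add: C_def)
  define \<epsilon>0 where "\<epsilon>0 = C * exp (- (1 + h)) * (b / 2)"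
  show ?thesis
  proof (intro exI[of _ \<epsilon>0] conjI allI impI ballI)
    show "\<epsilon>0 > 0" unfolding \<epsilon>0_def using b C by simp
    fix w T x0 m t x
    assume m: "0 \<le> (m::real)" and cont: "continuous_on ({T..T+1+h} \<times> UNIV) (\<lambda>(t,x). w t x)"
      and pos: "\<forall>t\<in>{T..T+1+h}. \<forall>x. 0 \<le> w t x"
      and jet: "\<forall>t\<in>{T<..T+1+h}. \<forall>x. \<exists>p r. heat_jet w t x p r \<and> r - w t x \<le> p"
      and init: "\<forall>x. \<bar>x - x0\<bar> \<le> r \<longrightarrow> m \<le> w T x"
      and t: "t \<in> {T+1..T+1+h}" and x: "\<bar>x - x0\<bar> \<le> R"
    \<comment> \<open>The factor exp(T - t) accounts for the zero order term: P solves P_t = P_xx -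
      P exactly, including the subtracted constant.\<close>
    define P where "P t x = m * C * (exp (T - t) * (gauss (t + (s - T)) (x - x0) - gauss s r))" for t x
    have CG: "C * gauss s' y \<le> 1" if "s' \<ge> s" for s' y
    proof -
      have "- y\<^sup>2 / (4 * s') \<le> 0" using that s by (simp add: divide_nonpos_pos)
      moreover have "ln s / 2 \<le> ln s' / 2" using that s by simp
      ultimately have "ln s / 2 + (- y\<^sup>2 / (4 * s') - ln s' / 2) \<le> 0" by linarith
      then show ?thesis unfolding C_def gauss_def exp_add[symmetric] by simp
    qed
    have gpos: "gauss s' y > 0" for s' y by (simp add: gauss_def)
    have Pm: "P t x \<le> m" if "t \<ge> T" for t x
    proof -
      have "C * (gauss (t + (s - T)) (x - x0) - gauss s r) \<le> 1"
        using CG[of "t + (s - T)" "x - x0"] that gpos[of s r] C by (simp add: algebra_simps) (smt (verit) mult_pos_pos)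
      then have "exp (T - t) * (C * (gauss (t + (s - T)) (x - x0) - gauss s r)) \<le> exp (T - t) * 1"
        by (intro mult_left_mono) auto
      also have "\<dots> \<le> 1" using that by simp
      finally have "m * (exp (T - t) * (C * (gauss (t + (s - T)) (x - x0) - gauss s r))) \<le> m * 1"
        using m by (intro mult_left_mono) auto
      then show ?thesis unfolding P_def by (simp add: algebra_simps)
    qed
    have "0 \<le> w t x - P t x"
    proof (rule parabolic_comparison[where h = 0 and L = 0 and ?t0.0 = T and ?t1.0 = "T+1+h" and N = m
          and w = "\<lambda>t x. w t x - P t x"])
      have "continuous_on ({T..T+1+h} \<times> UNIV) (\<lambda>(t,x). P t x)"
        unfolding P_def gauss_def case_prod_unfold using s by (intro continuous_intros) auto
      then show "continuous_on ({T - 0..T+1+h} \<times> UNIV) (\<lambda>(t,x). w t x - P t x)"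
        using cont unfolding case_prod_unfold by (auto intro!: continuous_intros)
      show "- m \<le> w t x - P t x" if "t \<in> {T - 0..T+1+h}" for t x
        using pos[rule_format, of t x] Pm[of t x] that by auto
      show "0 \<le> w t x - P t x" if "t \<in> {T - 0..T}" for t x
      proof -
        have tT: "t = T" using that by simp
        have w: "0 \<le> w T x" using pos h by auto
        show ?thesis
        proof (cases "\<bar>x - x0\<bar> \<le> r")
          case True
          then show ?thesis using init Pm[of T x] unfolding tT by fastforce
        next
          case False
          then have "r\<^sup>2 \<le> (x - x0)\<^sup>2" using r by (simp add: abs_le_square_iff[symmetric])
          then have "- (x - x0)\<^sup>2 / (4 * s) \<le> - r\<^sup>2 / (4 * s)" using s by (intro divide_right_mono) auto
          then have "gauss (T + (s - T)) (x - x0) \<le> gauss s r" unfolding gauss_def by simp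
          then have "P T x \<le> 0" unfolding P_def using m C by (intro mult_nonneg_nonpos) (auto simp: mult_nonneg_nonpos)
          then show ?thesis using w unfolding tT by linarith
        qed
      qed
      show "\<exists>p r. heat_jet (\<lambda>t x. w t x - P t x) t x p r \<and>
          r - (w t x - P t x) - 0 * max 0 (- (w (t - 0) x - P (t - 0) x)) \<le> p"
        if "T < t" "t \<le> T+1+h" for t x
      proof -
        define g where "g = gauss (t + (s - T)) (x - x0) * ((x - x0)\<^sup>2 / (4 * (t + (s - T))\<^sup>2) - 1 / (2 * (t + (s - T))))"
        have jg: "heat_jet (\<lambda>t x. gauss (t + (s - T)) (x - x0)) t x g g"
          unfolding g_def by (rule heat_jet_gauss) (use that s in auto)
        then obtain d where d: "((\<lambda>t. gauss (t + (s - T)) (x - x0)) has_real_derivative g) (at t)"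
          "\<And>y. ((\<lambda>x. gauss (t + (s - T)) (x - x0)) has_real_derivative d y) (at y)"
          "(d has_real_derivative g) (at x)"
          unfolding heat_jet_def by blast
        have jP: "heat_jet P t x (m * C * exp (T - t) * g - P t x) (m * C * exp (T - t) * g)"
        proof (rule heat_jetI)
          show "((\<lambda>t. P t x) has_real_derivative m * C * exp (T - t) * g - P t x) (at t)"
            unfolding P_def by (rule derivative_eq_intros d refl)+ (simp add: algebra_simps)
          show "(P t has_real_derivative m * C * exp (T - t) * d y) (at y)" for y
          proof -
            have "((\<lambda>x. m * C * (exp (T - t) * (gauss (t + (s - T)) (x - x0) - gauss s r))) has_real_derivative
                m * C * (exp (T - t) * (d y - 0))) (at y)"
              by (rule DERIV_cmult, rule DERIV_cmult, rule DERIV_diff, rule d, rule DERIV_const)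
            then show ?thesis unfolding P_def[abs_def] by (simp add: mult.assoc)
          qed
          show "((\<lambda>y. m * C * exp (T - t) * d y) has_real_derivative m * C * exp (T - t) * g) (at x)"
            by (rule DERIV_cmult[OF d(3)])
        qed
        have "t \<in> {T<..T+1+h}" using that by simp
        then obtain p r where pr: "heat_jet w t x p r" "r - w t x \<le> p" using jet by blast
        show ?thesis
          by (intro exI conjI, rule heat_jet_diff[OF pr(1) jP]) (use pr(2) in simp)
      qed
    qed (use t h in auto)
    moreover have "\<epsilon>0 * m \<le> P t x"
    proof -
      define s' where "s' = t + (s - T)"
      have s': "1 \<le> s'" "s' \<le> 2 + h" using t s by (auto simp: s'_def)
      have "(x - x0)\<^sup>2 \<le> R\<^sup>2" using x R by (simp add: abs_le_square_iff[symmetric])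
      then have "(x - x0)\<^sup>2 / (4 * s') \<le> R\<^sup>2 / 4" using s' by (intro frac_le) auto
      moreover have "ln s' \<le> ln (2 + h)" using s' by simp
      ultimately have "b \<le> gauss s' (x - x0)" unfolding b_def gauss_def by simp
      then have "b / 2 \<le> gauss s' (x - x0) - gauss s r" using s by linarith
      moreover have "exp (- (1 + h)) \<le> exp (T - t)" using t by simp
      ultimately have "exp (- (1 + h)) * (b / 2) \<le> exp (T - t) * (gauss s' (x - x0) - gauss s r)"
        using b by (intro mult_mono) auto
      then have "m * C * (exp (- (1 + h)) * (b / 2)) \<le> P t x"
        unfolding P_def s'_def[symmetric] using m C by (intro mult_left_mono) auto
      then show ?thesis unfolding \<epsilon>0_def by (simp add: algebra_simps)
    qed
    ultimately show "\<epsilon>0 * m \<le> w t x" by linarith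
  qed
qed

section \<open>The bounded solution operator of the profile equation\<close>

definition bcont :: "(real \<Rightarrow> real) \<Rightarrow> bool" where
  "bcont f \<longleftrightarrow> continuous_on UNIV f \<and> (\<exists>B. \<forall>x. \<bar>f x\<bar> \<le> B)"

lemma bcontI: "continuous_on UNIV f \<Longrightarrow> (\<And>x. \<bar>f x\<bar> \<le> B) \<Longrightarrow> bcont f"
  unfolding bcont_def by blast

lemma bcont_bound:
  assumes "bcont f" obtains B where "B > 0" "\<And>x. \<bar>f x\<bar> \<le> B"
proof -
  obtain B where B: "\<And>x. \<bar>f x\<bar> \<le> B" using assms unfolding bcont_def by blast
  have "\<bar>f x\<bar> \<le> \<bar>B\<bar> + 1" for x using B[of x] by linarith
  then show ?thesis using that[of "\<bar>B\<bar> + 1"] by simp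
qed

lemma bcont_continuous: "bcont f \<Longrightarrow> continuous_on UNIV f" unfolding bcont_def by blast

lemma bcont_measurable: "bcont f \<Longrightarrow> f \<in> borel_measurable borel"
  by (intro borel_measurable_continuous_onI bcont_continuous)

lemma bcont_const: "bcont (\<lambda>x. k)" by (rule bcontI[of _ "\<bar>k\<bar>"]) auto

lemma bcont_add: assumes "bcont f" "bcont g" shows "bcont (\<lambda>x. f x + g x)"
proof -
  obtain B C where "\<And>x. \<bar>f x\<bar> \<le> B" "\<And>x. \<bar>g x\<bar> \<le> C" using assms unfolding bcont_def by blast
  then show ?thesis using assms[THEN bcont_continuous]
    by (intro bcontI[of _ "B + C"] continuous_intros) (auto intro: order_trans[OF abs_triangle_ineq add_mono])
qed

lemma bcont_cmult: assumes "bcont f" shows "bcont (\<lambda>x. k * f x)"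
proof -
  obtain B where "\<And>x. \<bar>f x\<bar> \<le> B" using assms unfolding bcont_def by blast
  then show ?thesis using assms[THEN bcont_continuous]
    by (intro bcontI[of _ "\<bar>k\<bar> * B"] continuous_intros) (auto simp: abs_mult mult_left_mono)
qed

lemma bcont_diff: "bcont f \<Longrightarrow> bcont g \<Longrightarrow> bcont (\<lambda>x. f x - g x)"
  using bcont_add[of f "\<lambda>x. (-1) * g x"] bcont_cmult[of g "-1"] by simp

lemma bcont_compose_affine: assumes "bcont f" shows "bcont (\<lambda>x. f (k * x + a))"
proof -
  have "continuous_on UNIV (f \<circ> (\<lambda>x. k * x + a))"
    using assms by (intro continuous_on_compose continuous_intros continuous_on_subset[OF bcont_continuous]) auto
  then show ?thesis using assms unfolding bcont_def o_def by blast
qed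

lemma bcont_translate: "bcont f \<Longrightarrow> bcont (\<lambda>x. f (x + a))"
  using bcont_compose_affine[of f 1 a] by simp

lemma bcont_translate_minus: "bcont f \<Longrightarrow> bcont (\<lambda>x. f (x - a))"
  using bcont_compose_affine[of f 1 "-a"] by simp

lemma bcont_reflect: "bcont f \<Longrightarrow> bcont (\<lambda>x. f (- x))"
  using bcont_compose_affine[of f "-1" 0] by simp

lemma bcont_min: assumes "continuous_on UNIV f" "bcont g" "\<And>x. 0 \<le> f x" "\<And>x. 0 \<le> g x"
  shows "bcont (\<lambda>x. min (f x) (g x))"
proof -
  obtain B where B: "\<And>x. \<bar>g x\<bar> \<le> B" using assms unfolding bcont_def by blast
  have "\<bar>min (f x) (g x)\<bar> \<le> B" for x using B[of x] assms(3,4)[of x] by auto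
  then show ?thesis using assms bcont_continuous by (intro bcontI continuous_intros) auto
qed

section \<open>One-sided exponential means\<close>

definition expo :: "real \<Rightarrow> real measure" where
  "expo r = density lborel (exponential_density r)"

text \<open>This is r (D + r)^(-1), the mean of f to the left of z under an exponential law. As
  integration against a probability measure it is monotone and fixes constants.\<close>

definition Ep :: "real \<Rightarrow> (real \<Rightarrow> real) \<Rightarrow> real \<Rightarrow> real" where
  "Ep r f z = (\<integral>y. f (z - y) \<partial>expo r)"

text \<open>The mirror image r (r - D)^(-1), the mean of f to the right of z; defined by reflection
  so that its properties are transported from \<open>Ep\<close>.\<close>

definition Em :: "real \<Rightarrow> (real \<Rightarrow> real) \<Rightarrow> real \<Rightarrow> real" where
  "Em r f z = Ep r (\<lambda>x. f (- x)) (- z)"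

lemma sets_expo [simp, measurable_cong]: "sets (expo r) = sets borel"
  by (simp add: expo_def)

lemma prob_space_expo: "r > 0 \<Longrightarrow> prob_space (expo r)"
  unfolding expo_def by (rule prob_space_exponential_density)

lemma AE_expo: "r > 0 \<Longrightarrow> AE y in expo r. 0 \<le> y"
  unfolding expo_def by (subst AE_density) (auto simp: exponential_density_def)

lemma integrable_expo:
  assumes "r > 0" "bcont f" shows "integrable (expo r) (\<lambda>y. f (z - y))"
proof -
  interpret prob_space "expo r" by (rule prob_space_expo[OF assms(1)])
  obtain B where "\<And>x. \<bar>f x\<bar> \<le> B" using assms(2) unfolding bcont_def by blast
  moreover have "(\<lambda>y. f (z - y)) \<in> borel_measurable borel"
    using bcont_measurable[OF bcont_compose_affine[OF assms(2), of "-1" z]] by (simp add: algebra_simps)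
  ultimately show ?thesis by (intro integrable_const_bound[of _ B]) (auto simp: measurable_cong_sets[OF sets_expo refl])
qed

lemma Ep_mono:
  assumes r: "r > 0" and "bcont f" "bcont g" "\<And>x. x \<le> z \<Longrightarrow> f x \<le> g x"
  shows "Ep r f z \<le> Ep r g z"
  unfolding Ep_def
  by (rule integral_mono_AE) (use assms AE_expo[OF r] integrable_expo in auto)

lemma Ep_const: "r > 0 \<Longrightarrow> Ep r (\<lambda>x. k) z = k"
  using prob_space.prob_space[OF prob_space_expo, of r] unfolding Ep_def by simp

lemma Ep_add: "r > 0 \<Longrightarrow> bcont f \<Longrightarrow> bcont g \<Longrightarrow> Ep r (\<lambda>x. f x + g x) z = Ep r f z + Ep r g z"
  unfolding Ep_def by (intro Bochner_Integration.integral_add integrable_expo)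

lemma Ep_cmult: "Ep r (\<lambda>x. k * f x) z = k * Ep r f z"
  unfolding Ep_def by simp

lemma Ep_translate: "Ep r (\<lambda>x. f (x + a)) z = Ep r f (z + a)"
  unfolding Ep_def by (simp add: algebra_simps)

text \<open>Tilting the exponential density of rate r by exp(-l y) gives r / (r + l) times the
  density of rate r + l. The sign of C is free, so C = -1 turns the result into a lower
  bound.\<close>

lemma Ep_exp_bound:
  assumes r: "r > 0" and l: "r + l > 0" and f: "bcont f" and le: "\<And>x. x \<le> z \<Longrightarrow> f x \<le> C * exp (l * x)"
  shows "Ep r f z \<le> C * (r / (r + l)) * exp (l * z)"
proof -
  have e: "exponential_density r y * exp (l * (z - y)) = r / (r + l) * exp (l * z) * exponential_density (r + l) y" for y
  proof -
    have "exp (- y * r) * exp (l * (z - y)) = exp (l * z) * exp (- y * (r + l))"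
      by (simp add: exp_add[symmetric] algebra_simps)
    then show ?thesis using l unfolding exponential_density_def by simp
  qed
  interpret E: prob_space "expo (r + l)" by (rule prob_space_expo[OF l])
  have int1: "integrable (density lborel (exponential_density (r + l))) (\<lambda>y. 1::real)"
    using E.integrable_const[of 1] by (simp add: expo_def)
  then have int2: "integrable lborel (exponential_density (r + l))"
    by (subst (asm) integrable_density) (use l in \<open>auto simp: exponential_density_nonneg\<close>)
  have one: "integral\<^sup>L lborel (exponential_density (r + l)) = 1"
  proof -
    have "1 = (\<integral>y. (1::real) \<partial>density lborel (exponential_density (r + l)))"
      using Ep_const[OF l, of 1 0] unfolding Ep_def expo_def by simp
    also have "\<dots> = integral\<^sup>L lborel (exponential_density (r + l))"
      by (subst integral_density) (use l in \<open>auto simp: exponential_density_nonneg\<close>)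
    finally show ?thesis by simp
  qed
  have "(\<integral>y. C * exp (l * (z - y)) \<partial>expo r) = (\<integral>y. exponential_density r y *\<^sub>R (C * exp (l * (z - y))) \<partial>lborel)"
    unfolding expo_def by (rule integral_density) (use r in \<open>auto simp: exponential_density_nonneg\<close>)
  also have "\<dots> = (\<integral>y. C * (r / (r + l) * exp (l * z)) * exponential_density (r + l) y \<partial>lborel)"
    by (intro Bochner_Integration.integral_cong refl) (use e in \<open>auto simp: algebra_simps\<close>)
  also have "\<dots> = C * (r / (r + l) * exp (l * z))" using one by simp
  finally have val: "(\<integral>y. C * exp (l * (z - y)) \<partial>expo r) = C * (r / (r + l)) * exp (l * z)" by simp
  have "integrable (expo r) (\<lambda>y. C * exp (l * (z - y)))"
    unfolding expo_def
  proof (subst integrable_density)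
    have "integrable lborel (\<lambda>y. C * (r / (r + l) * exp (l * z)) * exponential_density (r + l) y)"
      using int2 by simp
    also have "(\<lambda>y. C * (r / (r + l) * exp (l * z)) * exponential_density (r + l) y)
        = (\<lambda>y. exponential_density r y *\<^sub>R (C * exp (l * (z - y))))"
      using e by (intro ext) (simp add: algebra_simps)
    finally show "integrable lborel (\<lambda>y. exponential_density r y *\<^sub>R (C * exp (l * (z - y))))" .
  qed (use r in \<open>auto simp: exponential_density_nonneg\<close>)
  moreover have "AE y in expo r. f (z - y) \<le> C * exp (l * (z - y))"
    using AE_expo[OF r] by eventually_elim (use le in simp)
  ultimately have "Ep r f z \<le> (\<integral>y. C * exp (l * (z - y)) \<partial>expo r)"
    unfolding Ep_def by (intro integral_mono_AE[OF integrable_expo[OF r f]])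
  then show ?thesis using val by simp
qed

lemma Ep_tendsto_seq:
  assumes r: "r > 0" and f: "\<And>n. bcont (f n)" and g: "bcont g"
    and B: "\<And>n x. \<bar>f n x\<bar> \<le> B" and lim: "\<And>x. (\<lambda>n. f n x) \<longlonglongrightarrow> g x"
  shows "(\<lambda>n. Ep r (f n) z) \<longlonglongrightarrow> Ep r g z"
proof -
  interpret prob_space "expo r" by (rule prob_space_expo[OF r])
  show ?thesis unfolding Ep_def
    by (rule integral_dominated_convergence[where w = "\<lambda>_. B"])
       (use integrable_expo[OF r] f g B lim in \<open>auto intro: borel_measurable_integrable\<close>)
qed

lemma Ep_tendsto_at_top:
  assumes r: "r > 0" and f: "bcont f" and lim: "(f \<longlongrightarrow> l) at_top"
  shows "(Ep r f \<longlongrightarrow> l) at_top"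
proof -
  interpret prob_space "expo r" by (rule prob_space_expo[OF r])
  obtain B where B: "\<And>x. \<bar>f x\<bar> \<le> B" using f unfolding bcont_def by blast
  have "((\<lambda>z. \<integral>y. f (z - y) \<partial>expo r) \<longlongrightarrow> (\<integral>y. l \<partial>expo r)) at_top"
  proof (rule integral_dominated_convergence_at_top[where w = "\<lambda>_. B"])
    show "AE y in expo r. ((\<lambda>z. f (z - y)) \<longlongrightarrow> l) at_top"
    proof (rule AE_I2)
      fix y :: real
      have "filterlim (\<lambda>z. z - y) at_top at_top"
        using filterlim_tendsto_add_at_top[OF tendsto_const filterlim_ident, of "-y"] by simp
      then show "((\<lambda>z. f (z - y)) \<longlongrightarrow> l) at_top" by (rule filterlim_compose[OF lim])
    qed
  qed (use integrable_expo[OF r f] B in \<open>auto intro: borel_measurable_integrable\<close>)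
  then show ?thesis using prob_space unfolding Ep_def by simp
qed

lemma Ep_tendsto_at_bot:
  assumes r: "r > 0" and f: "bcont f" and lim: "(f \<longlongrightarrow> l) at_bot"
  shows "(Ep r f \<longlongrightarrow> l) at_bot"
proof -
  interpret prob_space "expo r" by (rule prob_space_expo[OF r])
  obtain B where B: "\<And>x. \<bar>f x\<bar> \<le> B" using f unfolding bcont_def by blast
  have "((\<lambda>z. \<integral>y. f (- z - y) \<partial>expo r) \<longlongrightarrow> (\<integral>y. l \<partial>expo r)) at_top"
  proof (rule integral_dominated_convergence_at_top[where w = "\<lambda>_. B"])
    show "AE y in expo r. ((\<lambda>z. f (- z - y)) \<longlongrightarrow> l) at_top"
    proof (rule AE_I2)
      fix y :: real
      have "filterlim (\<lambda>z. y + z) at_top at_top"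
        by (rule filterlim_tendsto_add_at_top[OF tendsto_const filterlim_ident])
      then have "filterlim (\<lambda>z. - z - y) at_bot at_top"
        unfolding filterlim_uminus_at_bot by (simp add: add.commute)
      then show "((\<lambda>z. f (- z - y)) \<longlongrightarrow> l) at_top" by (rule filterlim_compose[OF lim])
    qed
  qed (use integrable_expo[OF r f] B in \<open>auto intro: borel_measurable_integrable\<close>)
  then have "((\<lambda>z. Ep r f (- z)) \<longlongrightarrow> l) at_top" using prob_space unfolding Ep_def by simp
  then show ?thesis by (simp add: filterlim_at_bot_mirror)
qed

text \<open>Substituting x = z - y writes the mean as exp(-r z) times the integral of r exp(r x)
  f(x) over x \<le> z; the fundamental theorem of calculus applies to the second factor although f
  is only continuous.\<close>

lemma Ep_deriv:
  assumes r: "r > 0" and f: "bcont f"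
  shows "(Ep r f has_real_derivative r * (f z - Ep r f z)) (at z)"
proof -
  define G where "G x = r * exp (r * x) * f x" for x
  have cG: "continuous_on A G" for A
    unfolding G_def using bcont_continuous[OF f] by (intro continuous_intros continuous_on_subset[OF bcont_continuous[OF f]]) auto
  have meas: "(\<lambda>y. f (z - y)) \<in> borel_measurable borel" for z
    using bcont_measurable[OF bcont_compose_affine[OF f, of "-1" z]] by (simp add: algebra_simps)
  have kern: "exponential_density r (z - x) * f x = exp (- r * z) * (indicator {..z} x * G x)" for z x
  proof -
    have "exp (- (z - x) * r) = exp (- r * z) * exp (r * x)" by (simp add: exp_add[symmetric] algebra_simps)
    then show ?thesis unfolding exponential_density_def G_def by (simp add: indicator_def)
  qed
  have int0: "integrable lborel (\<lambda>y. exponential_density r y *\<^sub>R f (z - y))" for z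
    using integrable_expo[OF r f, of z] unfolding expo_def
    by (subst (asm) integrable_density) (use r meas in \<open>auto simp: exponential_density_nonneg\<close>)
  have int1: "integrable lborel (\<lambda>x. exponential_density r (z - x) * f x)" for z
    using lborel_integrable_real_affine[OF int0[of z], of "-1" z] by simp
  have int: "integrable lborel (\<lambda>x. indicator {..z} x * G x)" for z
    using integrable_mult_right[OF int1[of z], of "exp (r * z)"]
    unfolding kern by (simp add: mult.assoc[symmetric] exp_add[symmetric])
  define F where "F z = (\<integral>x. indicator {..z} x * G x \<partial>lborel)" for z
  have EF: "Ep r f z = exp (- r * z) * F z" for z
  proof -
    have "Ep r f z = (\<integral>y. exponential_density r y *\<^sub>R f (z - y) \<partial>lborel)"
      unfolding Ep_def expo_def by (rule integral_density) (use r meas in \<open>auto simp: exponential_density_nonneg\<close>)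
    also have "\<dots> = (\<integral>x. exponential_density r (z - x) * f x \<partial>lborel)"
      using lborel_integral_real_affine[of "-1" "\<lambda>y. exponential_density r y *\<^sub>R f (z - y)" z] by simp
    also have "\<dots> = exp (- r * z) * F z" unfolding F_def kern by simp
    finally show ?thesis .
  qed
  have diff: "F v - F w = integral {w..v} G" if "w \<le> v" for v w
  proof -
    have "F v - F w = (\<integral>x. indicator {..v} x * G x - indicator {..w} x * G x \<partial>lborel)"
      unfolding F_def by (rule Bochner_Integration.integral_diff[symmetric]) (rule int)+
    also have "\<dots> = (\<integral>x. indicator {w<..v} x *\<^sub>R G x \<partial>lborel)"
      using that by (intro Bochner_Integration.integral_cong) (auto simp: indicator_def)
    also have "\<dots> = (LINT x:{w..v}|lborel. G x)"
      unfolding set_lebesgue_integral_def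
    proof (rule integral_cong_AE)
      have [measurable]: "G \<in> borel_measurable borel" by (rule borel_measurable_continuous_onI[OF cG])
      show "(\<lambda>x. indicator {w<..v} x *\<^sub>R G x) \<in> borel_measurable lborel" by measurable
      show "(\<lambda>x. indicator {w..v} x *\<^sub>R G x) \<in> borel_measurable lborel" by measurable
      show "AE x in lborel. indicator {w<..v} x *\<^sub>R G x = indicator {w..v} x *\<^sub>R G x"
        using AE_lborel_singleton[of w] by eventually_elim (auto simp: indicator_def)
    qed
    also have "\<dots> = integral {w..v} G"
      by (intro set_borel_integral_eq_integral borel_integrable_atLeastAtMost') (rule cG)
    finally show ?thesis .
  qed
  have "((\<lambda>u. integral {z-1..u} G) has_real_derivative G z) (at z within {z-1..z+1})"
    by (intro integral_has_real_derivative cG) auto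
  then have "((\<lambda>u. integral {z-1..u} G) has_real_derivative G z) (at z)"
    by (subst (asm) at_within_interior) auto
  then have d: "((\<lambda>u. F (z - 1) + integral {z-1..u} G) has_real_derivative G z) (at z)"
    by (auto intro!: derivative_eq_intros)
  have dF: "(F has_real_derivative G z) (at z)"
  proof (rule has_field_derivative_transform_within_open[OF d, of "{z-1<..<z+1}"])
    show "F (z - 1) + integral {z-1..u} G = F u" if "u \<in> {z-1<..<z+1}" for u
      using diff[of "z - 1" u] that by simp
  qed auto
  have "((\<lambda>z. exp (- r * z) * F z) has_real_derivative - r * exp (- r * z) * F z + exp (- r * z) * G z) (at z)"
    by (auto intro!: derivative_eq_intros dF)
  also have "- r * exp (- r * z) * F z + exp (- r * z) * G z = r * (f z - Ep r f z)"
  proof -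
    have "exp (- r * z) * exp (r * z) = 1" by (simp add: exp_add[symmetric])
    then have "exp (- r * z) * (r * exp (r * z) * f z) = r * f z" by (simp add: algebra_simps)
    then show ?thesis unfolding EF G_def by (simp add: algebra_simps)
  qed
  finally show ?thesis unfolding EF[abs_def, symmetric] by (simp add: EF[symmetric])
qed

lemma Ep_abs_le:
  assumes r: "r > 0" and f: "bcont f" and B: "\<And>x. \<bar>f x\<bar> \<le> B"
  shows "\<bar>Ep r f z\<bar> \<le> B"
proof -
  have "f x \<le> B" "- B \<le> f x" for x using B[of x] by auto
  then have "Ep r f z \<le> Ep r (\<lambda>x. B) z" "Ep r (\<lambda>x. - B) z \<le> Ep r f z"
    using r f by (intro Ep_mono bcont_const; simp)+
  then show ?thesis using Ep_const[OF r] by simp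
qed

lemma bcont_Ep: assumes "r > 0" "bcont f" shows "bcont (Ep r f)"
proof -
  obtain B where B: "B > 0" "\<And>x. \<bar>f x\<bar> \<le> B" using bcont_bound[OF assms(2)] by blast
  have "isCont (Ep r f) z" for z by (rule DERIV_isCont[OF Ep_deriv[OF assms]])
  then have "continuous_on UNIV (Ep r f)" by (simp add: continuous_on_eq_continuous_at)
  then show ?thesis by (rule bcontI) (rule Ep_abs_le[OF assms B(2)])
qed

text \<open>The function \<open>exp (r z) * Ep r f z\<close> is nondecreasing, so it stays zero to the left of a zero.\<close>

lemma Ep_eq_0:
  assumes r: "r > 0" and f: "bcont f" and nn: "\<And>x. x \<le> z \<Longrightarrow> 0 \<le> f x" and 0: "Ep r f z = 0" and x: "x \<le> z"
  shows "f x = 0"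
proof -
  define m where "m y = exp (r * y) * Ep r f y" for y
  have dm: "(m has_real_derivative r * exp (r * y) * f y) (at y)" for y
    unfolding m_def by (auto intro!: derivative_eq_intros Ep_deriv[OF r f] simp: algebra_simps)
  have pos: "0 \<le> m y" if "y \<le> z" for y
    using Ep_mono[OF r bcont_const f, of y 0] nn that Ep_const[OF r, of 0 y] unfolding m_def by auto
  have inc: "m y \<le> m z" if "y \<le> z" for y
    by (rule DERIV_nonneg_imp_nondecreasing[OF that]) (use dm nn r in \<open>auto intro!: exI mult_nonneg_nonneg\<close>)
  have m0: "m y = 0" if "y \<le> z" for y
    using pos[OF that] inc[OF that] 0 unfolding m_def by (auto intro: antisym)
  have f0: "f y = 0" if "y < z" for y
  proof -
    have "(m has_real_derivative 0) (at y)"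
      by (rule has_field_derivative_transform_within_open[OF DERIV_const[of 0], where S = "{..<z}"]) (use that m0 in auto)
    then have "r * exp (r * y) * f y = 0" using dm DERIV_unique by blast
    then show ?thesis using r by simp
  qed
  have "f z = 0"
  proof (rule tendsto_unique)
    have "isCont f z" using bcont_continuous[OF f] by (simp add: continuous_on_eq_continuous_at)
    then show "(f \<longlongrightarrow> f z) (at_left z)"
      unfolding isCont_def by (rule filterlim_mono) (auto simp: at_le)
    show "(f \<longlongrightarrow> 0) (at_left z)"
      by (rule tendsto_eventually) (auto simp: eventually_at_left[of "z - 1"] intro!: exI[of _ "z - 1"] f0)
  qed auto
  then show ?thesis using f0 x by (cases "x = z") auto
qed

lemma Em_mono:
  assumes "r > 0" "bcont f" "bcont g" "\<And>x. f x \<le> g x"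
  shows "Em r f z \<le> Em r g z"
  unfolding Em_def using assms by (intro Ep_mono bcont_reflect) auto

lemma Em_const: "r > 0 \<Longrightarrow> Em r (\<lambda>x. k) z = k"
  unfolding Em_def by (rule Ep_const)

lemma Em_add: "r > 0 \<Longrightarrow> bcont f \<Longrightarrow> bcont g \<Longrightarrow> Em r (\<lambda>x. f x + g x) z = Em r f z + Em r g z"
  unfolding Em_def by (intro Ep_add bcont_reflect)

lemma Em_cmult: "Em r (\<lambda>x. k * f x) z = k * Em r f z"
  unfolding Em_def by (rule Ep_cmult)

lemma Em_translate: "Em r (\<lambda>x. f (x + a)) z = Em r f (z + a)"
  unfolding Em_def using Ep_translate[of r "\<lambda>x. f (- x)" "- a" "- z"] by (simp add: algebra_simps)

lemma Em_exp_bound: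
  assumes r: "r > 0" and l: "l < r" and f: "bcont f" and le: "\<And>x. f x \<le> C * exp (l * x)"
  shows "Em r f z \<le> C * (r / (r - l)) * exp (l * z)"
proof -
  have "f (- x) \<le> C * exp (- l * x)" for x using le[of "- x"] by simp
  then show ?thesis
    unfolding Em_def using Ep_exp_bound[of r "- l" "\<lambda>x. f (- x)" "- z" C] r l bcont_reflect[OF f] by simp
qed

lemma Em_tendsto_seq:
  assumes "r > 0" "\<And>n. bcont (f n)" "bcont g" "\<And>n x. \<bar>f n x\<bar> \<le> B" "\<And>x. (\<lambda>n. f n x) \<longlonglongrightarrow> g x"
  shows "(\<lambda>n. Em r (f n) z) \<longlonglongrightarrow> Em r g z"
  unfolding Em_def using assms by (intro Ep_tendsto_seq bcont_reflect) auto

lemma Em_tendsto_at_top: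
  assumes "r > 0" "bcont f" "(f \<longlongrightarrow> l) at_top"
  shows "(Em r f \<longlongrightarrow> l) at_top"
proof -
  have "((\<lambda>x. f (- x)) \<longlongrightarrow> l) at_bot" using assms(3) by (simp add: filterlim_at_bot_mirror)
  then have "(Ep r (\<lambda>x. f (- x)) \<longlongrightarrow> l) at_bot" by (intro Ep_tendsto_at_bot assms bcont_reflect)
  then show ?thesis unfolding Em_def[abs_def] by (simp add: filterlim_at_bot_mirror)
qed

lemma Em_tendsto_at_bot:
  assumes "r > 0" "bcont f" "(f \<longlongrightarrow> l) at_bot"
  shows "(Em r f \<longlongrightarrow> l) at_bot"
proof -
  have "((\<lambda>x. f (- x)) \<longlongrightarrow> l) at_top" using assms(3) by (simp add: filterlim_at_bot_mirror)
  then have "(Ep r (\<lambda>x. f (- x)) \<longlongrightarrow> l) at_top" by (intro Ep_tendsto_at_top assms bcont_reflect)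
  then show ?thesis unfolding Em_def[abs_def] by (simp add: filterlim_at_bot_mirror)
qed

lemma Em_deriv:
  assumes "r > 0" "bcont f"
  shows "(Em r f has_real_derivative r * (Em r f z - f z)) (at z)"
proof -
  have "((\<lambda>z. Ep r (\<lambda>x. f (- x)) (- z)) has_real_derivative
      r * (f (- (- z)) - Ep r (\<lambda>x. f (- x)) (- z)) * (- 1)) (at z)"
    by (rule DERIV_chain2[OF Ep_deriv[OF assms(1) bcont_reflect[OF assms(2)]]]) (auto intro!: derivative_eq_intros)
  then show ?thesis unfolding Em_def[abs_def] by (simp add: algebra_simps)
qed

lemma bcont_Em: "r > 0 \<Longrightarrow> bcont f \<Longrightarrow> bcont (Em r f)"
  using bcont_reflect[OF bcont_Ep[OF _ bcont_reflect]] unfolding Em_def[abs_def] by blast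

lemma Em_eq_0:
  assumes "r > 0" "bcont f" "\<And>x. 0 \<le> f x" "Em r f z = 0" "z \<le> x"
  shows "f x = 0"
  using Ep_eq_0[of r "\<lambda>x. f (- x)" "- z" "- x"] assms bcont_reflect unfolding Em_def by simp

section \<open>The order preserving inverse of 1 + cD - D^2\<close>

definition rate_p :: "real \<Rightarrow> real" where "rate_p c = (sqrt (c\<^sup>2 + 4) - c) / 2"
definition rate_m :: "real \<Rightarrow> real" where "rate_m c = (sqrt (c\<^sup>2 + 4) + c) / 2"

text \<open>\<open>Kop c f\<close> is the bounded solution \<open>v\<close> of \<open>v'' - c v' - v = - f\<close>; the two exponential means invert the
  factors of \<open>(D + rate_p c) (D - rate_m c)\<close>.\<close>

definition Kop :: "real \<Rightarrow> (real \<Rightarrow> real) \<Rightarrow> real \<Rightarrow> real" where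
  "Kop c f = Ep (rate_p c) (Em (rate_m c) f)"

definition Kop' :: "real \<Rightarrow> (real \<Rightarrow> real) \<Rightarrow> real \<Rightarrow> real" where
  "Kop' c f z = rate_p c * (Em (rate_m c) f z - Kop c f z)"

text \<open>The numbers \<open>- rate_p c\<close> and \<open>rate_m c\<close> are the roots of z^2 -
  c z - 1.\<close>

lemma rates: "rate_p c > 0" "rate_m c > 0" "rate_p c * rate_m c = 1" "rate_m c - rate_p c = c"
proof -
  have "\<bar>c\<bar> < sqrt (c\<^sup>2 + 4)" by (rule real_less_rsqrt) simp
  then show "rate_p c > 0" "rate_m c > 0" unfolding rate_p_def rate_m_def by auto
  have "sqrt (c\<^sup>2 + 4) * sqrt (c\<^sup>2 + 4) = c\<^sup>2 + 4" by (simp add: add_nonneg_pos)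
  then show "rate_p c * rate_m c = 1" unfolding rate_p_def rate_m_def by (simp add: algebra_simps power2_eq_square)
  show "rate_m c - rate_p c = c" unfolding rate_p_def rate_m_def by (simp add: field_simps)
qed

text \<open>From (rate_p + l) (rate_m - l) = 1 + c l - l^2: the two one-sided factors multiply to
  the symbol of the inverted operator at the exponent l.\<close>

lemma rates_exp: assumes "l > - rate_p c" "0 < 1 + c * l - l\<^sup>2"
  shows "l < rate_m c"
    and "rate_p c / (rate_p c + l) * (rate_m c / (rate_m c - l)) = 1 / (1 + c * l - l\<^sup>2)"
proof -
  have "(rate_p c + l) * (rate_m c - l) = rate_p c * rate_m c + (rate_m c - rate_p c) * l - l\<^sup>2"
    by (simp add: algebra_simps power2_eq_square)
  then have e: "(rate_p c + l) * (rate_m c - l) = 1 + c * l - l\<^sup>2" using rates by simp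
  then have "0 < (rate_p c + l) * (rate_m c - l)" using assms by simp
  then show "l < rate_m c" using assms by (simp add: zero_less_mult_iff)
  show "rate_p c / (rate_p c + l) * (rate_m c / (rate_m c - l)) = 1 / (1 + c * l - l\<^sup>2)"
    unfolding e[symmetric] using rates(3)[of c] by simp
qed

lemma bcont_Kop: "bcont f \<Longrightarrow> bcont (Kop c f)"
  unfolding Kop_def using rates by (intro bcont_Ep bcont_Em)

lemma Kop_mono: "bcont f \<Longrightarrow> bcont g \<Longrightarrow> (\<And>x. f x \<le> g x) \<Longrightarrow> Kop c f z \<le> Kop c g z"
  unfolding Kop_def using rates by (intro Ep_mono Em_mono bcont_Em)

lemma Kop_const: "Kop c (\<lambda>x. k) z = k"
proof -
  have "Em (rate_m c) (\<lambda>x. k) = (\<lambda>x. k)" using Em_const[OF rates(2)] by blast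
  then show ?thesis unfolding Kop_def using Ep_const[OF rates(1)] by simp
qed

lemma Kop_add: assumes "bcont f" "bcont g" shows "Kop c (\<lambda>x. f x + g x) z = Kop c f z + Kop c g z"
proof -
  have "Em (rate_m c) (\<lambda>x. f x + g x) = (\<lambda>x. Em (rate_m c) f x + Em (rate_m c) g x)"
    using Em_add[OF rates(2) assms] by blast
  then show ?thesis unfolding Kop_def using Ep_add[OF rates(1) bcont_Em bcont_Em] assms rates by simp
qed

lemma Kop_cmult: "Kop c (\<lambda>x. k * f x) z = k * Kop c f z"
proof -
  have "Em (rate_m c) (\<lambda>x. k * f x) = (\<lambda>x. k * Em (rate_m c) f x)" using Em_cmult by blast
  then show ?thesis unfolding Kop_def using Ep_cmult by simp
qed

lemma Kop_diff: "bcont f \<Longrightarrow> bcont g \<Longrightarrow> Kop c (\<lambda>x. f x - g x) z = Kop c f z - Kop c g z"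
  using Kop_add[of f "\<lambda>x. (-1) * g x" c z] Kop_cmult[of c "-1" g z] bcont_cmult[of g "-1"] by simp

lemma Kop_translate: "Kop c (\<lambda>x. f (x + a)) z = Kop c f (z + a)"
proof -
  have "Em (rate_m c) (\<lambda>x. f (x + a)) = (\<lambda>x. Em (rate_m c) f (x + a))" using Em_translate by blast
  then show ?thesis unfolding Kop_def using Ep_translate by simp
qed

lemma Kop_translate_minus: "Kop c (\<lambda>x. f (x - a)) z = Kop c f (z - a)"
  using Kop_translate[of c f "- a" z] by simp

lemma Em_rate_exp_bound:
  assumes "0 \<le> l" "0 < 1 + c * l - l\<^sup>2" "bcont f" "\<And>x. f x \<le> C * exp (l * x)"
  shows "Em (rate_m c) f z \<le> C * (rate_m c / (rate_m c - l)) * exp (l * z)"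
  by (rule Em_exp_bound) (use assms rates[of c] rates_exp(1)[of c l] in auto)

lemma Kop_exp_bound:
  assumes l: "0 \<le> l" "0 < 1 + c * l - l\<^sup>2" and f: "bcont f" "\<And>x. f x \<le> C * exp (l * x)"
  shows "Kop c f z \<le> C / (1 + c * l - l\<^sup>2) * exp (l * z)"
proof -
  have "Kop c f z \<le> C * (rate_m c / (rate_m c - l)) * (rate_p c / (rate_p c + l)) * exp (l * z)"
    unfolding Kop_def
    by (rule Ep_exp_bound) (use rates[of c] l f bcont_Em Em_rate_exp_bound[OF l f] in auto)
  also have "C * (rate_m c / (rate_m c - l)) * (rate_p c / (rate_p c + l))
      = C * (rate_p c / (rate_p c + l) * (rate_m c / (rate_m c - l)))"
    by (simp only: mult.assoc mult.commute mult.left_commute)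
  also have "\<dots> = C / (1 + c * l - l\<^sup>2)" using rates_exp(2)[of c l] l rates(1)[of c] by simp
  finally show ?thesis .
qed

lemma Kop_tendsto_seq:
  assumes "\<And>n. bcont (f n)" "bcont g" "\<And>n x. \<bar>f n x\<bar> \<le> B" "\<And>x. (\<lambda>n. f n x) \<longlonglongrightarrow> g x"
  shows "(\<lambda>n. Kop c (f n) z) \<longlonglongrightarrow> Kop c g z"
  unfolding Kop_def
proof (rule Ep_tendsto_seq[where B = B])
  show "\<bar>Em (rate_m c) (f n) x\<bar> \<le> B" for n x
    unfolding Em_def by (rule Ep_abs_le) (use assms rates bcont_reflect in auto)
  show "(\<lambda>n. Em (rate_m c) (f n) x) \<longlonglongrightarrow> Em (rate_m c) g x" for x
    by (rule Em_tendsto_seq[OF rates(2) assms])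
qed (use rates assms bcont_Em in auto)

lemma Kop_tendsto_at_top: "bcont f \<Longrightarrow> (f \<longlongrightarrow> l) at_top \<Longrightarrow> (Kop c f \<longlongrightarrow> l) at_top"
  unfolding Kop_def by (intro Ep_tendsto_at_top Em_tendsto_at_top bcont_Em rates)

lemma Kop_tendsto_at_bot: "bcont f \<Longrightarrow> (f \<longlongrightarrow> l) at_bot \<Longrightarrow> (Kop c f \<longlongrightarrow> l) at_bot"
  unfolding Kop_def by (intro Ep_tendsto_at_bot Em_tendsto_at_bot bcont_Em rates)

lemma Kop_deriv: "bcont f \<Longrightarrow> (Kop c f has_real_derivative Kop' c f z) (at z)"
  unfolding Kop'_def Kop_def by (intro Ep_deriv bcont_Em rates)

lemma Kop'_deriv:
  assumes f: "bcont f"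
  shows "(Kop' c f has_real_derivative (c * Kop' c f z + Kop c f z - f z)) (at z)"
proof -
  have "(Kop' c f has_real_derivative
      rate_p c * (rate_m c * (Em (rate_m c) f z - f z) - Kop' c f z)) (at z)"
    unfolding Kop'_def[abs_def] by (intro DERIV_cmult DERIV_diff Em_deriv rates f Kop_deriv[unfolded Kop'_def])
  moreover have "rate_p c * (rate_m c * (Em (rate_m c) f z - f z) - Kop' c f z)
     = c * Kop' c f z + Kop c f z - f z"
  proof -
    have E: "Em (rate_m c) f z = Kop c f z + rate_m c * Kop' c f z"
    proof -
      have "rate_m c * Kop' c f z = (rate_p c * rate_m c) * (Em (rate_m c) f z - Kop c f z)"
        unfolding Kop'_def by simp
      then show ?thesis using rates(3)[of c] by simp
    qed
    have m: "rate_m c * Kop' c f z = rate_p c * Kop' c f z + c * Kop' c f z"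
    proof -
      have "rate_m c = rate_p c + c" using rates(4)[of c] by simp
      then show ?thesis by (simp only: distrib_right)
    qed
    have "rate_p c * (rate_m c * (Em (rate_m c) f z - f z) - Kop' c f z)
      = (rate_p c * rate_m c) * (Em (rate_m c) f z - f z) - rate_p c * Kop' c f z" by (simp add: algebra_simps)
    also have "\<dots> = Em (rate_m c) f z - f z - rate_p c * Kop' c f z" using rates(3)[of c] by simp
    finally show ?thesis using E m by linarith
  qed
  ultimately show ?thesis by simp
qed

lemma bcont_Kop': "bcont f \<Longrightarrow> bcont (Kop' c f)"
  unfolding Kop'_def[abs_def] by (intro bcont_cmult bcont_diff bcont_Em bcont_Kop rates)

lemma Kop_nonneg: "bcont f \<Longrightarrow> (\<And>x. 0 \<le> f x) \<Longrightarrow> 0 \<le> Kop c f z"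
  using Kop_mono[OF bcont_const, of f 0 c z] Kop_const[of c 0 z] by simp

lemma Kop_le: "bcont f \<Longrightarrow> (\<And>x. f x \<le> k) \<Longrightarrow> Kop c f z \<le> k"
  using Kop_mono[OF _ bcont_const, of f k c z] Kop_const[of c k z] by simp

text \<open>The strong maximum principle in integral form. A zero of the left mean makes the right
  mean vanish at every point to the left, and a zero of the right mean at \<open>min x z\<close>
  makes f vanish at x.\<close>

lemma Kop_eq_0:
  assumes f: "bcont f" "\<And>x. 0 \<le> f x" and 0: "Kop c f z = 0"
  shows "f x = 0"
proof -
  have nn: "0 \<le> Em (rate_m c) f y" for y
    using Em_mono[OF rates(2) bcont_const f(1), of 0 c y] f(2) Em_const[OF rates(2), of c 0 y] by simp
  have "Em (rate_m c) f (min x z) = 0"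
    by (rule Ep_eq_0[OF rates(1)[of c] bcont_Em[OF rates(2) f(1)]]) (use 0 nn in \<open>auto simp: Kop_def\<close>)
  then show ?thesis using Em_eq_0[OF rates(2) f, of c "min x z" x] by simp
qed

lemma mono_Kop: assumes f: "bcont f" "mono f" shows "mono (Kop c f)"
proof
  fix x y :: real assume "x \<le> y"
  have "Kop c f x \<le> Kop c (\<lambda>z. f (z + (y - x))) x"
    using \<open>x \<le> y\<close> f by (intro Kop_mono bcont_translate) (auto simp: mono_def)
  then show "Kop c f x \<le> Kop c f y" using Kop_translate[of c f "y - x" x] by simp
qed

text \<open>The function \<open>exp (k x) + exp (- k x)\<close> with small \<open>k\<close> is a coercive strict supersolution.\<close>

lemma bounded_max_principle:
  fixes D :: "real \<Rightarrow> real"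
  assumes D: "\<And>x. (D has_real_derivative D' x) (at x)" "\<And>x. (D' has_real_derivative D'' x) (at x)"
    and bdd: "\<And>x. - B \<le> D x" and ineq: "\<And>x. D'' x - c * D' x - D x \<le> 0"
  shows "0 \<le> D x"
proof (rule ccontr)
  assume neg: "\<not> 0 \<le> D x"
  \<comment> \<open>Chosen so that k^2 \<le> 1/4 and |c| k \<le> 1/2; then b'' - c b' - b \<le> (1/4
    + 1/2 - 1) b < 0.\<close>
  define k where "k = 1 / (2 * (1 + \<bar>c\<bar>))"
  have k: "k > 0" "k \<le> 1/2" "\<bar>c\<bar> * k \<le> 1/2" unfolding k_def by (auto simp: field_simps)
  have kk: "k\<^sup>2 \<le> 1/4" using power_mono[of k "1/2" 2] k by (simp add: power2_eq_square)
  define b where "b y = exp (k * y) + exp (- k * y)" for y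
  have b: "b y > 0" for y unfolding b_def by (simp add: add_pos_pos)
  define \<epsilon> where "\<epsilon> = - D x / (2 * b x)"
  have \<epsilon>: "\<epsilon> > 0" "\<epsilon> * b x = - D x / 2" unfolding \<epsilon>_def using neg b[of x] by (auto simp: field_simps)
  define V where "V y = D y + \<epsilon> * b y" for y
  have Vx: "V x < 0" using \<epsilon>(2) neg unfolding V_def by auto
  define R where "R = \<bar>x\<bar> + \<bar>B\<bar> / (\<epsilon> * k) + 1"
  have far: "V y > 0" if "\<bar>y\<bar> > R" for y
  proof -
    have "\<epsilon> * k * R > \<bar>B\<bar>" unfolding R_def using \<epsilon> k by (simp add: field_simps add_pos_nonneg)
    moreover have "\<epsilon> * k * \<bar>y\<bar> \<ge> \<epsilon> * k * R" using that \<epsilon> k by (intro mult_left_mono) auto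
    moreover have "k * \<bar>y\<bar> \<le> b y"
    proof -
      have "1 + k * y \<le> exp (k * y)" "1 + - k * y \<le> exp (- k * y)" by (rule exp_ge_add_one_self)+
      moreover have "0 < exp (k * y)" "0 < exp (- k * y)" by simp_all
      moreover have "k * \<bar>y\<bar> = \<bar>k * y\<bar>" using k by (simp add: abs_mult)
      ultimately show ?thesis unfolding b_def by linarith
    qed
    then have "\<epsilon> * (k * \<bar>y\<bar>) \<le> \<epsilon> * b y" using \<epsilon> by (intro mult_left_mono) auto
    ultimately show ?thesis using bdd[of y] unfolding V_def by (simp add: mult.assoc)
  qed
  have "isCont D y" for y by (rule DERIV_isCont[OF D(1)])
  then have "continuous_on {-R..R} V"
    unfolding V_def b_def by (intro continuous_intros) (auto intro!: continuous_at_imp_continuous_on)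
  moreover have xR: "x \<in> {-R..R}" unfolding R_def using \<epsilon> k by (auto simp: abs_le_iff) (smt (verit) divide_nonneg_pos mult_pos_pos)+
  ultimately obtain y where y: "y \<in> {-R..R}" "\<And>z. z \<in> {-R..R} \<Longrightarrow> V y \<le> V z"
    using continuous_attains_inf[of "{-R..R}" V] by auto
  have Vy: "V y < 0" using y(2)[OF xR] Vx by simp
  have min: "V y \<le> V z" for z
  proof (cases "\<bar>z\<bar> > R")
    case False
    then show ?thesis by (intro y(2)) auto
  qed (use far Vy in force)
  define b' where "b' y = k * exp (k * y) - k * exp (- k * y)" for y
  define b'' where "b'' y = k\<^sup>2 * b y" for y
  have db: "(b has_real_derivative b' z) (at z)" "(b' has_real_derivative b'' z) (at z)" for z
    unfolding b_def b'_def b''_def by (auto intro!: derivative_eq_intros simp: algebra_simps power2_eq_square)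
  have dV: "(V has_real_derivative D' z + \<epsilon> * b' z) (at z)"
    "((\<lambda>z. D' z + \<epsilon> * b' z) has_real_derivative D'' z + \<epsilon> * b'' z) (at z)" for z
    unfolding V_def by (intro DERIV_add DERIV_cmult D db)+
  have 2: "0 \<le> D'' y + \<epsilon> * b'' y"
    by (rule second_deriv_nonneg_at_min[OF dV, of 1]) (use min in auto)
  have 1: "D' y + \<epsilon> * b' y = 0"
    by (rule DERIV_local_min[OF dV(1), of 1]) (use min in auto)
  have "\<bar>b' y\<bar> \<le> k * b y"
    using k unfolding b'_def b_def by (auto simp: algebra_simps abs_le_iff)
  then have "\<bar>c * b' y\<bar> \<le> \<bar>c\<bar> * (k * b y)" unfolding abs_mult by (intro mult_left_mono) auto
  also have "\<dots> = (\<bar>c\<bar> * k) * b y" by simp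
  also have "\<dots> \<le> 1/2 * b y" using k b[of y] by (intro mult_right_mono) auto
  finally have 3: "\<bar>c * b' y\<bar> \<le> b y / 2" by simp
  have "b'' y \<le> 1/4 * b y" unfolding b''_def using kk b[of y] by (intro mult_right_mono) auto
  then have "b'' y - c * b' y - b y \<le> 0" using 3 b[of y] by linarith
  then have 4: "\<epsilon> * (b'' y - c * b' y - b y) \<le> 0" using \<epsilon> by (simp add: mult_nonneg_nonpos)
  have "D'' y - c * D' y - D y + \<epsilon> * (b'' y - c * b' y - b y)
     = (D'' y + \<epsilon> * b'' y) - c * (D' y + \<epsilon> * b' y) - V y"
    unfolding V_def by (simp add: algebra_simps)
  then show False using 1 2 4 ineq[of y] Vy by simp
qed

lemma Kop_le_supersolution:
  assumes v: "\<And>x. (v has_real_derivative v' x) (at x)" "\<And>x. (v' has_real_derivative v'' x) (at x)"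
    and bdd: "\<And>x. - B \<le> v x" and f: "bcont f" and ineq: "\<And>x. v'' x - c * v' x - v x \<le> - f x"
  shows "Kop c f x \<le> v x"
proof -
  obtain B' where B': "\<And>x. \<bar>Kop c f x\<bar> \<le> B'" using bcont_Kop[OF f] unfolding bcont_def by blast
  have "0 \<le> v x - Kop c f x"
  proof (rule bounded_max_principle[where D = "\<lambda>x. v x - Kop c f x" and B = "B + B'" and c = c])
    show "((\<lambda>x. v x - Kop c f x) has_real_derivative v' x - Kop' c f x) (at x)" for x
      by (intro DERIV_diff v Kop_deriv f)
    show "((\<lambda>x. v' x - Kop' c f x) has_real_derivative v'' x - (c * Kop' c f x + Kop c f x - f x)) (at x)" for x
      by (intro DERIV_diff v Kop'_deriv f)
    show "- (B + B') \<le> v x - Kop c f x" for x using bdd[of x] B'[of x] by linarith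
    show "v'' x - (c * Kop' c f x + Kop c f x - f x) - c * (v' x - Kop' c f x) - (v x - Kop c f x) \<le> 0" for x
      using ineq[of x] by (simp add: algebra_simps)
  qed
  then show ?thesis by simp
qed

text \<open>The passage from differential equation to integral operator. It also lets a function
  built with speed c be read as \<open>Kop\<close> of another speed applied to a corrected
  source.\<close>

lemma Kop_unique:
  assumes v: "\<And>x. (v has_real_derivative v' x) (at x)" "\<And>x. (v' has_real_derivative v'' x) (at x)"
    and bdd: "\<And>x. \<bar>v x\<bar> \<le> B" and f: "bcont f" and eq: "\<And>x. v'' x - c * v' x - v x = - f x"
  shows "v x = Kop c f x"
proof (rule antisym)
  have "- B \<le> v x" "- B \<le> - v x" for x using bdd[of x] by auto
  note B = this
  show "Kop c f x \<le> v x" by (rule Kop_le_supersolution[OF v B(1) f]) (use eq in auto)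
  have "Kop c (\<lambda>x. (-1) * f x) x \<le> - v x"
    by (rule Kop_le_supersolution[where v' = "\<lambda>x. - v' x" and v'' = "\<lambda>x. - v'' x", OF _ _ B(2)])
       (use eq in \<open>auto intro!: derivative_intros v bcont_cmult[of f "-1", simplified] f simp: algebra_simps\<close>)
  then show "v x \<le> Kop c f x" using Kop_cmult[of c "-1" f x] by simp
qed

section \<open>The characteristic function and the nonlinearity\<close>

text \<open>The exponential lies above its tangent, and the square contributes the exact remainder
  (w - z)^2; the result is a quantitative form of strict convexity in z.\<close>

lemma chi_tangent:
  assumes "deriv g 0 \<ge> 0"
  shows "chi g h w c \<ge> chi g h z c + (2 * z - c - deriv g 0 * c * h * exp (- z * c * h)) * (w - z) + (w - z)\<^sup>2"
proof -
  have e: "exp (- w * c * h) = exp (- z * c * h) * exp (- (w - z) * c * h)"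
    by (simp add: exp_add[symmetric] algebra_simps)
  have "1 + - (w - z) * c * h \<le> exp (- (w - z) * c * h)" by (rule exp_ge_add_one_self)
  then have "exp (- z * c * h) * (1 + - (w - z) * c * h) \<le> exp (- w * c * h)"
    unfolding e by (intro mult_left_mono) auto
  then have "deriv g 0 * (exp (- z * c * h) * (1 + - (w - z) * c * h)) \<le> deriv g 0 * exp (- w * c * h)"
    using assms by (rule mult_left_mono)
  then show ?thesis unfolding chi_def by (simp add: algebra_simps power2_eq_square)
qed

text \<open>At a point with a nonnegative value, the supporting parabola would need a slope that is
  negative towards both neighbours.\<close>

lemma chi_between:
  assumes "deriv g 0 \<ge> 0" and "chi g h z1 c \<le> 0" "chi g h z2 c \<le> 0" "z1 < z" "z < z2"
  shows "chi g h z c < 0"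
proof (rule ccontr)
  assume "\<not> chi g h z c < 0"
  then have z: "chi g h z c \<ge> 0" by simp
  define d where "d = 2 * z - c - deriv g 0 * c * h * exp (- z * c * h)"
  have 1: "0 \<ge> d * (z1 - z) + (z1 - z)\<^sup>2" using chi_tangent[OF assms(1), of h z c z1] assms z unfolding d_def by linarith
  have 2: "0 \<ge> d * (z2 - z) + (z2 - z)\<^sup>2" using chi_tangent[OF assms(1), of h z c z2] assms z unfolding d_def by linarith
  have "(z1 - z)\<^sup>2 > 0" "(z2 - z)\<^sup>2 > 0" using assms by auto
  then have "d * (z1 - z) < 0" "d * (z2 - z) < 0" using 1 2 by linarith+
  then show False using assms by (simp add: mult_less_0_iff)
qed

lemma chi_deriv:
  "((\<lambda>w. chi g h w c) has_real_derivative (2 * z - c - deriv g 0 * c * h * exp (- z * c * h))) (at z)"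
  unfolding chi_def by (auto intro!: derivative_eq_intros simp: algebra_simps)

lemma isCont_chi: "isCont (\<lambda>w. chi g h w c) z"
  by (rule DERIV_isCont[OF chi_deriv])

context
  fixes g :: "real \<Rightarrow> real" and h :: real
  assumes g0: "deriv g 0 > 1" and h: "h \<ge> 0"
begin

lemma chi_0_pos: "chi g h 0 c > 0" using g0 by (simp add: chi_def)

lemma chi_pos_c_nonpos: assumes "c \<le> 0" "z \<ge> 0" shows "chi g h z c > 0"
proof -
  have "- z * c * h \<ge> 0" using assms h by (simp add: mult_nonneg_nonpos mult_nonpos_nonneg)
  then have "1 \<le> exp (- z * c * h)" by simp
  then have "deriv g 0 * 1 \<le> deriv g 0 * exp (- z * c * h)" using g0 by (intro mult_left_mono) auto
  moreover have "c * z \<le> 0" using assms by (simp add: mult_nonpos_nonneg)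
  moreover have "z\<^sup>2 \<ge> 0" by simp
  ultimately show ?thesis using g0 unfolding chi_def by linarith
qed

lemma chi_pos_large: assumes "c \<ge> 0" "z \<ge> c + 1" shows "chi g h z c > 0"
proof -
  have "z * (z - c) \<ge> 1 * 1" using assms by (intro mult_mono) auto
  then have "z\<^sup>2 - c * z - 1 \<ge> 0" by (simp add: power2_eq_square algebra_simps)
  moreover have "deriv g 0 * exp (- z * c * h) > 0" using g0 by simp
  ultimately show ?thesis unfolding chi_def by linarith
qed

lemma chi_strict_antimono: assumes "0 < z" "c < c'" shows "chi g h z c' < chi g h z c"
proof -
  have "z * c * h \<le> z * c' * h" using assms h by (intro mult_right_mono mult_left_mono) auto
  then have "exp (- z * c' * h) \<le> exp (- z * c * h)" by simp
  then have "deriv g 0 * exp (- z * c' * h) \<le> deriv g 0 * exp (- z * c * h)" using g0 by (intro mult_left_mono) auto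
  moreover have "c * z < c' * z" using assms by simp
  ultimately show ?thesis unfolding chi_def by linarith
qed

lemma continuous_on_chi: "continuous_on S (\<lambda>p. chi g h (snd p) (fst p))"
  unfolding chi_def by (intro continuous_intros)

text \<open>Take the least c for which chi(., c) is nonpositive somewhere; it exists by compactness.
  For this c no value can be negative, since a slightly smaller c would then do as well, so the zero
  is a minimum and hence double.\<close>

lemma double_zero_exists:
  "\<exists>c>0. \<exists>z>0. chi g h z c = 0 \<and> deriv (\<lambda>w. chi g h w c) z = 0"
proof -
  \<comment> \<open>For this speed chi is nonpositive at z = 1, and points z \<ge> c + 1 never
    matter because chi is positive there; so the search takes place in a compact box.\<close>
  define c1 where "c1 = deriv g 0 + 1"
  have "c1 * h \<ge> 0" using g0 h by (intro mult_nonneg_nonneg) (auto simp: c1_def)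
  then have "exp (- 1 * c1 * h) \<le> 1" by simp
  then have "deriv g 0 * exp (- 1 * c1 * h) \<le> deriv g 0 * 1" using g0 by (intro mult_left_mono) auto
  then have neg1: "chi g h 1 c1 \<le> 0" unfolding chi_def c1_def by simp
  define P where "P = ({0..c1} \<times> {0..c1+1}) \<inter> {p. chi g h (snd p) (fst p) \<le> 0}"
  have "closed {p. chi g h (snd p) (fst p) \<le> 0}"
    by (intro closed_Collect_le continuous_on_chi continuous_on_const)
  then have "compact P" unfolding P_def by (intro compact_Int_closed compact_Times) auto
  moreover have "(c1, 1) \<in> P" unfolding P_def using neg1 g0 by (auto simp: c1_def)
  ultimately obtain p where p: "p \<in> P" "\<And>q. q \<in> P \<Longrightarrow> fst p \<le> fst q"
    using continuous_attains_inf[of P fst] continuous_on_fst[OF continuous_on_id] by (metis empty_iff)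
  define c z where "c = fst p" and "z = snd p"
  have cz: "0 \<le> c" "c \<le> c1" "0 \<le> z" "chi g h z c \<le> 0" using p(1) unfolding P_def c_def z_def by (cases p, auto)+
  have z: "z > 0" using chi_0_pos[of c] cz by (cases "z = 0") auto
  have c: "c > 0" using chi_pos_c_nonpos[of c z] cz by (cases "c = 0") auto
  have nn: "0 \<le> chi g h w c" if w: "w > 0" for w
  proof (rule ccontr)
    assume neg: "\<not> 0 \<le> chi g h w c"
    have wc: "w < c + 1" using chi_pos_large[of c w] neg cz by force
    have "isCont (\<lambda>c. chi g h w c) c" unfolding chi_def by (intro continuous_intros)
    then have "((\<lambda>c. chi g h w c) \<longlongrightarrow> chi g h w c) (at_left c)"
      unfolding isCont_def by (rule filterlim_mono) (auto simp: at_le)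
    then have "\<forall>\<^sub>F c' in at_left c. chi g h w c' < 0" using neg by (intro order_tendstoD) auto
    moreover have "\<forall>\<^sub>F c' in at_left c. c' \<in> {0<..<c}" using c by (rule eventually_at_left_real)
    ultimately have "\<forall>\<^sub>F c' in at_left c. chi g h w c' < 0 \<and> c' \<in> {0<..<c}" by eventually_elim auto
    then obtain c' where c': "chi g h w c' < 0" "0 < c'" "c' < c"
      using eventually_happens'[OF trivial_limit_at_left_real] by fastforce
    then have "(c', w) \<in> P" unfolding P_def using w wc cz by auto
    then show False using p(2)[of "(c', w)"] c' by (simp add: c_def)
  qed
  have z0: "chi g h z c = 0" using nn[OF z] cz by simp
  have "2 * z - c - deriv g 0 * c * h * exp (- z * c * h) = 0"
    by (rule DERIV_local_min[OF chi_deriv z]) (use nn z0 in auto)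
  then have "deriv (\<lambda>w. chi g h w c) z = 0" using DERIV_imp_deriv[OF chi_deriv[of g h c z]] by simp
  then show ?thesis using c z z0 by blast
qed

text \<open>By convexity chi stays nonnegative for a speed that has a double zero, while chi
  strictly decreases in c for z > 0; a zero at a smaller speed would become negative.\<close>

lemma double_zero_unique:
  assumes "z > 0" "chi g h z c = 0" "deriv (\<lambda>w. chi g h w c) z = 0"
    and "z' > 0" "chi g h z' c' = 0" "deriv (\<lambda>w. chi g h w c') z' = 0"
  shows "c = c'"
proof -
  have aux: False if "z > 0" "chi g h z c = 0"
    "z' > 0" "chi g h z' c' = 0" "deriv (\<lambda>w. chi g h w c') z' = 0" "c < c'" for z c z' c'
  proof -
    have "2 * z' - c' - deriv g 0 * c' * h * exp (- z' * c' * h) = 0"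
      using DERIV_imp_deriv[OF chi_deriv[of g h c' z']] that by simp
    then have "chi g h z c' \<ge> chi g h z' c' + 0 * (z - z') + (z - z')\<^sup>2"
      using chi_tangent[of g h z' c' z] g0 by simp
    then have "chi g h z c' \<ge> 0" using that by (smt (verit) zero_le_power2 mult_zero_left)
    then show False using chi_strict_antimono[of z c c'] that by simp
  qed
  show ?thesis using aux[of z c z' c'] aux[of z' c' z c] assms by (cases c c' rule: linorder_cases) auto
qed

lemma c_sharp_double_zero:
  "c_sharp g h > 0" "\<exists>z>0. chi g h z (c_sharp g h) = 0"
proof -
  obtain c z where c: "c > 0" and z: "z > 0" "chi g h z c = 0" "deriv (\<lambda>w. chi g h w c) z = 0"
    using double_zero_exists by blast
  have "c_sharp g h = c"
    unfolding c_sharp_def by (rule the_equality) (use z double_zero_unique in blast)+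
  then show "c_sharp g h > 0" "\<exists>z>0. chi g h z (c_sharp g h) = 0" using c z by auto
qed

text \<open>At the double zero of the critical speed, chi becomes negative for larger c. This gives
  one zero on either side, convexity excludes a third, and the definite descriptions of the two
  roots are thereby justified.\<close>

lemma lambda_facts:
  assumes c: "c > c_sharp g h"
  shows "0 < lambda1 g h c" "lambda1 g h c < lambda2 g h c"
    and "\<And>z. lambda1 g h c < z \<Longrightarrow> z < lambda2 g h c \<Longrightarrow> chi g h z c < 0"
proof -
  have cp: "c > 0" using c c_sharp_double_zero by simp
  obtain z0 where z0: "z0 > 0" "chi g h z0 (c_sharp g h) = 0" using c_sharp_double_zero by blast
  have neg: "chi g h z0 c < 0" using chi_strict_antimono[OF z0(1) c] z0 by simp
  obtain l1 where l1: "0 \<le> l1" "l1 \<le> z0" "chi g h l1 c = 0"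
    using IVT2[of "\<lambda>z. chi g h z c" z0 0 0] neg chi_0_pos[of c] z0 isCont_chi by auto
  define Z where "Z = max z0 (c + 1)"
  have "z0 \<le> Z" "0 < chi g h Z c" using chi_pos_large[of c Z] cp by (auto simp: Z_def)
  then have "\<exists>x\<ge>z0. x \<le> Z \<and> chi g h x c = 0"
    using neg isCont_chi by (intro IVT[of "\<lambda>z. chi g h z c"]) auto
  then obtain l2 where l2: "z0 \<le> l2" "l2 \<le> Z" "chi g h l2 c = 0" by blast
  have l: "0 < l1" "l1 < z0" "z0 < l2"
    using l1 l2 neg chi_0_pos[of c] by (auto simp: less_le)
  have g0': "deriv g 0 \<ge> 0" using g0 by simp
  have zeros: "{z. z > 0 \<and> chi g h z c = 0} = {l1, l2}"
  proof (intro equalityI subsetI)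
    fix z assume "z \<in> {z. z > 0 \<and> chi g h z c = 0}"
    then have z: "z > 0" "chi g h z c = 0" by auto
    consider "z < l1" | "z = l1" | "l1 < z" "z < l2" | "z = l2" | "l2 < z" by linarith
    then show "z \<in> {l1, l2}"
    proof cases
      case 1
      then have "chi g h l1 c < 0" using chi_between[OF g0', of h z c l2 l1] z l l2 by auto
      then show ?thesis using l1 by simp
    next
      case 3
      then have "chi g h z c < 0" using chi_between[OF g0', of h l1 c l2 z] l1 l2 by auto
      then show ?thesis using z by simp
    next
      case 5
      then have "chi g h l2 c < 0" using chi_between[OF g0', of h l1 c z l2] z l l1 by auto
      then show ?thesis using l2 by simp
    qed auto
  qed (use l l1 l2 in auto)
  have uniq: "a = l1 \<and> b = l2" if "a < b" "{z. z > 0 \<and> chi g h z c = 0} = {a, b}" for a b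
    using that l unfolding zeros doubleton_eq_iff by auto
  have ex: "l1 < l2 \<and> {z. z > 0 \<and> chi g h z c = 0} = {l1, l2}" using zeros l by simp
  have L1: "lambda1 g h c = l1" unfolding lambda1_def
  proof (rule the_equality)
    show "\<exists>l2. l1 < l2 \<and> {z. z > 0 \<and> chi g h z c = 0} = {l1, l2}" using ex by (rule exI)
    show "a = l1" if "\<exists>l2. a < l2 \<and> {z. z > 0 \<and> chi g h z c = 0} = {a, l2}" for a
      using that uniq by blast
  qed
  have L2: "lambda2 g h c = l2" unfolding lambda2_def
  proof (rule the_equality)
    show "\<exists>l1. l1 < l2 \<and> {z. z > 0 \<and> chi g h z c = 0} = {l1, l2}" using ex by (rule exI)
    show "a = l2" if "\<exists>l1. l1 < a \<and> {z. z > 0 \<and> chi g h z c = 0} = {l1, a}" for a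
      using that uniq by blast
  qed
  show "0 < lambda1 g h c" "lambda1 g h c < lambda2 g h c" using L1 L2 l by auto
  show "chi g h z c < 0" if "lambda1 g h c < z" "z < lambda2 g h c" for z
    using chi_between[OF g0', of h l1 c l2 z] that L1 L2 l1 l2 by auto
qed

end

text \<open>A two-point version is required: barriers compare g at two nearby values, neither of
  which need be the equilibrium p.\<close>

lemma slope_near:
  fixes g :: "real \<Rightarrow> real"
  assumes d: "\<delta> > 0" "\<And>x. x \<in> cball p \<delta> \<Longrightarrow> g differentiable (at x)"
    and c: "continuous_on (cball p \<delta>) (deriv g)" and e: "\<epsilon> > 0"
  shows "\<exists>r>0. \<forall>x y. \<bar>x - p\<bar> \<le> r \<longrightarrow> \<bar>y - p\<bar> \<le> r \<longrightarrow> \<bar>g x - g y - deriv g p * (x - y)\<bar> \<le> \<epsilon> * \<bar>x - y\<bar>"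
proof -
  obtain r' where r': "r' > 0" "\<And>x. x \<in> cball p \<delta> \<Longrightarrow> dist x p < r' \<Longrightarrow> dist (deriv g x) (deriv g p) < \<epsilon>"
    using c d(1) e unfolding continuous_on_iff by (metis centre_in_cball less_imp_le)
  define r where "r = min \<delta> (r'/2)"
  have r: "r > 0" "r \<le> \<delta>" "r < r'" using r' d by (auto simp: r_def)
  have D: "(g has_real_derivative deriv g x) (at x)" if "\<bar>x - p\<bar> \<le> r" for x
    using d(2)[of x] that r by (simp add: dist_real_def abs_minus_commute DERIV_deriv_iff_real_differentiable)
  have close: "\<bar>deriv g x - deriv g p\<bar> \<le> \<epsilon>" if "\<bar>x - p\<bar> \<le> r" for x
    using r'(2)[of x] that r by (simp add: dist_real_def abs_minus_commute)
  have main: "\<bar>g x - g y - deriv g p * (x - y)\<bar> \<le> \<epsilon> * \<bar>x - y\<bar>"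
    if xy: "\<bar>x - p\<bar> \<le> r" "\<bar>y - p\<bar> \<le> r" "y < x" for x y
  proof -
    obtain z where z: "y < z" "z < x" "g x - g y = (x - y) * deriv g z"
      using MVT2[of y x g "deriv g"] D xy by (auto simp: abs_le_iff)
    have "\<bar>deriv g z - deriv g p\<bar> \<le> \<epsilon>" using z xy by (intro close) (auto simp: abs_le_iff)
    then have "\<bar>x - y\<bar> * \<bar>deriv g z - deriv g p\<bar> \<le> \<bar>x - y\<bar> * \<epsilon>" by (intro mult_left_mono) auto
    moreover have "g x - g y - deriv g p * (x - y) = (x - y) * (deriv g z - deriv g p)"
      using z by (simp add: algebra_simps)
    ultimately show ?thesis by (simp add: abs_mult mult.commute)
  qed
  have "\<bar>g x - g y - deriv g p * (x - y)\<bar> \<le> \<epsilon> * \<bar>x - y\<bar>" if "\<bar>x - p\<bar> \<le> r" "\<bar>y - p\<bar> \<le> r" for x y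
    using main[of x y] main[of y x] that
    by (cases x y rule: linorder_cases) (auto simp: abs_le_iff algebra_simps)
  then show ?thesis using r by blast
qed

section \<open>The monotone nonlinearity\<close>

locale mono_H =
  fixes g :: "real \<Rightarrow> real" and \<kappa> :: real
  assumes H: "hyp_H g \<kappa>" and mono: "mono g"
begin

lemma kappa_pos: "\<kappa> > 0" using H unfolding hyp_H_def by blast
lemma slope_0: "deriv g 0 > 1" using H unfolding hyp_H_def by blast
lemma slope_kappa: "deriv g \<kappa> < 1" using H unfolding hyp_H_def by blast
lemma linear_left: "x \<le> 0 \<Longrightarrow> g x = g 0 + deriv g 0 * x" using H unfolding hyp_H_def by blast
lemma linear_right: "x \<ge> \<kappa> \<Longrightarrow> g x = g \<kappa> + deriv g \<kappa> * (x - \<kappa>)"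
  using H unfolding hyp_H_def by blast

lemma fixed_points: assumes "x \<ge> 0" shows "g x = x \<longleftrightarrow> x = 0 \<or> x = \<kappa>"
proof -
  have "{x. x \<ge> 0 \<and> g x = x} = {0, \<kappa>}" using H unfolding hyp_H_def by blast
  then have "x \<in> {x. x \<ge> 0 \<and> g x = x} \<longleftrightarrow> x \<in> {0, \<kappa>}" by simp
  then show ?thesis using assms by simp
qed

lemma g_0: "g 0 = 0" and g_kappa: "g \<kappa> = \<kappa>"
  using fixed_points[of 0] fixed_points[of \<kappa>] kappa_pos by auto

lemma slope_kappa_nonneg: "deriv g \<kappa> \<ge> 0"
  using linear_right[of "\<kappa> + 1"] monoD[OF mono, of \<kappa> "\<kappa> + 1"] g_kappa by simp

text \<open>Both t and g t split into the contributions of \<open>min t 0\<close>, the truncation of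
  t to [0, \<kappa>], and \<open>max t \<kappa>\<close>, so the three slope bounds add up. The bound
  must be global because barriers leave [0, \<kappa>].\<close>

lemma lipschitz: "\<exists>L\<ge>1. \<forall>x y. \<bar>g x - g y\<bar> \<le> L * \<bar>x - y\<bar>"
proof -
  have "\<exists>Lg. \<forall>u\<in>{0..\<kappa>}. \<forall>v\<in>{0..\<kappa>}. \<bar>g u - g v\<bar> \<le> Lg * \<bar>u - v\<bar>"
    using H unfolding hyp_H_def by (elim conjE) assumption
  then obtain L0 where L0: "\<And>u v. u \<in> {0..\<kappa>} \<Longrightarrow> v \<in> {0..\<kappa>} \<Longrightarrow> \<bar>g u - g v\<bar> \<le> L0 * \<bar>u - v\<bar>"
    by metis
  define L where "L = max L0 (deriv g 0)"
  have L: "L \<ge> 1" "L \<ge> L0" "L \<ge> deriv g 0" "L \<ge> deriv g \<kappa>" using slope_0 slope_kappa by (auto simp: L_def)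
  have main: "g y - g x \<le> L * (y - x)" if "x \<le> y" for x y
  proof -
    have 1: "g (min y 0) - g (min x 0) \<le> L * (min y 0 - min x 0)"
    proof -
      have "g (min y 0) - g (min x 0) = deriv g 0 * (min y 0 - min x 0)"
        using linear_left[of "min y 0"] linear_left[of "min x 0"] by (simp add: algebra_simps)
      also have "\<dots> \<le> L * (min y 0 - min x 0)" using L that by (intro mult_right_mono) auto
      finally show ?thesis .
    qed
    define m where "m t = max 0 (min t \<kappa>)" for t
    have 2: "g (m y) - g (m x) \<le> L * (m y - m x)"
    proof -
      have "g (m y) - g (m x) \<le> L0 * \<bar>m y - m x\<bar>"
      proof -
        have "m y \<in> {0..\<kappa>}" "m x \<in> {0..\<kappa>}" using kappa_pos by (auto simp: m_def)
        then show ?thesis using L0[of "m y" "m x"] by linarith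
      qed
      also have "\<dots> \<le> L * \<bar>m y - m x\<bar>" using L by (intro mult_right_mono) auto
      also have "\<bar>m y - m x\<bar> = m y - m x" using that by (auto simp: m_def)
      finally show ?thesis .
    qed
    have 3: "g (max y \<kappa>) - g (max x \<kappa>) \<le> L * (max y \<kappa> - max x \<kappa>)"
    proof -
      have "g (max y \<kappa>) - g (max x \<kappa>) = deriv g \<kappa> * (max y \<kappa> - max x \<kappa>)"
        using linear_right[of "max y \<kappa>"] linear_right[of "max x \<kappa>"] by (simp add: algebra_simps)
      also have "\<dots> \<le> L * (max y \<kappa> - max x \<kappa>)" using L that by (intro mult_right_mono) auto
      finally show ?thesis .
    qed
    have s: "t = min t 0 + m t + max t \<kappa> - \<kappa>" "g t = g (min t 0) + g (m t) + g (max t \<kappa>) - \<kappa>" for t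
      using kappa_pos g_0 g_kappa by (auto simp: m_def min_def max_def)
    have "L * (y - x) = L * (min y 0 - min x 0) + L * (m y - m x) + L * (max y \<kappa> - max x \<kappa>)"
      by (subst (1) s(1)[of y], subst (1) s(1)[of x]) (simp add: algebra_simps)
    then show ?thesis using 1 2 3 s(2)[of y] s(2)[of x] by linarith
  qed
  have "\<bar>g x - g y\<bar> \<le> L * \<bar>x - y\<bar>" for x y
    using main[of x y] main[of y x] monoD[OF mono, of x y] monoD[OF mono, of y x] by (cases "x \<le> y") auto
  then show ?thesis using L by blast
qed

lemma continuous_g: "continuous_on S g"
proof -
  obtain L where L: "L \<ge> 1" "\<And>x y. \<bar>g x - g y\<bar> \<le> L * \<bar>x - y\<bar>" using lipschitz by blast
  then show ?thesis
    by (intro lipschitz_on_continuous_on[of L] lipschitz_onI) (auto simp: dist_real_def)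
qed

lemma smooth_near:
  obtains \<delta> where "\<delta> > 0" "\<forall>x \<in> cball 0 \<delta> \<union> cball \<kappa> \<delta>. g differentiable (at x)"
    "continuous_on (cball 0 \<delta> \<union> cball \<kappa> \<delta>) (deriv g)"
  using H unfolding hyp_H_def
  by (elim conjE exE) (rule that)

lemma slope_near_0:
  assumes "\<epsilon> > 0"
  obtains r where "r > 0" "\<And>x y. \<bar>x\<bar> \<le> r \<Longrightarrow> \<bar>y\<bar> \<le> r \<Longrightarrow> x \<le> y \<Longrightarrow>
    g y - g x \<le> (deriv g 0 + \<epsilon>) * (y - x) \<and> (deriv g 0 - \<epsilon>) * (y - x) \<le> g y - g x"
proof -
  obtain \<delta> where \<delta>: "\<delta> > 0" "\<forall>x \<in> cball 0 \<delta> \<union> cball \<kappa> \<delta>. g differentiable (at x)"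
    "continuous_on (cball 0 \<delta> \<union> cball \<kappa> \<delta>) (deriv g)"
    by (rule smooth_near)
  have "\<exists>r>0. \<forall>x y. \<bar>x - 0\<bar> \<le> r \<longrightarrow> \<bar>y - 0\<bar> \<le> r \<longrightarrow> \<bar>g x - g y - deriv g 0 * (x - y)\<bar> \<le> \<epsilon> * \<bar>x - y\<bar>"
    by (rule slope_near[OF \<delta>(1)]) (use \<delta> assms in \<open>auto intro: continuous_on_subset\<close>)
  then obtain r where r: "r > 0" and
    r2: "\<And>x y. \<bar>x\<bar> \<le> r \<Longrightarrow> \<bar>y\<bar> \<le> r \<Longrightarrow> \<bar>g x - g y - deriv g 0 * (x - y)\<bar> \<le> \<epsilon> * \<bar>x - y\<bar>" by auto
  show ?thesis
  proof (rule that[OF r])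
    fix x y :: real assume "\<bar>x\<bar> \<le> r" "\<bar>y\<bar> \<le> r" "x \<le> y"
    then have "\<bar>g y - g x - deriv g 0 * (y - x)\<bar> \<le> \<epsilon> * (y - x)" using r2[of y x] by simp
    then show "g y - g x \<le> (deriv g 0 + \<epsilon>) * (y - x) \<and> (deriv g 0 - \<epsilon>) * (y - x) \<le> g y - g x"
      unfolding distrib_right[of "deriv g 0" \<epsilon>] left_diff_distrib[of "deriv g 0" \<epsilon>] abs_le_iff by linarith
  qed
qed

lemma slope_near_kappa:
  assumes "\<epsilon> > 0"
  obtains r where "r > 0" "\<And>x y. \<bar>x - \<kappa>\<bar> \<le> r \<Longrightarrow> \<bar>y - \<kappa>\<bar> \<le> r \<Longrightarrow> x \<le> y \<Longrightarrow>
    g y - g x \<le> (deriv g \<kappa> + \<epsilon>) * (y - x)"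
proof -
  obtain \<delta> where \<delta>: "\<delta> > 0" "\<forall>x \<in> cball 0 \<delta> \<union> cball \<kappa> \<delta>. g differentiable (at x)"
    "continuous_on (cball 0 \<delta> \<union> cball \<kappa> \<delta>) (deriv g)"
    by (rule smooth_near)
  have "\<exists>r>0. \<forall>x y. \<bar>x - \<kappa>\<bar> \<le> r \<longrightarrow> \<bar>y - \<kappa>\<bar> \<le> r \<longrightarrow> \<bar>g x - g y - deriv g \<kappa> * (x - y)\<bar> \<le> \<epsilon> * \<bar>x - y\<bar>"
    by (rule slope_near[OF \<delta>(1)]) (use \<delta> assms in \<open>auto intro: continuous_on_subset\<close>)
  then obtain r where r: "r > 0" and
    r2: "\<And>x y. \<bar>x - \<kappa>\<bar> \<le> r \<Longrightarrow> \<bar>y - \<kappa>\<bar> \<le> r \<Longrightarrow> \<bar>g x - g y - deriv g \<kappa> * (x - y)\<bar> \<le> \<epsilon> * \<bar>x - y\<bar>" by auto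
  show ?thesis
  proof (rule that[OF r])
    fix x y :: real assume "\<bar>x - \<kappa>\<bar> \<le> r" "\<bar>y - \<kappa>\<bar> \<le> r" "x \<le> y"
    then have "\<bar>g y - g x - deriv g \<kappa> * (y - x)\<bar> \<le> \<epsilon> * (y - x)" using r2[of y x] by simp
    then show "g y - g x \<le> (deriv g \<kappa> + \<epsilon>) * (y - x)"
      unfolding distrib_right[of "deriv g \<kappa>" \<epsilon>] abs_le_iff by linarith
  qed
qed

text \<open>Slope above 1 at 0 puts g above the diagonal near 0, and a crossing before \<kappa>
  would be a third fixed point.\<close>

lemma g_gt: assumes "0 < u" "u < \<kappa>" shows "g u > u"
proof (rule ccontr)
  assume neg: "\<not> g u > u"
  obtain r where r: "r > 0" "\<And>x y. \<bar>x\<bar> \<le> r \<Longrightarrow> \<bar>y\<bar> \<le> r \<Longrightarrow> x \<le> y \<Longrightarrow>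
    g y - g x \<le> (deriv g 0 + (deriv g 0 - 1)/2) * (y - x) \<and> (deriv g 0 - (deriv g 0 - 1)/2) * (y - x) \<le> g y - g x"
    by (rule slope_near_0[of "(deriv g 0 - 1)/2"]) (use slope_0 in auto)
  define v where "v = min r u"
  have v: "0 < v" "v \<le> u" "v \<le> r" using r assms by (auto simp: v_def)
  have "(deriv g 0 - (deriv g 0 - 1)/2) * v \<le> g v" using r(2)[of 0 v] v r(1) g_0 by auto
  moreover have "1 * v < (deriv g 0 - (deriv g 0 - 1)/2) * v"
    using slope_0 v by (intro mult_strict_right_mono) (auto simp: field_simps)
  ultimately have "g v - v > 0" by linarith
  have "continuous_on {v..u} (\<lambda>x. g x - x)" by (intro continuous_intros continuous_g)
  then obtain w where "v \<le> w" "w \<le> u" "g w - w = 0"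
    using IVT2'[of "\<lambda>x. g x - x" u 0 v] neg \<open>g v - v > 0\<close> v by auto
  then show False using fixed_points[of w] v assms by auto
qed

lemma g_pos: "x > 0 \<Longrightarrow> g x > 0"
proof -
  assume x: "x > 0"
  have "g (min x (\<kappa>/2)) > min x (\<kappa>/2)" using x kappa_pos by (intro g_gt) auto
  then have "g (min x (\<kappa>/2)) > 0" using x kappa_pos by auto
  moreover have "g (min x (\<kappa>/2)) \<le> g x" by (rule monoD[OF mono]) simp
  ultimately show ?thesis by simp
qed

lemma g_nonneg: "x \<ge> 0 \<Longrightarrow> g x \<ge> 0" using monoD[OF mono, of 0 x] g_0 by simp
lemma g_le_kappa: "x \<le> \<kappa> \<Longrightarrow> g x \<le> \<kappa>" using monoD[OF mono, of x \<kappa>] g_kappa by simp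

lemma bcont_g:
  assumes f: "bcont f" "\<And>x. 0 \<le> f x" "\<And>x. f x \<le> \<kappa>" shows "bcont (\<lambda>x. g (f x))"
proof (rule bcontI[of _ \<kappa>])
  have "continuous_on UNIV (g \<circ> f)" by (intro continuous_on_compose bcont_continuous f continuous_g)
  then show "continuous_on UNIV (\<lambda>x. g (f x))" by (simp add: o_def)
  show "\<bar>g (f x)\<bar> \<le> \<kappa>" for x using g_nonneg[OF f(2)[of x]] g_le_kappa[OF f(3)[of x]] by simp
qed

end

section \<open>Wavefronts from supersolutions\<close>

lemma mono_bounded_limits:
  fixes f :: "real \<Rightarrow> real"
  assumes f: "mono f" and B: "\<And>x. \<bar>f x\<bar> \<le> B"
  shows "\<exists>l. (f \<longlongrightarrow> l) at_top \<and> (\<forall>x. f x \<le> l)" and "\<exists>l. (f \<longlongrightarrow> l) at_bot \<and> (\<forall>x. l \<le> f x)"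
proof -
  have fB: "f x \<le> B" "- B \<le> f x" for x using B[of x] by auto
  have bdd: "bdd_above (range f)" "bdd_below (range f)"
    using fB by (auto intro!: bdd_aboveI[of _ B] bdd_belowI[of _ "- B"])
  have le: "f x \<le> (SUP x. f x)" "(INF x. f x) \<le> f x" for x using bdd by (auto intro: cSUP_upper cINF_lower)
  have "(f \<longlongrightarrow> (SUP x. f x)) at_top"
  proof (rule increasing_tendsto)
    fix y assume "y < (SUP x. f x)"
    then obtain x where "y < f x" using less_cSUP_iff[OF _ bdd(1)] by auto
    then have "y < f z" if "z \<ge> x" for z using monoD[OF f that] by simp
    then show "\<forall>\<^sub>F z in at_top. y < f z" by (auto simp: eventually_at_top_linorder)
  qed (use le in auto)
  then show "\<exists>l. (f \<longlongrightarrow> l) at_top \<and> (\<forall>x. f x \<le> l)" using le by blast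
  have "(f \<longlongrightarrow> (INF x. f x)) at_bot"
  proof (rule decreasing_tendsto)
    fix y assume "(INF x. f x) < y"
    then obtain x where "f x < y" using cINF_less_iff[OF _ bdd(2)] by auto
    then have "f z < y" if "z \<le> x" for z using monoD[OF f that] by simp
    then show "\<forall>\<^sub>F z in at_bot. f z < y" by (auto simp: eventually_at_bot_linorder)
  qed (use le in auto)
  then show "\<exists>l. (f \<longlongrightarrow> l) at_bot \<and> (\<forall>x. l \<le> f x)" using le by blast
qed

text \<open>Helly's theorem yields convergence at the continuity points of a monotone limit. These
  are dense, having a countable complement, and the common Lipschitz constant carries the Cauchy
  property to every point.\<close>

lemma equi_lipschitz_selection:
  fixes f :: "nat \<Rightarrow> real \<Rightarrow> real"
  assumes mono: "\<And>n. mono (f n)" and bdd: "\<And>n x. \<bar>f n x\<bar> \<le> B"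
    and lip: "\<And>n x y. \<bar>f n x - f n y\<bar> \<le> M * \<bar>x - y\<bar>" and M: "M > 0"
  shows "\<exists>s. strict_mono (s::nat \<Rightarrow> nat) \<and> (\<forall>x. convergent (\<lambda>n. f (s n) x))"
proof -
  have cont: "continuous (at_right x) (f n)" for n x
  proof -
    have "continuous_on UNIV (f n)"
      by (rule lipschitz_on_continuous_on[of M]) (use lip M in \<open>auto intro!: lipschitz_onI simp: dist_real_def\<close>)
    then have "isCont (f n) x" by (simp add: continuous_on_eq_continuous_at)
    then show ?thesis by (rule continuous_at_imp_continuous_within)
  qed
  obtain s F where s: "strict_mono (s::nat \<Rightarrow> nat)" and F: "mono F"
    and lim: "\<And>x. isCont F x \<Longrightarrow> (\<lambda>n. f (s n) x) \<longlonglongrightarrow> F x"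
    using Helly_selection[of f B, OF cont mono bdd] by blast
  have "convergent (\<lambda>n. f (s n) x)" for x
  proof -
    have "Cauchy (\<lambda>n. f (s n) x)"
    proof (rule metric_CauchyI)
      fix e :: real assume e: "e > 0"
      define \<delta> where "\<delta> = e / (4 * M)"
      have \<delta>: "\<delta> > 0" "M * \<delta> = e / 4" using e M by (auto simp: \<delta>_def)
      have "countable {a. \<not> isCont F a}" by (rule mono_ctble_discont[OF F])
      moreover have "uncountable {x<..<x+\<delta>}" using \<delta>(1) by (intro uncountable_open_interval[THEN iffD2]) simp
      ultimately have "\<not> {x<..<x+\<delta>} \<subseteq> {a. \<not> isCont F a}" using countable_subset by blast
      then obtain y where y: "y \<in> {x<..<x+\<delta>}" "isCont F y" by blast
      have "Cauchy (\<lambda>n. f (s n) y)" by (rule LIMSEQ_imp_Cauchy[OF lim[OF y(2)]])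
      then obtain N where N: "\<And>m n. m \<ge> N \<Longrightarrow> n \<ge> N \<Longrightarrow> dist (f (s m) y) (f (s n) y) < e / 4"
        using e unfolding Cauchy_def by (metis divide_pos_pos zero_less_numeral)
      have c: "\<bar>f (s n) x - f (s n) y\<bar> \<le> e / 4" for n
      proof -
        have "\<bar>f (s n) x - f (s n) y\<bar> \<le> M * \<bar>x - y\<bar>" by (rule lip)
        also have "\<dots> \<le> M * \<delta>" using y M by (intro mult_left_mono) auto
        finally show ?thesis using \<delta> by simp
      qed
      show "\<exists>N. \<forall>m\<ge>N. \<forall>n\<ge>N. dist (f (s m) x) (f (s n) x) < e"
      proof (intro exI[of _ N] allI impI)
        fix m n assume "m \<ge> N" "n \<ge> N"
        then show "dist (f (s m) x) (f (s n) x) < e"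
          using N[of m n] c[of m] c[of n] e unfolding dist_real_def by linarith
      qed
    qed
    then show ?thesis by (simp add: Cauchy_convergent_iff)
  qed
  then show ?thesis using s by blast
qed

text \<open>Keeping r in the maximum at every step makes the sequence nondecreasing for a monotone F
  even though r need not be a subsolution.\<close>

primrec max_iter :: "((real \<Rightarrow> real) \<Rightarrow> real \<Rightarrow> real) \<Rightarrow> (real \<Rightarrow> real) \<Rightarrow> nat \<Rightarrow> real \<Rightarrow> real" where
  "max_iter F r 0 = r"
| "max_iter F r (Suc n) = (\<lambda>z. max (r z) (F (max_iter F r n) z))"

section \<open>The profile operator and its monotone iteration\<close>

context mono_H
begin

text \<open>Inverting the linear part of the profile equation makes fronts of speed c fixed points
  of this order preserving map; the delay becomes the spatial shift by c h.\<close>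

definition profile_op :: "real \<Rightarrow> real \<Rightarrow> (real \<Rightarrow> real) \<Rightarrow> real \<Rightarrow> real" where
  "profile_op c h f = Kop c (\<lambda>x. g (f (x - c * h)))"

definition is_profile :: "(real \<Rightarrow> real) \<Rightarrow> bool" where
  "is_profile f \<longleftrightarrow> bcont f \<and> (\<forall>x. 0 \<le> f x \<and> f x \<le> \<kappa>)"

lemma is_profileD: "is_profile f \<Longrightarrow> bcont f" "is_profile f \<Longrightarrow> 0 \<le> f x" "is_profile f \<Longrightarrow> f x \<le> \<kappa>"
  unfolding is_profile_def by auto

lemma is_profile_translate: "is_profile f \<Longrightarrow> is_profile (\<lambda>x. f (x + a))"
  unfolding is_profile_def using bcont_translate by blast

lemma bcont_g_profile: assumes "is_profile f" shows "bcont (\<lambda>x. g (f (x - a)))"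
proof -
  have "bcont (\<lambda>x. g (f (x + (- a))))"
    by (rule bcont_g) (use assms in \<open>auto simp: is_profile_def intro: bcont_translate_minus\<close>)
  then show ?thesis by simp
qed

lemma is_profile_profile_op: assumes "is_profile f" shows "is_profile (profile_op c h f)"
proof -
  have b: "bcont (\<lambda>x. g (f (x - c * h)))" by (rule bcont_g_profile[OF assms])
  have "0 \<le> profile_op c h f x" "profile_op c h f x \<le> \<kappa>" for x
    unfolding profile_op_def
    using Kop_nonneg[OF b] Kop_le[OF b] g_nonneg g_le_kappa is_profileD[OF assms] by auto
  then show ?thesis using bcont_Kop[OF b] unfolding is_profile_def profile_op_def by blast
qed

lemma profile_op_mono:
  assumes "is_profile f" "is_profile f'" "\<And>x. f x \<le> f' x"
  shows "profile_op c h f z \<le> profile_op c h f' z"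
  unfolding profile_op_def using assms by (intro Kop_mono bcont_g_profile monoD[OF mono])

lemma mono_profile_op: assumes "is_profile f" "mono f" shows "mono (profile_op c h f)"
  unfolding profile_op_def
  by (rule mono_Kop) (use assms mono in \<open>auto intro!: bcont_g_profile simp: mono_def\<close>)

lemma profile_op_translate: "profile_op c h (\<lambda>x. f (x + a)) z = profile_op c h f (z + a)"
  using Kop_translate[of c "\<lambda>x. g (f (x - c * h))" a z] unfolding profile_op_def by (simp add: algebra_simps)

lemma isCont_g: "isCont g x"
  using continuous_g[of UNIV] by (simp add: continuous_on_eq_continuous_at)

lemma tendsto_shift_at_top:
  fixes f :: "real \<Rightarrow> real"
  assumes "(f \<longlongrightarrow> l) at_top" shows "((\<lambda>x. f (x - a)) \<longlongrightarrow> l) at_top"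
proof -
  have "filterlim (\<lambda>x. - a + x) at_top at_top"
    by (rule filterlim_tendsto_add_at_top[OF tendsto_const filterlim_ident])
  then show ?thesis using filterlim_compose[OF assms] by simp
qed

lemma tendsto_shift_at_bot:
  fixes f :: "real \<Rightarrow> real"
  assumes "(f \<longlongrightarrow> l) at_bot" shows "((\<lambda>x. f (x - a)) \<longlongrightarrow> l) at_bot"
proof -
  have "filterlim (\<lambda>x. - a + x) at_bot at_bot"
    using filterlim_tendsto_add_at_top[OF tendsto_const filterlim_ident, of a]
    by (auto simp: filterlim_at_bot_mirror filterlim_uminus_at_bot)
  then show ?thesis using filterlim_compose[OF assms] by simp
qed

lemma profile_op_at_top:
  assumes "is_profile f" "(f \<longlongrightarrow> l) at_top" shows "(profile_op c h f \<longlongrightarrow> g l) at_top"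
  unfolding profile_op_def
  by (intro Kop_tendsto_at_top bcont_g_profile assms isCont_tendsto_compose[OF isCont_g] tendsto_shift_at_top)

lemma profile_op_at_bot:
  assumes "is_profile f" "(f \<longlongrightarrow> l) at_bot" shows "(profile_op c h f \<longlongrightarrow> g l) at_bot"
  unfolding profile_op_def
  by (intro Kop_tendsto_at_bot bcont_g_profile assms isCont_tendsto_compose[OF isCont_g] tendsto_shift_at_bot)

lemma profile_op_tendsto:
  assumes "\<And>n. is_profile (f n)" "is_profile f'" "\<And>x. (\<lambda>n. f n x) \<longlonglongrightarrow> f' x"
  shows "(\<lambda>n. profile_op c h (f n) z) \<longlonglongrightarrow> profile_op c h f' z"
  unfolding profile_op_def
proof (rule Kop_tendsto_seq[where B = \<kappa>])
  show "\<bar>g (f n (x - c * h))\<bar> \<le> \<kappa>" for n x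
    using g_nonneg[OF is_profileD(2)[OF assms(1)]] g_le_kappa[OF is_profileD(3)[OF assms(1)]] by simp
  show "(\<lambda>n. g (f n (x - c * h))) \<longlonglongrightarrow> g (f' (x - c * h))" for x
    by (intro isCont_tendsto_compose[OF isCont_g] assms)
qed (use assms bcont_g_profile in auto)

text \<open>The derivative is \<open>rate_p c\<close> times a difference of two means, both in
  [0, \<kappa>]. The constant does not depend on f, which is the equicontinuity behind all limits of
  iterates.\<close>

lemma profile_op_lipschitz:
  assumes f: "is_profile f"
  shows "\<bar>profile_op c h f x - profile_op c h f y\<bar> \<le> rate_p c * \<kappa> * \<bar>x - y\<bar>"
proof -
  define G where "G = (\<lambda>x. g (f (x - c * h)))"
  have b: "bcont G" unfolding G_def by (rule bcont_g_profile[OF f])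
  have G: "0 \<le> G x" "G x \<le> \<kappa>" for x unfolding G_def using g_nonneg g_le_kappa is_profileD[OF f] by auto
  have "0 \<le> Em (rate_m c) G x" "Em (rate_m c) G x \<le> \<kappa>" for x
    using Em_mono[OF rates(2) bcont_const b, of 0 c x] Em_mono[OF rates(2) b bcont_const, of \<kappa> c x]
      Em_const[OF rates(2)] G by auto
  moreover have "0 \<le> Kop c G x" "Kop c G x \<le> \<kappa>" for x
    using Kop_nonneg[OF b G(1)] Kop_le[OF b G(2)] by auto
  ultimately have "\<bar>Em (rate_m c) G x - Kop c G x\<bar> \<le> \<kappa>" for x by (auto simp: abs_le_iff) (smt (verit))+
  then have K': "\<bar>Kop' c G x\<bar> \<le> rate_p c * \<kappa>" for x
    using rates(1)[of c] unfolding Kop'_def by (simp add: abs_mult)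
  have "norm (Kop c G x - Kop c G y) \<le> rate_p c * \<kappa> * norm (x - y)"
    by (rule field_differentiable_bound[of UNIV "Kop c G" "Kop' c G"])
       (use K' in \<open>auto intro: DERIV_subset Kop_deriv[OF b]\<close>)
  then show ?thesis unfolding profile_op_def G_def by simp
qed

lemma fixed_point_wavefront:
  assumes \<psi>: "is_profile \<psi>" "\<And>z. \<psi> z = profile_op c h \<psi> z" and pos: "\<And>z. \<psi> z > 0"
    and lim: "(\<psi> \<longlongrightarrow> 0) at_bot" "(\<psi> \<longlongrightarrow> \<kappa>) at_top"
  shows "wavefront g h \<kappa> c \<psi>"
proof -
  define G where "G = (\<lambda>x. g (\<psi> (x - c * h)))"
  have b: "bcont G" unfolding G_def by (rule bcont_g_profile[OF \<psi>(1)])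
  have eq: "\<psi> = Kop c G" using \<psi>(2) unfolding profile_op_def G_def by blast
  define d1 where "d1 = Kop' c G"
  define d2 where "d2 z = c * d1 z + \<psi> z - G z" for z
  have d: "(\<psi> has_real_derivative d1 z) (at z)" "(d1 has_real_derivative d2 z) (at z)" for z
    using Kop_deriv[OF b] Kop'_deriv[OF b] unfolding eq d1_def d2_def by auto
  have "pde_sol_on g h UNIV (\<lambda>t x. \<psi> (x + c * t))"
    unfolding pde_sol_on_def
  proof (intro ballI allI)
    fix t x
    have t: "((\<lambda>s. \<psi> (x + c * s)) has_real_derivative d1 (x + c * t) * c) (at t)"
      by (rule DERIV_chain2[OF d(1)]) (auto intro!: derivative_eq_intros)
    have x: "((\<lambda>y. \<psi> (y + c * t)) has_real_derivative d1 (y + c * t)) (at y)" for y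
      using d(1)[of "y + c * t"] by (rule DERIV_shift[THEN iffD1])
    then have dx: "deriv (\<lambda>y. \<psi> (y + c * t)) = (\<lambda>y. d1 (y + c * t))" by (intro ext DERIV_imp_deriv)
    have xx: "((\<lambda>y. d1 (y + c * t)) has_real_derivative d2 (x + c * t)) (at x)"
      using d(2)[of "x + c * t"] by (rule DERIV_shift[THEN iffD1])
    have "d1 (x + c * t) * c = d2 (x + c * t) - \<psi> (x + c * t) + g (\<psi> (x + c * (t - h)))"
      unfolding d2_def G_def by (simp add: algebra_simps)
    then show "(\<lambda>s. \<psi> (x + c * s)) differentiable at t \<and> (\<lambda>y. \<psi> (y + c * t)) differentiable at x \<and>
      deriv (\<lambda>y. \<psi> (y + c * t)) differentiable at x \<and>
      deriv (\<lambda>s. \<psi> (x + c * s)) t = deriv (deriv (\<lambda>y. \<psi> (y + c * t))) x - \<psi> (x + c * t) + g (\<psi> (x + c * (t - h)))"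
      unfolding dx DERIV_imp_deriv[OF t] DERIV_imp_deriv[OF xx]
      using t x xx by (auto simp: real_differentiable_def)
  qed
  then show ?thesis unfolding wavefront_def using pos lim by blast
qed

text \<open>A single zero would make the whole source vanish by \<open>Kop_eq_0\<close>, while g is
  positive on positive values.\<close>

lemma positive_of_fixed_point:
  assumes \<psi>: "is_profile \<psi>" "\<And>z. \<psi> z = profile_op c h \<psi> z" and p: "\<psi> p > 0"
  shows "\<psi> z > 0"
proof (rule ccontr)
  assume "\<not> \<psi> z > 0"
  then have "\<psi> z = 0" using is_profileD(2)[OF \<psi>(1), of z] by simp
  then have 0: "Kop c (\<lambda>x. g (\<psi> (x - c * h))) z = 0" using \<psi>(2)[of z] unfolding profile_op_def by simp
  have "g (\<psi> ((p + c * h) - c * h)) = 0"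
    by (rule Kop_eq_0[OF bcont_g_profile[OF \<psi>(1)] _ 0]) (rule g_nonneg[OF is_profileD(2)[OF \<psi>(1)]])
  then show False using g_pos[OF p] by simp
qed

text \<open>Weinberger's construction: maximal iterates started from ramps \<open>r / (k + 1)\<close> stay below the supersolution;
  normalising them at \<open>\<kappa> / 2\<close> and letting \<open>k\<close> tend to infinity removes the ramp.\<close>

lemma wavefront_from_supersolution:
  assumes \<Phi>: "is_profile \<Phi>" "\<And>z. profile_op c h \<Phi> z \<le> \<Phi> z" "(\<Phi> \<longlongrightarrow> 0) at_bot"
    and \<alpha>: "\<alpha> > 0" "\<And>z. z \<ge> 0 \<Longrightarrow> \<alpha> \<le> \<Phi> z"
  shows "\<exists>\<psi>. wavefront g h \<kappa> c \<psi>"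
proof -
  \<comment> \<open>The ramps vanish for z \<le> 0 and stay below \<alpha> to the right, hence below
    \<Phi> everywhere.\<close>
  define \<beta> where "\<beta> = min \<alpha> (\<kappa>/2)"
  have \<beta>: "\<beta> > 0" "\<beta> \<le> \<alpha>" "\<beta> \<le> \<kappa>" using \<alpha> kappa_pos by (auto simp: \<beta>_def)
  define r where "r k z = \<beta> * max 0 (min z 1) / (real k + 1)" for k :: nat and z
  have r0: "0 \<le> r k z" "r k z \<le> \<beta> / (real k + 1)" "r k z \<le> \<Phi> z" for k z
  proof -
    have m: "0 \<le> max 0 (min z 1)" "max 0 (min z 1) \<le> 1" by auto
    show "0 \<le> r k z" unfolding r_def using \<beta> by simp
    have "\<beta> * max 0 (min z 1) \<le> \<beta> * 1" using m \<beta> by (intro mult_left_mono) auto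
    then show 1: "r k z \<le> \<beta> / (real k + 1)" unfolding r_def by (intro divide_right_mono) auto
    show "r k z \<le> \<Phi> z"
    proof (cases "z \<ge> 0")
      case True
      have "\<beta> / (real k + 1) \<le> \<beta> / 1" using \<beta> by (intro divide_left_mono) auto
      then show ?thesis using 1 \<alpha>(2)[OF True] \<beta> by simp
    next
      case False
      then show ?thesis using is_profileD(2)[OF \<Phi>(1)] by (simp add: r_def)
    qed
  qed
  define M where "M = max (rate_p c * \<kappa>) \<beta>"
  have M: "M > 0" "rate_p c * \<kappa> \<le> M" "\<beta> \<le> M" using \<beta> by (auto simp: M_def)
  \<comment> \<open>A class closed under the profile operator, maxima, translations and pointwise
    limits, with one Lipschitz constant throughout.\<close>
  define good where "good f \<longleftrightarrow> (\<forall>z. 0 \<le> f z \<and> f z \<le> \<kappa>) \<and> mono f \<and> (\<forall>x y. \<bar>f x - f y\<bar> \<le> M * \<bar>x - y\<bar>)"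
    for f :: "real \<Rightarrow> real"
  have goodD: "is_profile f" "mono f" "\<bar>f x - f y\<bar> \<le> M * \<bar>x - y\<bar>" if "good f" for f x y
  proof -
    have "continuous_on UNIV f"
      by (rule lipschitz_on_continuous_on[of M])
         (use that M in \<open>auto intro!: lipschitz_onI simp: dist_real_def good_def\<close>)
    moreover have "\<bar>f x\<bar> \<le> \<kappa>" for x using that unfolding good_def by auto
    ultimately have "bcont f" by (rule bcontI)
    then show "is_profile f" using that unfolding is_profile_def good_def by blast
    show "mono f" "\<bar>f x - f y\<bar> \<le> M * \<bar>x - y\<bar>" using that unfolding good_def by auto
  qed
  have good_op: "good (profile_op c h f)" if "good f" for f
  proof -
    have "\<bar>profile_op c h f x - profile_op c h f y\<bar> \<le> M * \<bar>x - y\<bar>" for x y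
      using profile_op_lipschitz[OF goodD(1)[OF that], of c h x y] mult_right_mono[OF M(2), of "\<bar>x - y\<bar>"] by simp
    then show ?thesis
      using is_profile_profile_op[OF goodD(1)[OF that], of c h] mono_profile_op[OF goodD(1,2)[OF that], of c h]
      unfolding good_def is_profile_def by blast
  qed
  have good_r: "good (r k)" for k
  proof -
    have "0 \<le> r k z \<and> r k z \<le> \<kappa>" for z using r0(1,3)[of k z] is_profileD(3)[OF \<Phi>(1), of z] by auto
    moreover have "mono (r k)" unfolding r_def using \<beta> by (intro monoI divide_right_mono mult_left_mono) auto
    moreover have "\<bar>r k x - r k y\<bar> \<le> M * \<bar>x - y\<bar>" for x y
    proof -
      have "r k x - r k y = \<beta> / (real k + 1) * (max 0 (min x 1) - max 0 (min y 1))"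
        unfolding r_def by (simp add: diff_divide_distrib right_diff_distrib)
      then have "\<bar>r k x - r k y\<bar> = \<beta> / (real k + 1) * \<bar>max 0 (min x 1) - max 0 (min y 1)\<bar>"
        using \<beta> by (simp add: abs_mult)
      also have "\<dots> \<le> M * \<bar>x - y\<bar>"
      proof (intro mult_mono)
        have "\<beta> / (real k + 1) \<le> \<beta> / 1" using \<beta> by (intro divide_left_mono) auto
        then show "\<beta> / (real k + 1) \<le> M" using M by simp
        show "\<bar>max 0 (min x 1) - max 0 (min y 1)\<bar> \<le> \<bar>x - y\<bar>" by (simp add: abs_if max_def min_def)
      qed (use M in auto)
      finally show ?thesis .
    qed
    ultimately show ?thesis unfolding good_def by blast
  qed
  have good_max: "good (\<lambda>z. max (f z) (f' z))" if "good f" "good f'" for f f'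
    unfolding good_def
  proof (intro conjI allI)
    fix x y
    have "\<bar>max (f x) (f' x) - max (f y) (f' y)\<bar> \<le> max \<bar>f x - f y\<bar> \<bar>f' x - f' y\<bar>"
      by (simp add: abs_if max_def)
    then show "\<bar>max (f x) (f' x) - max (f y) (f' y)\<bar> \<le> M * \<bar>x - y\<bar>"
      using goodD(3)[OF that(1), of x y] goodD(3)[OF that(2), of x y] by linarith
    show "mono (\<lambda>z. max (f z) (f' z))"
      using goodD(2)[OF that(1)] goodD(2)[OF that(2)] unfolding mono_def by (meson max.mono)
  qed (use that in \<open>auto simp: good_def le_max_iff_disj\<close>)
  have good_lim: "good f'" if f: "\<And>n. good (f n)" "\<And>z. (\<lambda>n. f n z) \<longlonglongrightarrow> f' z" for f :: "nat \<Rightarrow> real \<Rightarrow> real" and f'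
    unfolding good_def
  proof (intro conjI allI monoI)
    show "0 \<le> f' z" for z by (rule LIMSEQ_le_const[OF f(2)]) (use f(1) in \<open>auto simp: good_def\<close>)
    show "f' z \<le> \<kappa>" for z by (rule LIMSEQ_le_const2[OF f(2)]) (use f(1) in \<open>auto simp: good_def\<close>)
    show "f' x \<le> f' y" if "x \<le> y" for x y
      by (rule LIMSEQ_le[OF f(2) f(2)]) (use f(1) that in \<open>auto simp: good_def mono_def\<close>)
    show "\<bar>f' x - f' y\<bar> \<le> M * \<bar>x - y\<bar>" for x y
      by (rule LIMSEQ_le_const2[OF tendsto_rabs[OF tendsto_diff[OF f(2) f(2)]]]) (use f(1) in \<open>auto simp: good_def\<close>)
  qed
  define a where "a k = max_iter (profile_op c h) (r k)" for k
  have a0: "a k 0 = r k" and aS: "a k (Suc n) = (\<lambda>z. max (r k z) (profile_op c h (a k n) z))" for k n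
    unfolding a_def by simp_all
  have good_a: "good (a k n)" for k n
    by (induction n) (auto simp: a0 aS intro!: good_r good_max good_op)
  have a_le: "a k n z \<le> \<Phi> z" for k n z
  proof (induction n arbitrary: z)
    case (Suc n)
    have "profile_op c h (a k n) z \<le> profile_op c h \<Phi> z"
      by (intro profile_op_mono goodD good_a \<Phi>) (rule Suc.IH)
    then show ?case using r0(3)[of k z] \<Phi>(2)[of z] by (simp add: aS)
  qed (simp add: a0 r0)
  have a_inc: "a k n z \<le> a k (Suc n) z" for k n z
  proof (induction n arbitrary: z)
    case (Suc n)
    have "profile_op c h (a k n) z \<le> profile_op c h (a k (Suc n)) z"
      by (intro profile_op_mono goodD good_a Suc.IH)
    then show ?case unfolding aS[of k "Suc n"] by (subst (1) aS) auto
  qed (simp add: a0 aS)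
  have "\<exists>l. (\<lambda>n. a k n z) \<longlonglongrightarrow> l" for k z
  proof -
    have "incseq (\<lambda>n. a k n z)" by (rule incseq_SucI) (rule a_inc)
    moreover have "Bseq (\<lambda>n. a k n z)"
      using good_a[of k] unfolding good_def by (intro BseqI'[of _ \<kappa>]) auto
    ultimately show ?thesis using Bseq_mono_convergent[of "\<lambda>n. a k n z"] by (auto simp: incseq_def convergent_def)
  qed
  then obtain b where b: "\<And>k z. (\<lambda>n. a k n z) \<longlonglongrightarrow> b k z" by metis
  have good_b: "good (b k)" for k by (rule good_lim[OF good_a b])
  have b_eq: "b k z = max (r k z) (profile_op c h (b k) z)" for k z
  proof (rule LIMSEQ_unique)
    show "(\<lambda>n. a k (Suc n) z) \<longlonglongrightarrow> b k z" by (rule LIMSEQ_Suc[OF b])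
    show "(\<lambda>n. a k (Suc n) z) \<longlonglongrightarrow> max (r k z) (profile_op c h (b k) z)"
      unfolding aS by (intro tendsto_max tendsto_const profile_op_tendsto goodD(1)[OF good_a] goodD(1)[OF good_b] b)
  qed
  have b_bot: "(b k \<longlongrightarrow> 0) at_bot" for k
  proof (rule tendsto_sandwich[OF _ _ tendsto_const \<Phi>(3)])
    show "\<forall>\<^sub>F z in at_bot. b k z \<le> \<Phi> z"
      by (intro always_eventually allI LIMSEQ_le_const2[OF b]) (use a_le in auto)
  qed (use good_b in \<open>auto simp: good_def\<close>)
  \<comment> \<open>The limit l satisfies g l \<le> l, and the ramp keeps it positive; since g lies
    above the diagonal on (0, \<kappa>), it must be \<kappa>. The supersolution controls the other
    end.\<close>
  have b_top: "(b k \<longlongrightarrow> \<kappa>) at_top" for k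
  proof -
    have "\<bar>b k x\<bar> \<le> \<kappa>" for x using good_b[of k] unfolding good_def by auto
    then obtain l where l: "(b k \<longlongrightarrow> l) at_top" "\<And>x. b k x \<le> l"
      using mono_bounded_limits(1)[OF goodD(2)[OF good_b[of k]]] by metis
    have le: "profile_op c h (b k) x \<le> b k x" for x using b_eq[of k x] by linarith
    have "g l \<le> l"
      by (rule tendsto_le[OF _ l(1) profile_op_at_top[OF goodD(1)[OF good_b] l(1), of c h]])
         (auto intro!: always_eventually le)
    moreover have "l \<le> \<kappa>"
      by (rule tendsto_upperbound[OF l(1)]) (use good_b[of k] in \<open>auto simp: good_def\<close>)
    moreover have "l > 0"
    proof -
      have "r k 1 > 0" using \<beta> by (simp add: r_def)
      then show ?thesis using l(2)[of 1] b_eq[of k 1] by simp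
    qed
    ultimately have "l = \<kappa>" using g_gt[of l] by fastforce
    then show ?thesis using l by simp
  qed
  have "\<exists>z. b k z = \<kappa>/2" for k
  proof -
    have "\<forall>\<^sub>F z in at_bot. b k z < \<kappa>/2" using b_bot kappa_pos by (intro order_tendstoD) auto
    then obtain z1 where z1: "b k z1 < \<kappa>/2" by (meson eventually_happens trivial_limit_at_bot_linorder)
    have "\<forall>\<^sub>F z in at_top. \<kappa>/2 < b k z" using b_top[of k] kappa_pos by (intro order_tendstoD) auto
    then obtain z2 where z2: "b k z2 > \<kappa>/2" by (meson eventually_happens trivial_limit_at_top_linorder)
    have "z1 \<le> z2" using monoD[OF goodD(2)[OF good_b[of k]], of z2 z1] z1 z2 by linarith
    have "continuous_on {z1..z2} (b k)"
      using bcont_continuous[OF is_profileD(1)[OF goodD(1)[OF good_b]]] by (rule continuous_on_subset) auto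
    then show ?thesis using IVT'[of "b k" z1 "\<kappa>/2" z2] z1 z2 \<open>z1 \<le> z2\<close> by auto
  qed
  then obtain \<zeta> where \<zeta>: "\<And>k. b k (\<zeta> k) = \<kappa>/2" by metis
  define B where "B k z = b k (z + \<zeta> k)" for k z
  have good_B: "good (B k)" for k
  proof -
    have "\<bar>b k (x + \<zeta> k) - b k (y + \<zeta> k)\<bar> \<le> M * \<bar>x - y\<bar>" for x y
      using goodD(3)[OF good_b, of k "x + \<zeta> k" "y + \<zeta> k"] by simp
    then show ?thesis using good_b[of k] unfolding good_def B_def mono_def by simp
  qed
  \<comment> \<open>The maximum differs from its second entry by at most the ramp, so the defect as
    a fixed point is at most \<beta> / (k + 1), wherever the ramp has been shifted to.\<close>
  have B_eq: "\<bar>B k z - profile_op c h (B k) z\<bar> \<le> \<beta> / (real k + 1)" for k z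
  proof -
    have op: "profile_op c h (B k) z = profile_op c h (b k) (z + \<zeta> k)"
      unfolding B_def[abs_def] by (rule profile_op_translate)
    have "0 \<le> profile_op c h (b k) (z + \<zeta> k)"
      by (rule is_profileD(2)[OF is_profile_profile_op[OF goodD(1)[OF good_b]]])
    then show ?thesis unfolding op
      using b_eq[of k "z + \<zeta> k"] r0(1,2)[of k "z + \<zeta> k"] by (simp add: B_def)
  qed
  have "\<exists>s. strict_mono (s::nat \<Rightarrow> nat) \<and> (\<forall>x. convergent (\<lambda>n. B (s n) x))"
    by (rule equi_lipschitz_selection[where B = \<kappa> and M = M])
       (use good_B M in \<open>auto simp: good_def\<close>)
  then obtain s \<psi> where s: "strict_mono (s::nat \<Rightarrow> nat)" and lim: "\<And>x. (\<lambda>n. B (s n) x) \<longlonglongrightarrow> \<psi> x"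
    unfolding convergent_def by metis
  have good_\<psi>: "good \<psi>" by (rule good_lim[OF good_B lim])
  have eq: "\<psi> z = profile_op c h \<psi> z" for z
  proof -
    have "(\<lambda>n. B (s n) z - profile_op c h (B (s n)) z) \<longlonglongrightarrow> \<psi> z - profile_op c h \<psi> z"
      by (intro tendsto_diff lim profile_op_tendsto goodD(1)[OF good_B] goodD(1)[OF good_\<psi>])
    moreover have "(\<lambda>n. B (s n) z - profile_op c h (B (s n)) z) \<longlonglongrightarrow> 0"
    proof (rule tendsto_rabs_zero_cancel, rule tendsto_sandwich[OF _ _ tendsto_const])
      have "(\<lambda>n. \<beta> / (real n + 1)) \<longlonglongrightarrow> 0" by real_asymp
      then show "(\<lambda>n. \<beta> / (real (s n) + 1)) \<longlonglongrightarrow> 0" using LIMSEQ_subseq_LIMSEQ[OF _ s] by (auto simp: o_def)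
    qed (use B_eq in auto)
    ultimately show ?thesis using LIMSEQ_unique by fastforce
  qed
  have \<psi>0: "\<psi> 0 = \<kappa>/2"
  proof -
    have "(\<lambda>n. B (s n) 0) \<longlonglongrightarrow> \<kappa>/2" by (simp add: B_def \<zeta>)
    then show ?thesis using LIMSEQ_unique lim by blast
  qed
  note P\<psi> = goodD(1)[OF good_\<psi>]
  have bd: "\<bar>\<psi> x\<bar> \<le> \<kappa>" for x using good_\<psi> unfolding good_def by auto
  have opeq: "profile_op c h \<psi> = \<psi>" by (intro ext eq[symmetric])
  obtain l where l: "(\<psi> \<longlongrightarrow> l) at_top" "\<And>x. \<psi> x \<le> l"
    using mono_bounded_limits(1)[OF goodD(2)[OF good_\<psi>] bd] by metis
  have "(\<psi> \<longlongrightarrow> g l) at_top" using profile_op_at_top[OF P\<psi> l(1), of c h] unfolding opeq .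
  then have "g l = l" by (rule tendsto_unique[OF trivial_limit_at_top_linorder _ l(1)])
  \<comment> \<open>Both limits are fixed points of g; the normalisation \<psi> 0 = \<kappa> / 2
    decides which one occurs at which end.\<close>
  then have l\<kappa>: "l = \<kappa>" using fixed_points[of l] l(2)[of 0] \<psi>0 kappa_pos by auto
  obtain m where m: "(\<psi> \<longlongrightarrow> m) at_bot" "\<And>x. m \<le> \<psi> x"
    using mono_bounded_limits(2)[OF goodD(2)[OF good_\<psi>] bd] by metis
  have "(\<psi> \<longlongrightarrow> g m) at_bot" using profile_op_at_bot[OF P\<psi> m(1), of c h] unfolding opeq .
  then have "g m = m" by (rule tendsto_unique[OF trivial_limit_at_bot_linorder _ m(1)])
  moreover have "m \<ge> 0" by (rule tendsto_lowerbound[OF m(1)]) (use good_\<psi> in \<open>auto simp: good_def\<close>)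
  ultimately have m0: "m = 0" using fixed_points[of m] m(2)[of 0] \<psi>0 kappa_pos by auto
  have pos: "\<psi> z > 0" for z by (rule positive_of_fixed_point[OF P\<psi> eq, of 0]) (use \<psi>0 kappa_pos in simp)
  show ?thesis using fixed_point_wavefront[OF P\<psi> eq pos] l(1) m(1) l\<kappa> m0 by blast
qed

end

section \<open>Decay and monotonicity of the pushed front\<close>

lemma eta_nonneg: "0 \<le> eta l z" and eta_pos: "0 < eta l z" and eta_le_1: "eta l z \<le> 1"
  and eta_le_exp: "eta l z \<le> exp (l * z)"
  unfolding eta_def by auto

lemma bcont_eta: "bcont (eta l)"
proof -
  have "continuous_on UNIV (eta l)" unfolding eta_def[abs_def] by (intro continuous_intros)
  then show ?thesis by (rule bcontI[of _ 1]) (simp add: eta_nonneg eta_le_1)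
qed

lemma eta_mono: "l \<ge> 0 \<Longrightarrow> x \<le> y \<Longrightarrow> eta l x \<le> eta l y"
  unfolding eta_def by (intro min.mono) (auto simp: mult_left_mono)

lemma eta_eq_1: "l \<ge> 0 \<Longrightarrow> z \<ge> 0 \<Longrightarrow> eta l z = 1"
  unfolding eta_def by simp

lemma eta_eq_exp: "l \<ge> 0 \<Longrightarrow> z \<le> 0 \<Longrightarrow> eta l z = exp (l * z)"
  unfolding eta_def by (simp add: mult_nonneg_nonpos)

lemma le_eta: assumes "y \<le> C * exp (l * z)" "y \<le> C'" "C \<le> M" "C' \<le> M" "0 \<le> M"
  shows "y \<le> M * eta l z"
proof -
  have "C * exp (l * z) \<le> M * exp (l * z)" using assms by (intro mult_right_mono) auto
  then have "y \<le> M * exp (l * z)" "y \<le> M" using assms by linarith+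
  then show ?thesis unfolding eta_def by (auto simp: min_def)
qed

text \<open>The exponential bound works on the left and the constant bound on the right. With
  \<gamma> slightly above g'(0) and \<rho> slightly below 1, the condition linking them is chi(l, c)
  < 0 with a margin.\<close>

lemma Kop_weight_contract:
  assumes l: "0 \<le> l" "0 < 1 + c * l - l\<^sup>2" and f: "bcont f" "\<And>x. f x \<le> \<gamma> * exp (l * x)" "\<And>x. f x \<le> \<rho>"
    and \<gamma>: "\<gamma> * exp (- l * c * h) \<le> \<rho> * (1 + c * l - l\<^sup>2)" and \<rho>: "0 \<le> \<rho>"
  shows "Kop c f (z - c * h) \<le> \<rho> * eta l z"
proof (rule le_eta)
  show "Kop c f (z - c * h) \<le> \<rho>" by (rule Kop_le[OF f(1,3)])
  have "Kop c f (z - c * h) \<le> \<gamma> / (1 + c * l - l\<^sup>2) * exp (l * (z - c * h))"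
    by (rule Kop_exp_bound[OF l f(1,2)])
  also have "exp (l * (z - c * h)) = exp (- l * c * h) * exp (l * z)"
    by (simp add: exp_add[symmetric] algebra_simps)
  also have "\<gamma> / (1 + c * l - l\<^sup>2) * (exp (- l * c * h) * exp (l * z))
      = (\<gamma> * exp (- l * c * h)) / (1 + c * l - l\<^sup>2) * exp (l * z)" by simp
  also have "\<dots> \<le> \<rho> * exp (l * z)"
    using \<gamma> l by (intro mult_right_mono) (auto simp: field_simps)
  finally show "Kop c f (z - c * h) \<le> \<rho> * exp (l * z)" .
qed (use \<rho> in auto)

text \<open>\<open>Kop'\<close> is a multiple of the difference of two nonnegative means, each of
  which inherits both the exponential and the constant bound; cancellation plays no part.\<close>

lemma Kop'_weight_bound:
  assumes l: "0 \<le> l" "0 < 1 + c * l - l\<^sup>2" and f: "bcont f" "\<And>x. 0 \<le> f x" "\<And>x. f x \<le> C * exp (l * x)" "\<And>x. f x \<le> B"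
    and C: "0 \<le> C" "0 \<le> B"
  shows "\<exists>M\<ge>0. \<forall>z. \<bar>Kop' c f z\<bar> \<le> M * eta l z"
proof -
  define M where "M = Max {C * (rate_m c / (rate_m c - l)), C / (1 + c * l - l\<^sup>2), B}"
  have M: "C * (rate_m c / (rate_m c - l)) \<le> M" "C / (1 + c * l - l\<^sup>2) \<le> M" "B \<le> M" by (auto simp: M_def)
  have M0: "M \<ge> 0" using M C by linarith
  have "\<bar>Kop' c f z\<bar> \<le> (rate_p c * M) * eta l z" for z
  proof -
    have "0 \<le> Em (rate_m c) f z"
      using Em_mono[OF rates(2) bcont_const f(1), of 0 c z] f(2) Em_const[OF rates(2), of c 0 z] by simp
    moreover have "0 \<le> Kop c f z" by (rule Kop_nonneg[OF f(1,2)])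
    moreover have "Em (rate_m c) f z \<le> M * eta l z"
    proof (rule le_eta[OF Em_rate_exp_bound[OF l f(1,3)]])
      show "Em (rate_m c) f z \<le> B"
        using Em_mono[OF rates(2) f(1) bcont_const, of B c z] f(4) Em_const[OF rates(2), of c B z] by simp
    qed (use M M0 in auto)
    moreover have "Kop c f z \<le> M * eta l z"
      by (rule le_eta[OF Kop_exp_bound[OF l f(1,3)] Kop_le[OF f(1,4)]]) (use M M0 in auto)
    ultimately have "\<bar>Em (rate_m c) f z - Kop c f z\<bar> \<le> M * eta l z" by linarith
    then show ?thesis using rates(1)[of c] unfolding Kop'_def by (simp add: abs_mult mult.assoc)
  qed
  then show ?thesis using M0 rates(1)[of c] by (intro exI[of _ "rate_p c * M"]) auto
qed

lemma tendsto_at_botD: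
  fixes f :: "real \<Rightarrow> real"
  assumes "(f \<longlongrightarrow> l) at_bot" "e > 0"
  obtains Y where "\<And>y. y \<le> Y \<Longrightarrow> \<bar>f y - l\<bar> < e"
  using tendstoD[OF assms] that by (auto simp: eventually_at_bot_linorder dist_real_def)

lemma tendsto_at_topD:
  fixes f :: "real \<Rightarrow> real"
  assumes "(f \<longlongrightarrow> l) at_top" "e > 0"
  obtains Y where "\<And>y. y \<ge> Y \<Longrightarrow> \<bar>f y - l\<bar> < e"
  using tendstoD[OF assms] that by (auto simp: eventually_at_top_linorder dist_real_def)

section \<open>Wavefronts as fixed points\<close>

context mono_H
begin

lemma wavefront_derivs:
  assumes "wavefront g h \<kappa> c \<phi>"
  shows "(\<phi> has_real_derivative deriv \<phi> z) (at z)"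
    and "(deriv \<phi> has_real_derivative (c * deriv \<phi> z + \<phi> z - g (\<phi> (z - c * h)))) (at z)"
proof -
  have pde: "\<And>x. (\<lambda>y. \<phi> (y + c * 0)) differentiable at x"
    "\<And>x. deriv (\<lambda>y. \<phi> (y + c * 0)) differentiable at x"
    "\<And>x. deriv (\<lambda>s. \<phi> (x + c * s)) 0
      = deriv (deriv (\<lambda>y. \<phi> (y + c * 0))) x - \<phi> (x + c * 0) + g (\<phi> (x + c * (0 - h)))"
    using assms unfolding wavefront_def pde_sol_on_def by blast+
  show d1: "(\<phi> has_real_derivative deriv \<phi> z) (at z)" for z
    using pde(1)[of z] by (simp add: DERIV_deriv_iff_real_differentiable)
  have "((\<lambda>s. \<phi> (z + c * s)) has_real_derivative deriv \<phi> (z + c * 0) * c) (at 0)"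
    by (rule DERIV_chain2[OF d1]) (auto intro!: derivative_eq_intros)
  then have "deriv (deriv \<phi>) z = c * deriv \<phi> z + \<phi> z - g (\<phi> (z - c * h))"
    using pde(3)[of z] by (simp add: DERIV_imp_deriv algebra_simps)
  moreover have "(deriv \<phi> has_real_derivative deriv (deriv \<phi>) z) (at z)"
    using pde(2)[of z] by (simp add: DERIV_deriv_iff_real_differentiable)
  ultimately show "(deriv \<phi> has_real_derivative (c * deriv \<phi> z + \<phi> z - g (\<phi> (z - c * h)))) (at z)" by simp
qed

text \<open>An overshoot would be attained because of the limits. At the maximum y the equation
  gives \<phi> y \<le> g (\<phi> y), which the linear continuation of slope below 1 beyond \<kappa>
  forbids.\<close>

lemma wavefront_le_kappa:
  assumes w: "wavefront g h \<kappa> c \<phi>"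
  shows "\<phi> z \<le> \<kappa>"
proof (rule ccontr)
  assume neg: "\<not> \<phi> z \<le> \<kappa>"
  note d = wavefront_derivs[OF w]
  have lims: "(\<phi> \<longlongrightarrow> 0) at_bot" "(\<phi> \<longlongrightarrow> \<kappa>) at_top" using w unfolding wavefront_def by auto
  obtain Y1 where Y1: "\<And>y. y \<le> Y1 \<Longrightarrow> \<bar>\<phi> y - 0\<bar> < \<phi> z"
    using tendsto_at_botD[OF lims(1), of "\<phi> z"] neg kappa_pos by (metis not_le order_less_trans)
  obtain Y2 where Y2: "\<And>y. y \<ge> Y2 \<Longrightarrow> \<bar>\<phi> y - \<kappa>\<bar> < \<phi> z - \<kappa>"
    using tendsto_at_topD[OF lims(2), of "\<phi> z - \<kappa>"] neg by (metis diff_gt_0_iff_gt not_le)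
  have z: "Y1 \<le> z" "z \<le> Y2"
  proof -
    have "\<not> \<bar>\<phi> z - 0\<bar> < \<phi> z" "\<not> \<bar>\<phi> z - \<kappa>\<bar> < \<phi> z - \<kappa>" by linarith+
    then show "Y1 \<le> z" "z \<le> Y2" using Y1[of z] Y2[of z] by linarith+
  qed
  have "continuous_on {Y1..Y2} \<phi>"
    by (rule DERIV_continuous_on) (use d(1) in \<open>auto intro: DERIV_subset\<close>)
  then obtain y where y: "y \<in> {Y1..Y2}" "\<And>x. x \<in> {Y1..Y2} \<Longrightarrow> \<phi> x \<le> \<phi> y"
    using continuous_attains_sup[of "{Y1..Y2}" \<phi>] z by auto
  have zy: "\<phi> z \<le> \<phi> y" using y(2) z by auto
  have max: "\<phi> x \<le> \<phi> y" for x
    using y(2)[of x] Y1[of x] Y2[of x] zy by (cases "x \<le> Y1"; cases "x \<ge> Y2") auto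
  have d1: "deriv \<phi> y = 0"
    by (rule DERIV_local_max[OF d(1), of 1]) (use max in auto)
  have "0 \<le> - (c * deriv \<phi> y + \<phi> y - g (\<phi> (y - c * h)))"
  proof (rule second_deriv_nonneg_at_min[of "\<lambda>x. - \<phi> x" "\<lambda>x. - deriv \<phi> x" _ y 1])
    show "((\<lambda>x. - \<phi> x) has_real_derivative - deriv \<phi> x) (at x)" for x by (rule DERIV_minus[OF d(1)])
    show "((\<lambda>x. - deriv \<phi> x) has_real_derivative - (c * deriv \<phi> y + \<phi> y - g (\<phi> (y - c * h)))) (at y)"
      by (rule DERIV_minus[OF d(2)])
  qed (use max in auto)
  then have "\<phi> y \<le> g (\<phi> (y - c * h))" using d1 by simp
  also have "\<dots> \<le> g (\<phi> y)" by (rule monoD[OF mono max])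
  also have "\<dots> = \<kappa> + deriv g \<kappa> * (\<phi> y - \<kappa>)" using linear_right[of "\<phi> y"] zy neg g_kappa by simp
  finally have "(1 - deriv g \<kappa>) * (\<phi> y - \<kappa>) \<le> 0" by (simp add: algebra_simps)
  then show False using zy neg slope_kappa by (simp add: mult_le_0_iff)
qed

lemma wavefront_is_profile:
  assumes w: "wavefront g h \<kappa> c \<phi>"
  shows "is_profile \<phi>" and "profile_op c h \<phi> = \<phi>"
proof -
  note d = wavefront_derivs[OF w]
  have pos: "0 \<le> \<phi> z" for z using w unfolding wavefront_def by (auto intro: less_imp_le)
  have b: "\<bar>\<phi> z\<bar> \<le> \<kappa>" for z using wavefront_le_kappa[OF w] pos by simp
  have "continuous_on UNIV \<phi>" by (rule DERIV_continuous_on) (use d(1) in \<open>auto intro: DERIV_subset\<close>)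
  then have "bcont \<phi>" by (rule bcontI) (rule b)
  then show P: "is_profile \<phi>"
    using wavefront_le_kappa[OF w] pos unfolding is_profile_def by blast
  show "profile_op c h \<phi> = \<phi>"
    unfolding profile_op_def
    by (intro ext, rule sym, rule Kop_unique[OF d b bcont_g_profile[OF P]]) simp
qed

text \<open>One \<epsilon> serves three purposes: the error of both linearisations and a contraction
  factor 1 - \<epsilon> in the weight, all paid for by chi < 0 and g'(\<kappa>) < 1.\<close>

lemma exists_margin:
  assumes "deriv g 0 * exp (- l * c * h) < 1 + c * l - l\<^sup>2"
  shows "\<exists>\<epsilon>. 0 < \<epsilon> \<and> \<epsilon> < 1 \<and> (deriv g 0 + \<epsilon>) * exp (- l * c * h) < (1 - \<epsilon>) * (1 + c * l - l\<^sup>2) \<and> deriv g \<kappa> + \<epsilon> < 1 - \<epsilon>"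
proof -
  have t: "(f \<longlongrightarrow> f 0) (at_right 0)" if "isCont f 0" for f :: "real \<Rightarrow> real"
    using that unfolding isCont_def by (rule filterlim_mono) (auto simp: at_le)
  have "((\<lambda>\<epsilon>. (1 - \<epsilon>) * (1 + c * l - l\<^sup>2) - (deriv g 0 + \<epsilon>) * exp (- l * c * h)) \<longlongrightarrow>
      (1 - 0) * (1 + c * l - l\<^sup>2) - (deriv g 0 + 0) * exp (- l * c * h)) (at_right 0)"
    by (rule t) (intro continuous_intros)
  then have 1: "\<forall>\<^sub>F \<epsilon> in at_right 0. (1 - \<epsilon>) * (1 + c * l - l\<^sup>2) - (deriv g 0 + \<epsilon>) * exp (- l * c * h) > 0"
    using assms by (intro order_tendstoD(1)) auto
  have "((\<lambda>\<epsilon>. 1 - \<epsilon> - (deriv g \<kappa> + \<epsilon>)) \<longlongrightarrow> 1 - 0 - (deriv g \<kappa> + 0)) (at_right 0)"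
    by (rule t) (intro continuous_intros)
  then have 2: "\<forall>\<^sub>F \<epsilon> in at_right 0. 1 - \<epsilon> - (deriv g \<kappa> + \<epsilon>) > 0"
    using slope_kappa by (intro order_tendstoD(1)) auto
  have 3: "\<forall>\<^sub>F \<epsilon> in at_right (0::real). \<epsilon> \<in> {0<..<1}" by (rule eventually_at_right_real) simp
  from 1 2 3 have "\<forall>\<^sub>F \<epsilon> in at_right 0. 0 < \<epsilon> \<and> \<epsilon> < 1 \<and>
      (deriv g 0 + \<epsilon>) * exp (- l * c * h) < (1 - \<epsilon>) * (1 + c * l - l\<^sup>2) \<and> deriv g \<kappa> + \<epsilon> < 1 - \<epsilon>"
    by eventually_elim auto
  then show ?thesis using eventually_happens'[OF trivial_limit_at_right_real] by blast
qed

end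

section \<open>Decay forced by minimality of the speed\<close>

locale pushed_front = mono_H +
  fixes h c :: real and \<phi> :: "real \<Rightarrow> real"
  assumes h: "h \<ge> 0" and front: "wavefront g h \<kappa> c \<phi>"
    and minimal: "\<And>c' \<psi>. wavefront g h \<kappa> c' \<psi> \<Longrightarrow> c \<le> c'"
    and pushed: "c > c_sharp g h"
begin

lemma c_pos: "c > 0"
  using pushed c_sharp_double_zero[OF slope_0 h] by simp

lemma ch: "c * h \<ge> 0" using c_pos h by simp

abbreviation "l1 \<equiv> lambda1 g h c"
abbreviation "l2 \<equiv> lambda2 g h c"

lemma l12: "0 < l1" "l1 < l2"
  using lambda_facts[OF slope_0 h pushed] by auto

lemma chi_margin: assumes "l1 < l" "l < l2"
  shows "deriv g 0 * exp (- l * c * h) < 1 + c * l - l\<^sup>2" "0 < 1 + c * l - l\<^sup>2"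
proof -
  show *: "deriv g 0 * exp (- l * c * h) < 1 + c * l - l\<^sup>2"
    using lambda_facts(3)[OF slope_0 h pushed assms] unfolding chi_def by linarith
  have "0 < deriv g 0 * exp (- l * c * h)" using slope_0 by simp
  then show "0 < 1 + c * l - l\<^sup>2" using * by linarith
qed

lemma phi: "is_profile \<phi>" "profile_op c h \<phi> = \<phi>" "0 < \<phi> z" "\<phi> z \<le> \<kappa>" "(\<phi> \<longlongrightarrow> 0) at_bot" "(\<phi> \<longlongrightarrow> \<kappa>) at_top"
  using wavefront_is_profile[OF front] wavefront_le_kappa[OF front] front unfolding wavefront_def by auto

text \<open>If \<open>\<phi>\<close> decayed more slowly than \<open>exp (l z)\<close>, then \<open>min \<phi> (A exp (l z))\<close> would be a strict
  supersolution, and a small perturbation of its second iterate would still be a supersolution for a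
  slightly smaller speed.\<close>

lemma fast_decay:
  assumes l: "l1 < l" "l < l2"
  shows "\<exists>C>0. \<forall>z. \<phi> z \<le> C * exp (l * z)"
proof (rule ccontr)
  assume "\<not> ?thesis"
  then have unb: "\<exists>z. \<phi> z > C * exp (l * z)" if "C > 0" for C using that by (auto simp: not_le)
  have l0: "l > 0" using l l12 by simp
  define D where "D = 1 + c * l - l\<^sup>2"
  have D: "D > 0" "deriv g 0 * exp (- l * c * h) < D" using chi_margin[OF l] by (auto simp: D_def)
  obtain \<epsilon> where \<epsilon>: "0 < \<epsilon>" "\<epsilon> < 1" "(deriv g 0 + \<epsilon>) * exp (- l * c * h) < (1 - \<epsilon>) * D" "deriv g \<kappa> + \<epsilon> < 1 - \<epsilon>"
    using exists_margin[of l c h] D(2) unfolding D_def by blast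
  define \<gamma> where "\<gamma> = deriv g 0 + \<epsilon>"
  have \<gamma>: "\<gamma> \<ge> 1" using slope_0 \<epsilon> by (simp add: \<gamma>_def)
  obtain ra where ra: "ra > 0" "\<And>x y. \<bar>x\<bar> \<le> ra \<Longrightarrow> \<bar>y\<bar> \<le> ra \<Longrightarrow> x \<le> y \<Longrightarrow>
    g y - g x \<le> (deriv g 0 + \<epsilon>) * (y - x) \<and> (deriv g 0 - \<epsilon>) * (y - x) \<le> g y - g x"
    using slope_near_0[OF \<epsilon>(1)] by metis
  obtain rb where rb: "rb > 0" "\<And>x y. \<bar>x - \<kappa>\<bar> \<le> rb \<Longrightarrow> \<bar>y - \<kappa>\<bar> \<le> rb \<Longrightarrow> x \<le> y \<Longrightarrow>
    g y - g x \<le> (deriv g \<kappa> + \<epsilon>) * (y - x)"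
    using slope_near_kappa[OF \<epsilon>(1)] by metis
  obtain L where L: "L \<ge> 1" "\<And>x y. \<bar>g x - g y\<bar> \<le> L * \<bar>x - y\<bar>" using lipschitz by blast
  obtain Y0 where Y0: "\<And>y. y \<le> Y0 \<Longrightarrow> \<phi> y \<le> ra / 2"
  proof -
    obtain Y where "\<And>y. y \<le> Y \<Longrightarrow> \<bar>\<phi> y - 0\<bar> < ra / 2" using tendsto_at_botD[OF phi(5), of "ra/2"] ra(1) by auto
    then show ?thesis using that[of Y] by fastforce
  qed
  \<comment> \<open>With this A the exponential reaches \<kappa> at Y0, so the truncation acts only
    to the left of Y0, where the linearisation at 0 is valid.\<close>
  define A where "A = \<kappa> * exp (- l * Y0)"
  have A: "A > 0" unfolding A_def using kappa_pos by simp
  have A\<kappa>: "\<kappa> \<le> A * exp (l * y)" if "y \<ge> Y0" for y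
  proof -
    have "\<kappa> * exp 0 \<le> \<kappa> * exp (l * (y - Y0))" using that l0 kappa_pos by (intro mult_left_mono) auto
    also have "\<dots> = A * exp (l * y)" unfolding A_def by (simp add: exp_add[symmetric] algebra_simps)
    finally show ?thesis by simp
  qed
  define \<Phi>0 where "\<Phi>0 z = min (A * exp (l * z)) (\<phi> z)" for z
  have P0: "is_profile \<Phi>0"
  proof -
    have "bcont \<Phi>0" unfolding \<Phi>0_def[abs_def]
      by (rule bcont_min) (use A phi is_profileD[OF phi(1)] in \<open>auto intro!: continuous_intros\<close>)
    then show ?thesis using phi(3,4) A unfolding is_profile_def \<Phi>0_def by (auto simp: min_le_iff_disj less_imp_le)
  qed
  have g\<Phi>0: "g (\<Phi>0 y) \<le> \<gamma> * A * exp (l * y)" for y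
  proof (cases "y \<le> Y0")
    case True
    have p: "0 \<le> \<Phi>0 y" "\<Phi>0 y \<le> ra" using is_profileD(2)[OF P0] Y0[OF True] ra(1) unfolding \<Phi>0_def by (auto simp: min_le_iff_disj)
    then have "g (\<Phi>0 y) \<le> \<gamma> * \<Phi>0 y" using ra(2)[of 0 "\<Phi>0 y"] ra(1) g_0 by (auto simp: \<gamma>_def)
    also have "\<dots> \<le> \<gamma> * (A * exp (l * y))" using \<gamma> by (intro mult_left_mono) (auto simp: \<Phi>0_def)
    finally show ?thesis by simp
  next
    case False
    have "g (\<Phi>0 y) \<le> \<kappa>" by (rule g_le_kappa[OF is_profileD(3)[OF P0]])
    also have "\<dots> \<le> 1 * (A * exp (l * y))" using A\<kappa>[of y] False by simp
    also have "\<dots> \<le> \<gamma> * (A * exp (l * y))" using \<gamma> A by (intro mult_right_mono) auto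
    finally show ?thesis by simp
  qed
  define G0 where "G0 = (\<lambda>x. g (\<Phi>0 (x - c * h)))"
  \<comment> \<open>Iterates replace \<Phi>0 because they are smooth with derivatives bounded by a
    multiple of \<open>eta l\<close>. That is the price per unit of a change of speed; no such bound
    is known for \<phi>' at this stage.\<close>
  define \<Phi>1 where "\<Phi>1 = profile_op c h \<Phi>0"
  have \<Phi>1K: "\<Phi>1 = Kop c G0" unfolding \<Phi>1_def G0_def profile_op_def by simp
  have bG0: "bcont G0" unfolding G0_def by (rule bcont_g_profile[OF P0])
  have P1: "is_profile \<Phi>1" unfolding \<Phi>1_def by (rule is_profile_profile_op[OF P0])
  have G0e: "G0 x \<le> (\<gamma> * A * exp (- l * c * h)) * exp (l * x)" for x
  proof -
    have "exp (l * (x - c * h)) = exp (- l * c * h) * exp (l * x)" by (simp add: exp_add[symmetric] algebra_simps)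
    then show ?thesis using g\<Phi>0[of "x - c * h"] unfolding G0_def by (simp add: mult.assoc)
  qed
  have \<Phi>1e: "\<Phi>1 z \<le> (1 - \<epsilon>) * A * exp (l * z)" for z
  proof -
    have "\<Phi>1 z \<le> (\<gamma> * A * exp (- l * c * h)) / D * exp (l * z)"
      unfolding \<Phi>1K D_def by (rule Kop_exp_bound[OF _ _ bG0 G0e]) (use l0 D in \<open>auto simp: D_def\<close>)
    also have "(\<gamma> * A * exp (- l * c * h)) / D \<le> (1 - \<epsilon>) * A"
    proof -
      have "A * (\<gamma> * exp (- l * c * h)) \<le> A * ((1 - \<epsilon>) * D)"
        using \<epsilon>(3) A by (intro mult_left_mono) (auto simp: \<gamma>_def)
      then show ?thesis using D(1) by (simp add: field_simps)
    qed
    finally show ?thesis by simp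
  qed
  have \<Phi>1\<phi>: "\<Phi>1 z \<le> \<phi> z" for z
    using profile_op_mono[OF P0 phi(1), of c h z] phi(2) unfolding \<Phi>1_def by (auto simp: \<Phi>0_def)
  have \<Phi>10: "\<Phi>1 z \<le> \<Phi>0 z" for z
  proof -
    have "(1 - \<epsilon>) * (A * exp (l * z)) \<le> 1 * (A * exp (l * z))" using \<epsilon> A by (intro mult_right_mono) auto
    then show ?thesis using \<Phi>1e[of z] \<Phi>1\<phi>[of z] unfolding \<Phi>0_def by simp
  qed
  define G1 where "G1 = (\<lambda>x. g (\<Phi>1 (x - c * h)))"
  define \<Phi>2 where "\<Phi>2 = profile_op c h \<Phi>1"
  have \<Phi>2K: "\<Phi>2 = Kop c G1" unfolding \<Phi>2_def G1_def profile_op_def by simp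
  have bG1: "bcont G1" unfolding G1_def by (rule bcont_g_profile[OF P1])
  have P2: "is_profile \<Phi>2" unfolding \<Phi>2_def by (rule is_profile_profile_op[OF P1])
  have G10: "G1 x \<le> G0 x" for x unfolding G1_def G0_def by (rule monoD[OF mono \<Phi>10])
  \<comment> \<open>Contact at one point would give equal sources everywhere by
    \<open>Kop_eq_0\<close>. Slow decay supplies a point z1 where the truncation is active; there
    \<Phi>1 < \<Phi>0, and g increases strictly near 0.\<close>
  have \<Phi>21: "\<Phi>2 z < \<Phi>1 z" for z
  proof (rule ccontr)
    assume neg: "\<not> \<Phi>2 z < \<Phi>1 z"
    have "Kop c (\<lambda>x. G0 x - G1 x) z = \<Phi>1 z - \<Phi>2 z" unfolding \<Phi>1K \<Phi>2K by (rule Kop_diff[OF bG0 bG1])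
    moreover have "0 \<le> Kop c (\<lambda>x. G0 x - G1 x) z"
      by (rule Kop_nonneg) (use bG0 bG1 G10 in \<open>auto intro: bcont_diff\<close>)
    ultimately have 0: "Kop c (\<lambda>x. G0 x - G1 x) z = 0" using neg by simp
    have eq: "G0 x - G1 x = 0" for x
      by (rule Kop_eq_0[OF bcont_diff[OF bG0 bG1] _ 0]) (use G10 in simp)
    obtain z1 where z1: "\<phi> z1 > A * exp (l * z1)" using unb[OF A] by blast
    have "z1 \<le> Y0" using A\<kappa>[of z1] z1 phi(4)[of z1] by (cases "z1 \<le> Y0") auto
    then have s: "\<Phi>0 z1 \<le> ra" using Y0[of z1] ra(1) unfolding \<Phi>0_def by auto
    have e: "\<Phi>0 z1 = A * exp (l * z1)" using z1 unfolding \<Phi>0_def by simp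
    have "\<Phi>1 z1 \<le> (1 - \<epsilon>) * \<Phi>0 z1" using \<Phi>1e[of z1] unfolding e by simp
    moreover have "\<Phi>0 z1 > 0" unfolding e using A by simp
    moreover have "(1 - \<epsilon>) * \<Phi>0 z1 < 1 * \<Phi>0 z1" if "\<Phi>0 z1 > 0"
      using \<epsilon>(1) that by (intro mult_strict_right_mono) auto
    ultimately have lt: "\<Phi>1 z1 < \<Phi>0 z1" by linarith
    have "(deriv g 0 - \<epsilon>) * (\<Phi>0 z1 - \<Phi>1 z1) \<le> g (\<Phi>0 z1) - g (\<Phi>1 z1)"
      using ra(2)[of "\<Phi>1 z1" "\<Phi>0 z1"] s lt is_profileD(2)[OF P1, of z1] by auto
    also have "\<dots> = 0" using eq[of "z1 + c * h"] unfolding G0_def G1_def by simp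
    finally show False using lt slope_0 \<epsilon> by (simp add: mult_le_0_iff)
  qed
  have \<Phi>1top: "(\<Phi>1 \<longlongrightarrow> \<kappa>) at_top"
  proof -
    have "(\<Phi>0 \<longlongrightarrow> \<kappa>) at_top"
    proof (rule Lim_transform_eventually[OF phi(6)])
      show "\<forall>\<^sub>F z in at_top. \<phi> z = \<Phi>0 z"
        using eventually_ge_at_top[of Y0]
      proof eventually_elim
        case (elim z)
        then show ?case using A\<kappa>[of z] phi(4)[of z] unfolding \<Phi>0_def by simp
      qed
    qed
    then show ?thesis using profile_op_at_top[OF P0, of \<kappa> c h] g_kappa unfolding \<Phi>1_def by simp
  qed
  obtain Y1 where Y1: "\<And>y. y \<ge> Y1 \<Longrightarrow> \<Phi>1 y > \<kappa> - rb"
  proof -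
    obtain Y where "\<And>y. y \<ge> Y \<Longrightarrow> \<bar>\<Phi>1 y - \<kappa>\<bar> < rb" using tendsto_at_topD[OF \<Phi>1top rb(1)] by blast
    then show ?thesis using that[of Y] by fastforce
  qed
  obtain Y2 where Y2: "\<And>y. y \<le> Y2 \<Longrightarrow> \<gamma> * exp (l * y) \<le> 1 - \<epsilon>"
  proof -
    have "((\<lambda>y. \<gamma> * exp (l * y)) \<longlongrightarrow> 0) at_bot" using l0 by real_asymp
    then obtain Y where "\<And>y. y \<le> Y \<Longrightarrow> \<bar>\<gamma> * exp (l * y) - 0\<bar> < 1 - \<epsilon>" using tendsto_at_botD[of _ 0 "1 - \<epsilon>"] \<epsilon> by auto
    then show ?thesis using that[of Y] by fastforce
  qed
  \<comment> \<open>Outside [-N, N] one of the linearisations applies and the matching branch of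
    \<open>e\<close> below is active; inside, the strict gap between \<Phi>1 and \<Phi>2 absorbs the
    perturbation.\<close>
  define N where "N = max 0 (max (- Y0) (max Y1 (- Y2)))"
  have N: "N \<ge> 0" "- N \<le> Y0" "N \<ge> Y1" "- N \<le> Y2" by (auto simp: N_def)
  obtain m where m: "m > 0" "\<And>y. y \<in> {-N..N} \<Longrightarrow> m \<le> \<Phi>1 y - \<Phi>2 y"
  proof -
    have "continuous_on {-N..N} (\<lambda>y. \<Phi>1 y - \<Phi>2 y)"
      using is_profileD(1)[OF P1] is_profileD(1)[OF P2]
      by (intro continuous_intros continuous_on_subset[OF bcont_continuous]) auto
    then obtain y where "y \<in> {-N..N}" "\<And>x. x \<in> {-N..N} \<Longrightarrow> \<Phi>1 y - \<Phi>2 y \<le> \<Phi>1 x - \<Phi>2 x"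
      using continuous_attains_inf[of "{-N..N}" "\<lambda>y. \<Phi>1 y - \<Phi>2 y"] N(1) by auto
    then show ?thesis using that[of "\<Phi>1 y - \<Phi>2 y"] \<Phi>21[of y] by auto
  qed
  define \<delta> where "\<delta> = min m (min (ra / 2) rb)"
  have \<delta>: "\<delta> > 0" "\<delta> \<le> m" "\<delta> \<le> ra / 2" "\<delta> \<le> rb" using m ra rb by (auto simp: \<delta>_def)
  \<comment> \<open>The envelope for the growth of g per unit of \<delta>:
    \<open>Kop_weight_contract\<close> sends its delayed copy below (1 - \<epsilon>)
    \<open>eta l\<close>, which leaves \<epsilon> \<delta> \<open>eta l\<close> for the change of
    speed.\<close>
  define e where "e y = min (\<gamma> * exp (l * y)) (1 - \<epsilon>)" for y
  have be: "bcont e" unfolding e_def[abs_def]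
    by (rule bcont_min) (use \<gamma> \<epsilon> in \<open>auto intro!: continuous_intros bcont_const\<close>)
  have e0: "0 \<le> e y" for y unfolding e_def using \<gamma> \<epsilon> by auto
  define \<Psi> where "\<Psi> z = min (\<Phi>2 z + \<delta> * eta l z) \<kappa>" for z
  have bs: "bcont (\<lambda>z. \<Phi>2 z + \<delta> * eta l z)" using is_profileD(1)[OF P2] bcont_eta by (intro bcont_add bcont_cmult)
  have P\<Psi>: "is_profile \<Psi>"
  proof -
    have nn: "0 \<le> \<Phi>2 z + \<delta> * eta l z" for z
      using is_profileD(2)[OF P2, of z] \<delta>(1) eta_nonneg[of l z] by simp
    have "bcont \<Psi>" unfolding \<Psi>_def[abs_def]
      by (rule bcont_min[OF bcont_continuous[OF bs] bcont_const nn]) (use kappa_pos in simp)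
    then show ?thesis using nn kappa_pos unfolding is_profile_def \<Psi>_def by auto
  qed
  have g\<Psi>: "g (\<Psi> y) \<le> g (\<Phi>1 y) + \<delta> * e y" for y
  proof -
    have le1: "\<Psi> y \<le> \<Phi>1 y + \<delta> * eta l y" using \<Phi>21[of y] unfolding \<Psi>_def by auto
    consider "y < - N" | "y \<in> {-N..N}" | "y > N" by fastforce
    then show ?thesis
    proof cases
      case 1
      have ey: "e y = \<gamma> * exp (l * y)" using Y2[of y] 1 N unfolding e_def by simp
      have eta: "eta l y = exp (l * y)" using 1 N l0 by (intro eta_eq_exp) auto
      have "\<Phi>1 y \<le> ra / 2" using \<Phi>1\<phi>[of y] Y0[of y] 1 N by auto
      moreover have "\<delta> * eta l y \<le> ra / 2 * 1" using \<delta> ra eta_le_1 eta_nonneg by (intro mult_mono) auto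
      moreover have "0 \<le> \<delta> * eta l y" using \<delta> eta_nonneg by simp
      ultimately have "g (\<Phi>1 y + \<delta> * eta l y) - g (\<Phi>1 y) \<le> \<gamma> * (\<delta> * eta l y)"
        using ra(2)[of "\<Phi>1 y" "\<Phi>1 y + \<delta> * eta l y"] is_profileD(2)[OF P1, of y] by (auto simp: \<gamma>_def)
      then show ?thesis using monoD[OF mono le1] unfolding ey eta by (simp add: algebra_simps)
    next
      case 2
      have "\<delta> * eta l y \<le> \<delta> * 1" using \<delta> eta_le_1 by (intro mult_left_mono) auto
      then have "\<Phi>2 y + \<delta> * eta l y \<le> \<Phi>1 y" using m(2)[OF 2] \<delta>(2) by linarith
      then have "\<Psi> y \<le> \<Phi>1 y" unfolding \<Psi>_def by simp
      then show ?thesis using monoD[OF mono, of "\<Psi> y" "\<Phi>1 y"] mult_nonneg_nonneg[OF less_imp_le[OF \<delta>(1)] e0[of y]] by simp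
    next
      case 3
      have "\<gamma> * exp (l * y) \<ge> 1 * 1" using \<gamma> 3 N l0 by (intro mult_mono) auto
      then have ey: "e y = 1 - \<epsilon>" using \<epsilon> unfolding e_def by simp
      have eta: "eta l y = 1" using 3 N l0 by (intro eta_eq_1) auto
      have "g (\<Phi>1 y + \<delta>) - g (\<Phi>1 y) \<le> (deriv g \<kappa> + \<epsilon>) * \<delta>"
        using rb(2)[of "\<Phi>1 y" "\<Phi>1 y + \<delta>"] Y1[of y] 3 N \<delta> is_profileD(3)[OF P1, of y] by auto
      also have "\<dots> \<le> (1 - \<epsilon>) * \<delta>" using \<epsilon> \<delta> by (intro mult_right_mono) auto
      finally show ?thesis using monoD[OF mono le1] unfolding ey eta by (simp add: mult.commute)
    qed
  qed
  have G0nn: "0 \<le> G0 x" "G0 x \<le> \<kappa>" for x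
    unfolding G0_def using g_nonneg[OF is_profileD(2)[OF P0]] g_le_kappa[OF is_profileD(3)[OF P0]] by auto
  have G1nn: "0 \<le> G1 x" "G1 x \<le> \<kappa>" for x
    unfolding G1_def using g_nonneg[OF is_profileD(2)[OF P1]] g_le_kappa[OF is_profileD(3)[OF P1]] by auto
  define C where "C = \<gamma> * A * exp (- l * c * h)"
  have C: "C \<ge> 0" unfolding C_def using \<gamma> A by simp
  have G1e: "G1 x \<le> C * exp (l * x)" for x using G10[of x] G0e[of x] unfolding C_def by linarith
  have "\<exists>M\<ge>0. \<forall>z. \<bar>Kop' c G0 z\<bar> \<le> M * eta l z"
    by (rule Kop'_weight_bound[OF _ _ bG0 G0nn(1) G0e[folded C_def] G0nn(2)]) (use l0 D C kappa_pos in \<open>auto simp: D_def\<close>)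
  moreover have "\<exists>M\<ge>0. \<forall>z. \<bar>Kop' c G1 z\<bar> \<le> M * eta l z"
    by (rule Kop'_weight_bound[OF _ _ bG1 G1nn(1) G1e G1nn(2)]) (use l0 D C kappa_pos in \<open>auto simp: D_def\<close>)
  ultimately obtain Ma Mb where Mab: "Ma \<ge> 0" "Mb \<ge> 0" "\<And>z. \<bar>Kop' c G0 z\<bar> \<le> Ma * eta l z" "\<And>z. \<bar>Kop' c G1 z\<bar> \<le> Mb * eta l z"
    by blast
  define M where "M = max Ma Mb"
  have MM: "Ma \<le> M" "Mb \<le> M" by (auto simp: M_def)
  have M0: "M \<ge> 0" using Mab(1) MM(1) by linarith
  have M1: "\<bar>Kop' c G0 z\<bar> \<le> M * eta l z" "\<bar>Kop' c G1 z\<bar> \<le> M * eta l z" for z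
    using Mab(3)[of z] Mab(4)[of z] mult_right_mono[OF MM(1) eta_nonneg[of l z]] mult_right_mono[OF MM(2) eta_nonneg[of l z]]
    by linarith+
  \<comment> \<open>The cost of lowering the speed by one unit, relative to \<open>eta l\<close>: L
    h M from the changed delay, M from the drift term, and exp(l c h) because \<open>Kop c'\<close>
    is applied here without the delay shift.\<close>
  define Q where "Q = (L * h + 1) * M * exp (l * c * h)"
  have Q: "Q \<ge> 0" unfolding Q_def using L h M0 by simp
  obtain c' where c': "0 < c'" "c' < c" "\<gamma> * exp (- l * c' * h) < (1 - \<epsilon>) * (1 + c' * l - l\<^sup>2)" "(c - c') * Q \<le> \<delta> * \<epsilon>"
  proof -
    have t: "(f \<longlongrightarrow> f c) (at_left c)" if "isCont f c" for f :: "real \<Rightarrow> real"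
      using that unfolding isCont_def by (rule filterlim_mono) (auto simp: at_le)
    have "((\<lambda>c'. (1 - \<epsilon>) * (1 + c' * l - l\<^sup>2) - \<gamma> * exp (- l * c' * h)) \<longlongrightarrow>
       (1 - \<epsilon>) * (1 + c * l - l\<^sup>2) - \<gamma> * exp (- l * c * h)) (at_left c)"
      by (rule t) (intro continuous_intros)
    then have 1: "\<forall>\<^sub>F c' in at_left c. (1 - \<epsilon>) * (1 + c' * l - l\<^sup>2) - \<gamma> * exp (- l * c' * h) > 0"
      using \<epsilon>(3) by (intro order_tendstoD(1)) (auto simp: D_def \<gamma>_def)
    have "((\<lambda>c'. (c - c') * Q) \<longlongrightarrow> (c - c) * Q) (at_left c)"
      by (rule t) (intro continuous_intros)
    then have 2: "\<forall>\<^sub>F c' in at_left c. (c - c') * Q < \<delta> * \<epsilon>"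
      using \<epsilon> \<delta> by (intro order_tendstoD(2)) auto
    have 3: "\<forall>\<^sub>F c' in at_left c. c' \<in> {0<..<c}" by (rule eventually_at_left_real[OF c_pos])
    from 1 2 3 have "\<forall>\<^sub>F c' in at_left c. 0 < c' \<and> c' < c \<and> \<gamma> * exp (- l * c' * h) < (1 - \<epsilon>) * (1 + c' * l - l\<^sup>2) \<and> (c - c') * Q \<le> \<delta> * \<epsilon>"
      by eventually_elim auto
    then show ?thesis using that eventually_happens'[OF trivial_limit_at_left_real] by blast
  qed
  define D' where "D' = 1 + c' * l - l\<^sup>2"
  have c'h: "c' * h \<le> c * h" "0 \<le> c' * h" using c' h by (auto intro: mult_right_mono)
  have D': "D' > 0" "exp (- l * c' * h) \<le> D'"
  proof -
    have "1 * exp (- l * c' * h) \<le> \<gamma> * exp (- l * c' * h)" using \<gamma> by (intro mult_right_mono) auto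
    then have a: "exp (- l * c' * h) < (1 - \<epsilon>) * D'" using c'(3) unfolding D'_def by linarith
    have "0 < exp (- l * c' * h)" by simp
    then have "0 < (1 - \<epsilon>) * D'" using a by linarith
    then show "D' > 0" using \<epsilon> by (simp add: zero_less_mult_iff)
    then have "(1 - \<epsilon>) * D' \<le> 1 * D'" using \<epsilon> by (intro mult_right_mono) auto
    then show "exp (- l * c' * h) \<le> D'" using a by simp
  qed
  have Keta: "Kop c' (eta l) z \<le> exp (l * c * h) * eta l z" for z
  proof -
    have "Kop c' (eta l) ((z + c' * h) - c' * h) \<le> 1 * eta l (z + c' * h)"
      by (rule Kop_weight_contract[where \<gamma> = 1])
         (use l0 D' bcont_eta eta_le_exp eta_le_1 in \<open>auto simp: D'_def\<close>)
    also have "eta l (z + c' * h) \<le> exp (l * c * h) * eta l z"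
    proof -
      have "exp (l * (z + c' * h)) = exp (l * (c' * h)) * exp (l * z)" by (simp add: exp_add[symmetric] algebra_simps)
      also have "\<dots> \<le> exp (l * c * h) * exp (l * z)"
        using c'h(1) l0 by (intro mult_right_mono) (auto simp: mult.assoc)
      finally have a: "exp (l * (z + c' * h)) \<le> exp (l * c * h) * exp (l * z)" .
      have "l * c * h \<ge> 0" using l0 ch by (simp add: mult.assoc)
      then have "1 \<le> exp (l * c * h)" by simp
      then show ?thesis using a by (intro le_eta[where C = "exp (l * c * h)" and C' = 1])
          (auto simp: eta_le_1 intro: order_trans[OF eta_le_exp])
    qed
    finally show ?thesis by simp
  qed
  have super: "profile_op c' h \<Psi> z \<le> \<Psi> z" for z
  proof -
    define F where "F = (\<lambda>x. g (\<Phi>1 (x - c' * h)))"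
    have bF: "bcont F" unfolding F_def by (rule bcont_g_profile[OF P1])
    have b2: "bcont (\<lambda>x. (c - c') * Kop' c G1 x)" by (intro bcont_cmult bcont_Kop' bG1)
    \<comment> \<open>\<Phi>2 solves the linear equation of speed c with source G1; moving (c - c')
      \<Phi>2' to the source gives the one of speed c'.\<close>
    have "\<Phi>2 z = Kop c' (\<lambda>x. G1 x - (c - c') * Kop' c G1 x) z"
    proof (rule Kop_unique)
      show "(\<Phi>2 has_real_derivative Kop' c G1 x) (at x)" for x unfolding \<Phi>2K by (rule Kop_deriv[OF bG1])
      show "(Kop' c G1 has_real_derivative (c * Kop' c G1 x + Kop c G1 x - G1 x)) (at x)" for x by (rule Kop'_deriv[OF bG1])
      show "\<bar>\<Phi>2 x\<bar> \<le> \<kappa>" for x using is_profileD(2,3)[OF P2, of x] by simp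
      show "bcont (\<lambda>x. G1 x - (c - c') * Kop' c G1 x)" by (rule bcont_diff[OF bG1 b2])
      show "c * Kop' c G1 x + Kop c G1 x - G1 x - c' * Kop' c G1 x - \<Phi>2 x = - (G1 x - (c - c') * Kop' c G1 x)" for x
        unfolding \<Phi>2K by (simp add: algebra_simps)
    qed
    then have "Kop c' F z - \<Phi>2 z = Kop c' (\<lambda>x. F x - (G1 x - (c - c') * Kop' c G1 x)) z"
      using Kop_diff[OF bF bcont_diff[OF bG1 b2], of c' z] by simp
    also have "\<dots> \<le> Kop c' (\<lambda>x. ((c - c') * ((L * h + 1) * M)) * eta l x) z"
    proof (rule Kop_mono)
      fix x
      \<comment> \<open>Both delayed arguments lie to the left of x because c' > 0, so the weight at
        x dominates the derivative on the whole segment.\<close>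
      have d: "norm (\<Phi>1 (x - c' * h) - \<Phi>1 (x - c * h)) \<le> (M * eta l x) * norm ((x - c' * h) - (x - c * h))"
      proof (rule field_differentiable_bound[of "{x - c * h..x - c' * h}" \<Phi>1 "Kop' c G0"])
        show "(\<Phi>1 has_field_derivative Kop' c G0 y) (at y within {x - c * h..x - c' * h})" for y
          unfolding \<Phi>1K by (rule DERIV_subset[OF Kop_deriv[OF bG0]]) auto
        show "norm (Kop' c G0 y) \<le> M * eta l x" if "y \<in> {x - c * h..x - c' * h}" for y
          using M1(1)[of y] mult_left_mono[OF eta_mono[of l y x] M0] that c'h l0 by auto
      qed (use c'h in auto)
      also have "\<dots> = (c - c') * h * M * eta l x" using c'h by (simp add: algebra_simps abs_mult[symmetric])
      finally have "F x - G1 x \<le> L * ((c - c') * h * M * eta l x)"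
        using L(2)[of "\<Phi>1 (x - c' * h)" "\<Phi>1 (x - c * h)"] L(1) unfolding F_def G1_def
        by (smt (verit) mult_left_mono real_norm_def)
      moreover have "(c - c') * Kop' c G1 x \<le> (c - c') * (M * eta l x)"
        using M1(2)[of x] c' by (intro mult_left_mono) auto
      ultimately show "F x - (G1 x - (c - c') * Kop' c G1 x) \<le> ((c - c') * ((L * h + 1) * M)) * eta l x"
        by (simp add: algebra_simps)
    qed (intro bcont_diff bF bG1 b2 bcont_cmult bcont_eta)+
    also have "\<dots> = ((c - c') * ((L * h + 1) * M)) * Kop c' (eta l) z" by (rule Kop_cmult)
    also have "\<dots> \<le> ((c - c') * ((L * h + 1) * M)) * (exp (l * c * h) * eta l z)"
      using c' L h M0 Keta[of z] by (intro mult_left_mono) auto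
    also have "\<dots> = ((c - c') * Q) * eta l z" unfolding Q_def by (simp add: algebra_simps)
    also have "\<dots> \<le> (\<delta> * \<epsilon>) * eta l z" using c'(4) eta_nonneg by (intro mult_right_mono) auto
    finally have 1: "Kop c' F z \<le> \<Phi>2 z + (\<delta> * \<epsilon>) * eta l z" by linarith
    have be': "bcont (\<lambda>x. e (x - c' * h))" by (rule bcont_translate_minus[OF be])
    have "profile_op c' h \<Psi> z \<le> Kop c' (\<lambda>x. F x + \<delta> * e (x - c' * h)) z"
      unfolding profile_op_def F_def
      by (rule Kop_mono) (use g\<Psi> bcont_g_profile[OF P\<Psi>] bcont_g_profile[OF P1] be' in \<open>auto intro: bcont_add bcont_cmult\<close>)
    also have "\<dots> = Kop c' F z + \<delta> * Kop c' e (z - c' * h)"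
      using Kop_add[OF bF bcont_cmult[OF be', of \<delta>], of c' z] Kop_cmult[of c' \<delta> "\<lambda>x. e (x - c' * h)" z]
        Kop_translate_minus[of c' e "c' * h" z] by simp
    also have "Kop c' e (z - c' * h) \<le> (1 - \<epsilon>) * eta l z"
      by (rule Kop_weight_contract[where \<gamma> = \<gamma>]) (use l0 D' be c'(3) \<epsilon> in \<open>auto simp: D'_def e_def\<close>)
    finally have "profile_op c' h \<Psi> z \<le> \<Phi>2 z + (\<delta> * \<epsilon>) * eta l z + \<delta> * ((1 - \<epsilon>) * eta l z)"
      using 1 \<delta>(1) by (smt (verit) mult_left_mono)
    then have "profile_op c' h \<Psi> z \<le> \<Phi>2 z + \<delta> * eta l z" by (simp add: algebra_simps)
    then show ?thesis using is_profileD(3)[OF is_profile_profile_op[OF P\<Psi>], of c' h z] unfolding \<Psi>_def by simp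
  qed
  have "(\<Psi> \<longlongrightarrow> 0) at_bot"
  proof (rule tendsto_sandwich[OF _ _ tendsto_const])
    show "\<forall>\<^sub>F z in at_bot. 0 \<le> \<Psi> z" using is_profileD(2)[OF P\<Psi>] by simp
    have "\<Psi> z \<le> \<phi> z + \<delta> * exp (l * z)" for z
    proof -
      have "\<delta> * eta l z \<le> \<delta> * exp (l * z)" using \<delta> eta_le_exp by (intro mult_left_mono) auto
      then show ?thesis using \<Phi>21[of z] \<Phi>1\<phi>[of z] unfolding \<Psi>_def by linarith
    qed
    then show "\<forall>\<^sub>F z in at_bot. \<Psi> z \<le> \<phi> z + \<delta> * exp (l * z)" by simp
    have "((\<lambda>z. \<delta> * exp (l * z)) \<longlongrightarrow> 0) at_bot" using l0 by real_asymp
    from tendsto_add[OF phi(5) this] show "((\<lambda>z. \<phi> z + \<delta> * exp (l * z)) \<longlongrightarrow> 0) at_bot" by simp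
  qed
  moreover have "min \<delta> \<kappa> \<le> \<Psi> z" if "z \<ge> 0" for z
    using eta_eq_1[of l z] that l0 is_profileD(2)[OF P2, of z] unfolding \<Psi>_def by auto
  ultimately obtain \<psi> where "wavefront g h \<kappa> c' \<psi>"
    using wavefront_from_supersolution[OF P\<Psi> super, of "min \<delta> \<kappa>"] \<delta>(1) kappa_pos by auto
  then show False using minimal[of c' \<psi>] c' by simp
qed

section \<open>Strict bounds and monotonicity of the front\<close>

lemma Kop'_phi: "deriv \<phi> z = Kop' c (\<lambda>x. g (\<phi> (x - c * h))) z"
proof (rule DERIV_unique)
  show "(\<phi> has_real_derivative deriv \<phi> z) (at z)" by (rule wavefront_derivs[OF front])
  have "(Kop c (\<lambda>x. g (\<phi> (x - c * h))) has_real_derivative Kop' c (\<lambda>x. g (\<phi> (x - c * h))) z) (at z)"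
    by (rule Kop_deriv[OF bcont_g_profile[OF phi(1)]])
  then show "(\<phi> has_real_derivative Kop' c (\<lambda>x. g (\<phi> (x - c * h))) z) (at z)"
    using phi(2) unfolding profile_op_def by simp
qed

lemma Kop_phi: "\<phi> z = Kop c (\<lambda>x. g (\<phi> (x - c * h))) z"
  using fun_cong[OF phi(2), of z] unfolding profile_op_def by simp

text \<open>Touching \<kappa> would make the source identically \<kappa> by \<open>Kop_eq_0\<close>,
  contrary to its limit 0 on the left.\<close>

lemma phi_less_kappa: "\<phi> z < \<kappa>"
proof (rule ccontr)
  define G where "G = (\<lambda>x. g (\<phi> (x - c * h)))"
  have bG: "bcont G" unfolding G_def by (rule bcont_g_profile[OF phi(1)])
  assume "\<not> \<phi> z < \<kappa>"
  then have "Kop c G z = \<kappa>" using Kop_phi[of z] phi(4)[of z] unfolding G_def by simp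
  then have 0: "Kop c (\<lambda>x. \<kappa> - G x) z = 0"
    using Kop_diff[OF bcont_const[of \<kappa>] bG, of c z] Kop_const[of c \<kappa> z] by simp
  have "\<kappa> - G x = 0" for x
    by (rule Kop_eq_0[OF bcont_diff[OF bcont_const bG] _ 0]) (use g_le_kappa[OF phi(4)] in \<open>auto simp: G_def\<close>)
  then have "G = (\<lambda>x. \<kappa>)" by (intro ext) simp
  moreover have "(G \<longlongrightarrow> g 0) at_bot"
    unfolding G_def by (intro isCont_tendsto_compose[OF isCont_g] tendsto_shift_at_bot phi)
  ultimately have "((\<lambda>x::real. \<kappa>) \<longlongrightarrow> g 0) at_bot" by simp
  then show False using tendsto_unique[OF trivial_limit_at_bot_linorder _ tendsto_const] g_0 kappa_pos by fastforce
qed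

text \<open>A bound \<open>\<phi> z - \<phi> (z + s) \<le> Q * eta l z\<close> improves itself by the factor \<open>1 - \<epsilon>\<close>.\<close>

lemma slide_step:
  obtains M where "M \<ge> 0"
    "\<And>s z. s \<ge> 0 \<Longrightarrow> (\<And>z. z \<in> {-M..M} \<Longrightarrow> \<phi> z \<le> \<phi> (z + s)) \<Longrightarrow> \<phi> z \<le> \<phi> (z + s)"
proof -
  define l where "l = (l1 + l2) / 2"
  have l: "l1 < l" "l < l2" "l > 0" using l12 by (auto simp: l_def)
  obtain C where C: "C > 0" "\<And>z. \<phi> z \<le> C * exp (l * z)" using fast_decay[OF l(1,2)] by blast
  obtain \<epsilon> where \<epsilon>: "0 < \<epsilon>" "\<epsilon> < 1"
    "(deriv g 0 + \<epsilon>) * exp (- l * c * h) < (1 - \<epsilon>) * (1 + c * l - l\<^sup>2)" "deriv g \<kappa> + \<epsilon> < 1 - \<epsilon>"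
    using exists_margin[OF chi_margin(1)[OF l(1,2)]] by blast
  define \<gamma> where "\<gamma> = deriv g 0 + \<epsilon>"
  have \<gamma>: "\<gamma> \<ge> 1" using slope_0 \<epsilon> by (simp add: \<gamma>_def)
  obtain ra where ra: "ra > 0" "\<And>x y. \<bar>x\<bar> \<le> ra \<Longrightarrow> \<bar>y\<bar> \<le> ra \<Longrightarrow> x \<le> y \<Longrightarrow>
    g y - g x \<le> (deriv g 0 + \<epsilon>) * (y - x) \<and> (deriv g 0 - \<epsilon>) * (y - x) \<le> g y - g x"
    using slope_near_0[OF \<epsilon>(1)] by metis
  obtain rb where rb: "rb > 0" "\<And>x y. \<bar>x - \<kappa>\<bar> \<le> rb \<Longrightarrow> \<bar>y - \<kappa>\<bar> \<le> rb \<Longrightarrow> x \<le> y \<Longrightarrow>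
    g y - g x \<le> (deriv g \<kappa> + \<epsilon>) * (y - x)"
    using slope_near_kappa[OF \<epsilon>(1)] by metis
  obtain Y0 where Y0: "\<And>y. y \<le> Y0 \<Longrightarrow> \<bar>\<phi> y - 0\<bar> < ra" using tendsto_at_botD[OF phi(5) ra(1)] by blast
  obtain Y1 where Y1: "\<And>y. y \<ge> Y1 \<Longrightarrow> \<bar>\<phi> y - \<kappa>\<bar> < rb" using tendsto_at_topD[OF phi(6) rb(1)] by blast
  obtain Y2 where Y2: "\<And>y. y \<le> Y2 \<Longrightarrow> \<bar>\<gamma> * exp (l * y) - 0\<bar> < 1 - \<epsilon>"
  proof -
    have "((\<lambda>y. \<gamma> * exp (l * y)) \<longlongrightarrow> 0) at_bot" using l by real_asymp
    then show ?thesis using tendsto_at_botD[of _ 0 "1 - \<epsilon>"] \<epsilon>(2) that by auto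
  qed
  \<comment> \<open>M is independent of the shift s, since only shifts to the right are considered;
    the sliding argument relies on this uniformity.\<close>
  define M where "M = max 0 (max (- Y0) (max Y1 (- Y2)))"
  have M: "M \<ge> 0" "- M \<le> Y0" "M \<ge> Y1" "- M \<le> Y2" by (auto simp: M_def)
  define e where "e y = min (\<gamma> * exp (l * y)) (1 - \<epsilon>)" for y
  have be: "bcont e" unfolding e_def[abs_def]
    by (rule bcont_min) (use \<gamma> \<epsilon> in \<open>auto intro!: continuous_intros bcont_const\<close>)
  have e0: "0 \<le> e y" for y unfolding e_def using \<gamma> \<epsilon> by auto
  have "\<phi> z \<le> \<phi> (z + s)" if s: "s \<ge> 0" and mid: "\<And>z. z \<in> {-M..M} \<Longrightarrow> \<phi> z \<le> \<phi> (z + s)" for s z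
  proof -
    have step: "\<phi> z - \<phi> (z + s) \<le> (Q * (1 - \<epsilon>)) * eta l z"
      if Q: "Q \<ge> 0" "\<And>z. \<phi> z - \<phi> (z + s) \<le> Q * eta l z" for Q z
    proof -
      define G where "G = (\<lambda>x. g (\<phi> (x - c * h)))"
      have bG: "bcont G" unfolding G_def by (rule bcont_g_profile[OF phi(1)])
      have bGs: "bcont (\<lambda>x. G (x + s))" by (rule bcont_translate[OF bG])
      have be': "bcont (\<lambda>x. e (x - c * h))" by (rule bcont_translate_minus[OF be])
      have pt: "g (\<phi> y) - g (\<phi> (y + s)) \<le> Q * e y" for y
      proof (cases "\<phi> y \<le> \<phi> (y + s)")
        case True
        have "0 \<le> Q * e y" using Q(1) e0[of y] by simp
        then show ?thesis using monoD[OF mono True] by linarith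
      next
        case False
        then have lt: "\<phi> (y + s) \<le> \<phi> y" by simp
        have "y \<notin> {-M..M}" using mid[of y] False by auto
        then consider "y < - M" | "y > M" by fastforce
        then show ?thesis
        proof cases
          case 1
          have ey: "e y = \<gamma> * exp (l * y)" using Y2[of y] 1 M(4) unfolding e_def by simp
          have eta: "eta l y = exp (l * y)" using 1 M(1) l by (intro eta_eq_exp) auto
          have "g (\<phi> y) - g (\<phi> (y + s)) \<le> \<gamma> * (\<phi> y - \<phi> (y + s))"
            using ra(2)[of "\<phi> (y + s)" "\<phi> y"] lt Y0[of y] 1 M(2) phi(3)[of y] phi(3)[of "y + s"] by (auto simp: \<gamma>_def)
          also have "\<dots> \<le> \<gamma> * (Q * eta l y)" using Q(2)[of y] \<gamma> by (intro mult_left_mono) auto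
          also have "\<dots> = Q * e y" unfolding ey eta by simp
          finally show ?thesis .
        next
          case 2
          have "\<gamma> * exp (l * y) \<ge> 1 * 1" using \<gamma> 2 M(1) l by (intro mult_mono) auto
          then have ey: "e y = 1 - \<epsilon>" using \<epsilon>(1) unfolding e_def by simp
          have eta: "eta l y = 1" using 2 M(1) l by (intro eta_eq_1) auto
          have "g (\<phi> y) - g (\<phi> (y + s)) \<le> (deriv g \<kappa> + \<epsilon>) * (\<phi> y - \<phi> (y + s))"
            using rb(2)[of "\<phi> (y + s)" "\<phi> y"] lt Y1[of y] Y1[of "y + s"] 2 M(3) s by auto
          also have "\<dots> \<le> (1 - \<epsilon>) * (\<phi> y - \<phi> (y + s))" using \<epsilon>(4) lt by (intro mult_right_mono) auto
          also have "\<dots> \<le> (1 - \<epsilon>) * (Q * eta l y)" using Q(2)[of y] \<epsilon>(2) by (intro mult_left_mono) auto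
          also have "\<dots> = Q * e y" unfolding ey eta by simp
          finally show ?thesis .
        qed
      qed
      have "\<phi> z - \<phi> (z + s) = Kop c G z - Kop c (\<lambda>x. G (x + s)) z"
        using Kop_phi[of z] Kop_phi[of "z + s"] Kop_translate[of c G s z] unfolding G_def by simp
      also have "\<dots> = Kop c (\<lambda>x. G x - G (x + s)) z" by (rule Kop_diff[OF bG bGs, symmetric])
      also have "\<dots> \<le> Kop c (\<lambda>x. Q * e (x - c * h)) z"
      proof (rule Kop_mono)
        show "G x - G (x + s) \<le> Q * e (x - c * h)" for x
          using pt[of "x - c * h"] unfolding G_def by (simp add: algebra_simps)
      qed (intro bcont_diff bG bGs bcont_cmult be')+
      also have "\<dots> = Q * Kop c e (z - c * h)"
        using Kop_cmult[of c Q "\<lambda>x. e (x - c * h)" z] Kop_translate_minus[of c e "c * h" z] by simp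
      also have "\<dots> \<le> Q * ((1 - \<epsilon>) * eta l z)"
        using Q(1) by (intro mult_left_mono Kop_weight_contract[where \<gamma> = \<gamma>])
           (use l chi_margin(2)[OF l(1,2)] be \<epsilon> in \<open>auto simp: \<gamma>_def e_def\<close>)
      finally show ?thesis by (simp only: mult.assoc)
    qed
    \<comment> \<open>Fast decay provides the first finite bound in the weight; without it the
      iteration by 1 - \<epsilon> could not start.\<close>
    define Q0 where "Q0 = max C \<kappa>"
    have Q0: "Q0 \<ge> 0" "C \<le> Q0" "\<kappa> \<le> Q0" using C(1) by (auto simp: Q0_def)
    have iter: "\<phi> z - \<phi> (z + s) \<le> (Q0 * (1 - \<epsilon>) ^ n) * eta l z" for n z
    proof (induction n arbitrary: z)
      case 0
      have "\<phi> z \<le> Q0 * eta l z" by (rule le_eta[OF C(2) phi(4) Q0(2,3,1)])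
      then show ?case using phi(3)[of "z + s"] by simp
    next
      case (Suc n)
      have "\<phi> z - \<phi> (z + s) \<le> ((Q0 * (1 - \<epsilon>) ^ n) * (1 - \<epsilon>)) * eta l z"
        by (rule step) (use Q0(1) \<epsilon>(2) Suc.IH in auto)
      then show ?case by (simp add: mult.assoc mult.commute[of "1 - \<epsilon>"])
    qed
    have "(\<lambda>n. (Q0 * (1 - \<epsilon>) ^ n) * eta l z) \<longlonglongrightarrow> (Q0 * 0) * eta l z"
      using \<epsilon>(1,2) by (intro tendsto_intros LIMSEQ_realpow_zero) auto
    then have "\<phi> z - \<phi> (z + s) \<le> (Q0 * 0) * eta l z" by (rule LIMSEQ_le_const) (use iter in blast)
    then show ?thesis by simp
  qed
  then show ?thesis using that[OF M(1)] by blast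
qed

lemma phi_lipschitz: "\<bar>\<phi> x - \<phi> y\<bar> \<le> (rate_p c * \<kappa>) * \<bar>x - y\<bar>"
  using profile_op_lipschitz[OF phi(1), of c h x y] phi(2) by simp

lemma phi_continuous: "continuous_on S \<phi>"
  by (rule continuous_on_subset[OF bcont_continuous[OF is_profileD(1)[OF phi(1)]]]) simp

text \<open>One contact point makes the sources coincide, so \<phi> would be s-periodic; a periodic
  function tending to \<kappa> is constantly \<kappa>, which \<phi> never attains.\<close>

lemma phi_slide_strict:
  assumes le: "\<And>z. \<phi> z \<le> \<phi> (z + s)" and s: "s > 0"
  shows "\<phi> z < \<phi> (z + s)"
proof (rule ccontr)
  define G where "G = (\<lambda>x. g (\<phi> (x - c * h)))"
  have bG: "bcont G" unfolding G_def by (rule bcont_g_profile[OF phi(1)])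
  have bGs: "bcont (\<lambda>x. G (x + s))" by (rule bcont_translate[OF bG])
  have K: "\<phi> z = Kop c G z" "\<phi> (z + s) = Kop c (\<lambda>x. G (x + s)) z" for z
    using Kop_phi[of z] Kop_phi[of "z + s"] Kop_translate[of c G s z] unfolding G_def by simp_all
  assume "\<not> \<phi> z < \<phi> (z + s)"
  then have "\<phi> z = \<phi> (z + s)" using le[of z] by simp
  then have 0: "Kop c (\<lambda>x. G (x + s) - G x) z = 0" using Kop_diff[OF bGs bG, of c z] K[of z] by simp
  have "G (x + s) - G x = 0" for x
  proof (rule Kop_eq_0[OF bcont_diff[OF bGs bG] _ 0])
    show "0 \<le> G (x + s) - G x" for x
      using monoD[OF mono le[of "x - c * h"]] unfolding G_def by (simp add: algebra_simps)
  qed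
  then have "(\<lambda>x. G (x + s)) = G" by (intro ext) simp
  then have per: "\<phi> (z + s) = \<phi> z" for z using K[of z] by simp
  have "\<phi> (real n * s) = \<phi> 0" for n
  proof (induction n)
    case (Suc n)
    then show ?case using per[of "real n * s"] by (simp add: algebra_simps)
  qed simp
  moreover have "filterlim (\<lambda>n. real n * s) at_top sequentially"
    using s by real_asymp
  then have "(\<lambda>n. \<phi> (real n * s)) \<longlonglongrightarrow> \<kappa>" by (rule filterlim_compose[OF phi(6)])
  ultimately have "\<phi> 0 = \<kappa>" using LIMSEQ_unique[OF _ tendsto_const, of "\<phi> 0" \<kappa>] by simp
  then show False using phi_less_kappa[of 0] by simp
qed

text \<open>Sliding: by \<open>slide_step\<close> the order of \<phi> and its translate need only be
  checked on a fixed compact interval. There large shifts succeed since \<phi> tends to \<kappa>,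
  and at a positive critical shift a strict gap would allow a smaller one.\<close>

lemma phi_slide: assumes "s \<ge> 0" shows "\<phi> z \<le> \<phi> (z + s)"
proof -
  obtain M where M: "M \<ge> 0"
    "\<And>s z. s \<ge> 0 \<Longrightarrow> (\<And>z. z \<in> {-M..M} \<Longrightarrow> \<phi> z \<le> \<phi> (z + s)) \<Longrightarrow> \<phi> z \<le> \<phi> (z + s)"
    using slide_step by blast
  define K where "K = rate_p c * \<kappa>"
  have K: "K > 0" "\<And>x y. \<bar>\<phi> x - \<phi> y\<bar> \<le> K * \<bar>x - y\<bar>"
    using rates(1) kappa_pos phi_lipschitz by (auto simp: K_def)
  \<comment> \<open>Requiring the order for all larger shifts makes every shift above the infimum
    admissible.\<close>
  define S where "S = {s. s \<ge> 0 \<and> (\<forall>s'\<ge>s. \<forall>z. \<phi> z \<le> \<phi> (z + s'))}"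
  have "\<exists>y0\<in>{-M..M}. \<forall>y\<in>{-M..M}. \<phi> y \<le> \<phi> y0"
    by (rule continuous_attains_sup) (use M(1) phi_continuous in auto)
  then obtain y0 where y0: "\<And>y. y \<in> {-M..M} \<Longrightarrow> \<phi> y \<le> \<phi> y0" by blast
  obtain X where X: "\<And>x. x \<ge> X \<Longrightarrow> \<bar>\<phi> x - \<kappa>\<bar> < \<kappa> - \<phi> y0"
    using tendsto_at_topD[OF phi(6), of "\<kappa> - \<phi> y0"] phi_less_kappa[of y0] by auto
  have "max 0 (X + M) \<in> S"
    unfolding S_def
  proof (intro CollectI conjI allI impI)
    fix s' z assume s': "max 0 (X + M) \<le> s'"
    show "\<phi> z \<le> \<phi> (z + s')"
    proof (rule M(2))
      fix z assume z: "z \<in> {-M..M}"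
      have "\<bar>\<phi> (z + s') - \<kappa>\<bar> < \<kappa> - \<phi> y0" by (rule X) (use s' z in auto)
      then have "\<phi> y0 < \<phi> (z + s')" by linarith
      then show "\<phi> z \<le> \<phi> (z + s')" using y0[OF z] by simp
    qed (use s' in auto)
  qed auto
  then have "S \<noteq> {}" by blast
  moreover have "bdd_below S" by (auto simp: S_def intro!: bdd_belowI[of _ 0])
  ultimately have S: "S \<noteq> {}" "bdd_below S" by auto
  define \<sigma> where "\<sigma> = Inf S"
  have \<sigma>0: "\<sigma> \<ge> 0" unfolding \<sigma>_def by (rule cInf_greatest[OF S(1)]) (simp add: S_def)
  have gt: "\<phi> z \<le> \<phi> (z + s')" if "s' > \<sigma>" for s' z
  proof -
    have "Inf S < s'" using that unfolding \<sigma>_def .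
    then obtain s where "s \<in> S" "s < s'" using cInf_lessD[OF S(1)] by blast
    then show ?thesis unfolding S_def by auto
  qed
  have at: "\<phi> z \<le> \<phi> (z + \<sigma>)" for z
  proof (rule field_le_epsilon)
    fix e :: real assume e: "e > 0"
    have "\<phi> z \<le> \<phi> (z + (\<sigma> + e / K))" by (rule gt) (use e K in simp)
    moreover have "\<bar>\<phi> (z + (\<sigma> + e / K)) - \<phi> (z + \<sigma>)\<bar> \<le> K * \<bar>(z + (\<sigma> + e / K)) - (z + \<sigma>)\<bar>" by (rule K(2))
    ultimately show "\<phi> z \<le> \<phi> (z + \<sigma>) + e" using e K(1) by (simp add: abs_le_iff)
  qed
  have "\<sigma> = 0"
  proof (rule ccontr)
    assume "\<sigma> \<noteq> 0"
    then have \<sigma>: "\<sigma> > 0" using \<sigma>0 by simp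
    have "continuous_on {-M..M} (\<lambda>z. \<phi> (z + \<sigma>) - \<phi> z)"
      by (intro continuous_intros phi_continuous continuous_on_compose2[OF phi_continuous[of UNIV]]) auto
    then have "\<exists>y\<in>{-M..M}. \<forall>x\<in>{-M..M}. \<phi> (y + \<sigma>) - \<phi> y \<le> \<phi> (x + \<sigma>) - \<phi> x"
      using M(1) by (intro continuous_attains_inf) auto
    then obtain y where y: "\<And>x. x \<in> {-M..M} \<Longrightarrow> \<phi> (y + \<sigma>) - \<phi> y \<le> \<phi> (x + \<sigma>) - \<phi> x" by blast
    define m where "m = \<phi> (y + \<sigma>) - \<phi> y"
    have m: "m > 0" using phi_slide_strict[OF at \<sigma>, of y] by (simp add: m_def)
    \<comment> \<open>Going back by m / K consumes at most the gap m, K being a Lipschitz constant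
      of \<phi>.\<close>
    define s1 where "s1 = max 0 (\<sigma> - m / K)"
    have s1: "0 \<le> s1" "s1 < \<sigma>" "K * (\<sigma> - s1) \<le> m" using \<sigma> m K(1) by (auto simp: s1_def field_simps max_def)
    have "s1 \<in> S"
      unfolding S_def
    proof (intro CollectI conjI allI impI)
      fix s' z assume s': "s1 \<le> s'"
      show "\<phi> z \<le> \<phi> (z + s')"
      proof (cases "s' > \<sigma>")
        case False
        show ?thesis
        proof (rule M(2))
          fix z assume z: "z \<in> {-M..M}"
          have "\<bar>\<phi> (z + \<sigma>) - \<phi> (z + s')\<bar> \<le> K * \<bar>(z + \<sigma>) - (z + s')\<bar>" by (rule K(2))
          also have "\<dots> \<le> K * (\<sigma> - s1)" using False s' K(1) by (intro mult_left_mono) auto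
          finally have "\<bar>\<phi> (z + \<sigma>) - \<phi> (z + s')\<bar> \<le> m" using s1 by simp
          then show "\<phi> z \<le> \<phi> (z + s')" using y[OF z] unfolding m_def by linarith
        qed (use s' s1 in auto)
      qed (rule gt)
    qed (use s1 in auto)
    then have "\<sigma> \<le> s1" unfolding \<sigma>_def by (rule cInf_lower[OF _ S(2)])
    then show False using s1 by simp
  qed
  then show ?thesis using gt[of s z] at[of z] assms by (cases "s = 0") auto
qed

lemma phi_strict_mono: "x < y \<Longrightarrow> \<phi> x < \<phi> y"
  using phi_slide_strict[of "y - x" x] phi_slide[of "y - x"] by simp

lemma phi_mono: "x \<le> y \<Longrightarrow> \<phi> x \<le> \<phi> y"
  using phi_slide[of "y - x" x] by simp

text \<open>\<phi>' is \<open>rate_p c\<close> times w - Ep w for the nondecreasing right mean w. If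
  it vanished, w would be constant to the left of z, hence equal to its limit 0, whereas w z =
  \<phi> z > 0.\<close>

lemma phi_deriv_pos: "deriv \<phi> z > 0"
proof (rule ccontr)
  assume neg: "\<not> deriv \<phi> z > 0"
  define G where "G = (\<lambda>x. g (\<phi> (x - c * h)))"
  have bG: "bcont G" unfolding G_def by (rule bcont_g_profile[OF phi(1)])
  define w where "w = Em (rate_m c) G"
  have bw: "bcont w" unfolding w_def by (rule bcont_Em[OF rates(2) bG])
  have mw: "w x \<le> w y" if "x \<le> y" for x y
  proof -
    have "Em (rate_m c) G x \<le> Em (rate_m c) (\<lambda>t. G (t + (y - x))) x"
      by (rule Em_mono[OF rates(2) bG bcont_translate[OF bG]])
         (use that in \<open>auto simp: G_def intro!: monoD[OF mono] phi_mono\<close>)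
    then show ?thesis using Em_translate[of "rate_m c" G "y - x" x] unfolding w_def by simp
  qed
  have phiw: "\<phi> x = Ep (rate_p c) w x" for x using Kop_phi[of x] unfolding Kop_def w_def G_def .
  have Kd: "deriv \<phi> z = rate_p c * (w z - \<phi> z)"
    using Kop'_phi[of z] phiw[of z] unfolding Kop'_def Kop_def w_def G_def by simp
  have "\<phi> z \<le> w z"
    using Ep_mono[OF rates(1) bw bcont_const, of z "w z" c] mw Ep_const[OF rates(1), of c "w z" z] phiw[of z] by simp
  then have eq: "\<phi> z = w z" using neg rates(1)[of c] unfolding Kd by (simp add: zero_less_mult_iff)
  have "Ep (rate_p c) (\<lambda>x. w z + (-1) * w x) z = w z - Ep (rate_p c) w z"
    using Ep_add[OF rates(1) bcont_const bcont_cmult[OF bw], of c "w z" "-1" z] Ep_const[OF rates(1), of c "w z" z]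
      Ep_cmult[of "rate_p c" "-1" w z] by simp
  then have 0: "Ep (rate_p c) (\<lambda>x. w z + (-1) * w x) z = 0" using eq phiw[of z] by simp
  have "w z + (-1) * w x = 0" if "x \<le> z" for x
    by (rule Ep_eq_0[OF rates(1) bcont_add[OF bcont_const bcont_cmult[OF bw]] _ 0 that]) (use mw in simp)
  then have "\<forall>\<^sub>F x in at_bot. w x = w z" by (auto simp: eventually_at_bot_linorder intro!: exI[of _ z])
  then have "(w \<longlongrightarrow> w z) at_bot" by (rule tendsto_eventually)
  moreover have "(w \<longlongrightarrow> g 0) at_bot"
    unfolding w_def G_def
    by (intro Em_tendsto_at_bot rates bG[unfolded G_def] isCont_tendsto_compose[OF isCont_g] tendsto_shift_at_bot phi)
  ultimately have "w z = g 0" by (rule tendsto_unique[OF trivial_limit_at_bot_linorder])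
  then show False using eq phi(3)[of z] g_0 by simp
qed

lemma phi_deriv_weight: assumes l: "l1 < l" "l < l2"
  shows "\<exists>M\<ge>0. \<forall>z. deriv \<phi> z \<le> M * eta l z"
proof -
  define G where "G = (\<lambda>x. g (\<phi> (x - c * h)))"
  have bG: "bcont G" unfolding G_def by (rule bcont_g_profile[OF phi(1)])
  obtain C where C: "C > 0" "\<And>z. \<phi> z \<le> C * exp (l * z)" using fast_decay[OF l] by blast
  obtain L where L: "L \<ge> 1" "\<And>x y. \<bar>g x - g y\<bar> \<le> L * \<bar>x - y\<bar>" using lipschitz by blast
  have l0: "l > 0" using l l12 by simp
  have G: "G x \<le> (L * C) * exp (l * x)" for x
  proof -
    have "G x \<le> L * \<phi> (x - c * h)" using L(2)[of "\<phi> (x - c * h)" 0] phi(3)[of "x - c * h"] g_0 unfolding G_def by simp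
    also have "\<dots> \<le> L * \<phi> x" using L(1) ch by (intro mult_left_mono phi_mono) auto
    also have "\<dots> \<le> L * (C * exp (l * x))" using L(1) C(2) by (intro mult_left_mono) auto
    finally show ?thesis by simp
  qed
  have "\<exists>M\<ge>0. \<forall>z. \<bar>Kop' c G z\<bar> \<le> M * eta l z"
    by (rule Kop'_weight_bound[OF _ chi_margin(2)[OF l] bG _ G, where B = \<kappa>])
       (use l0 L C kappa_pos g_nonneg[OF less_imp_le[OF phi(3)]] g_le_kappa[OF phi(4)] in \<open>auto simp: G_def\<close>)
  then obtain M where M: "M \<ge> 0" "\<And>z. \<bar>Kop' c G z\<bar> \<le> M * eta l z" by blast
  have "deriv \<phi> z \<le> M * eta l z" for z using M(2)[of z] Kop'_phi[of z] unfolding G_def by simp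
  then show ?thesis using M(1) by blast
qed

text \<open>The admissible exponents form an open interval, so \<phi>' also decays at a larger
  exponent k; the surplus exp((k - l) z) is small on the left. On the right \<phi>' tends to 0
  because both means tend to \<kappa>.\<close>

lemma phi_deriv_small:
  assumes l: "l1 < l" "l < l2" and \<delta>: "\<delta> > 0"
  shows "\<exists>M>0. \<forall>z. \<bar>z\<bar> \<ge> M \<longrightarrow> deriv \<phi> z \<le> \<delta> * eta l z"
proof -
  define k where "k = (l + l2) / 2"
  have k: "l1 < k" "k < l2" "l < k" "k > 0" "l > 0" using l l12 by (auto simp: k_def)
  obtain C where C: "C \<ge> 0" "\<And>z. deriv \<phi> z \<le> C * eta k z" using phi_deriv_weight[OF k(1,2)] by blast
  have "((\<lambda>z. C * exp ((k - l) * z)) \<longlongrightarrow> 0) at_bot" using k by real_asymp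
  then obtain Y1 where Y1: "\<And>y. y \<le> Y1 \<Longrightarrow> \<bar>C * exp ((k - l) * y) - 0\<bar> < \<delta>" using tendsto_at_botD[OF _ \<delta>] by blast
  have "(deriv \<phi> \<longlongrightarrow> 0) at_top"
  proof -
    define G where "G = (\<lambda>x. g (\<phi> (x - c * h)))"
    have bG: "bcont G" unfolding G_def by (rule bcont_g_profile[OF phi(1)])
    have tG: "(G \<longlongrightarrow> \<kappa>) at_top"
      using isCont_tendsto_compose[OF isCont_g tendsto_shift_at_top[OF phi(6)], of "c * h"] g_kappa unfolding G_def by simp
    have "(Kop' c G \<longlongrightarrow> rate_p c * (\<kappa> - \<kappa>)) at_top"
      unfolding Kop'_def[abs_def]
      by (intro tendsto_intros Em_tendsto_at_top Kop_tendsto_at_top rates bG tG)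
    moreover have "Kop' c G = deriv \<phi>" using Kop'_phi unfolding G_def by (intro ext) simp
    ultimately show ?thesis by simp
  qed
  then obtain Y2 where Y2: "\<And>y. y \<ge> Y2 \<Longrightarrow> \<bar>deriv \<phi> y - 0\<bar> < \<delta>" using tendsto_at_topD[OF _ \<delta>] by blast
  define M where "M = max 1 (max (- Y1) Y2)"
  have M: "M \<ge> 1" "- M \<le> Y1" "Y2 \<le> M" by (auto simp: M_def)
  have "deriv \<phi> z \<le> \<delta> * eta l z" if z: "\<bar>z\<bar> \<ge> M" for z
  proof (cases "z \<ge> 0")
    case True
    then show ?thesis using Y2[of z] z M eta_eq_1[of l z] k by simp
  next
    case False
    then have e: "eta k z = exp (k * z)" "eta l z = exp (l * z)" using k by (auto intro!: eta_eq_exp)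
    have "C * exp (k * z) = (C * exp ((k - l) * z)) * exp (l * z)" by (simp add: exp_add[symmetric] algebra_simps)
    also have "\<dots> \<le> \<delta> * exp (l * z)" using Y1[of z] z M False by (intro mult_right_mono) auto
    finally show ?thesis using C(2)[of z] e by simp
  qed
  then show ?thesis using M(1) by (intro exI[of _ M]) auto
qed

end

section \<open>Barriers for the Cauchy problem\<close>

context mono_H
begin

text \<open>The initial function is dropped, so that spatial translates of a solution stay in the
  class.\<close>

definition is_sol :: "real \<Rightarrow> (real \<Rightarrow> real \<Rightarrow> real) \<Rightarrow> bool" where
  "is_sol h u \<longleftrightarrow> continuous_on ({-h..} \<times> UNIV) (\<lambda>(t, x). u t x) \<and> pde_sol_on g h {0<..} u \<and>
     (\<forall>t \<ge> -h. \<forall>x. 0 \<le> u t x \<and> u t x \<le> \<kappa>)"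

lemma is_solD:
  assumes "is_sol h u"
  shows "continuous_on ({-h..} \<times> UNIV) (\<lambda>(t, x). u t x)"
    and "t \<ge> -h \<Longrightarrow> 0 \<le> u t x" and "t \<ge> -h \<Longrightarrow> u t x \<le> \<kappa>"
  using assms unfolding is_sol_def by auto

lemma is_sol_jet:
  assumes "is_sol h u" "t > 0"
  shows "\<exists>p r. heat_jet u t x p r \<and> p = r - u t x + g (u (t - h) x)"
proof -
  have pde: "\<And>x. (\<lambda>s. u s x) differentiable (at t)" "\<And>x. (\<lambda>y. u t y) differentiable (at x)"
    "\<And>x. deriv (\<lambda>y. u t y) differentiable (at x)"
    "\<And>x. deriv (\<lambda>s. u s x) t = deriv (deriv (\<lambda>y. u t y)) x - u t x + g (u (t - h) x)"
    using assms unfolding is_sol_def pde_sol_on_def by (blast intro: greaterThan_iff[THEN iffD2])+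
  have "heat_jet u t x (deriv (\<lambda>s. u s x) t) (deriv (deriv (u t)) x)"
    by (rule heat_jetI[where d = "deriv (u t)"])
       (use pde(1-3) in \<open>auto simp: DERIV_deriv_iff_real_differentiable\<close>)
  then show ?thesis using pde(4)[of x] by blast
qed

lemma is_sol_translate:
  assumes u: "is_sol h u" shows "is_sol h (\<lambda>t x. u t (x + a))"
  unfolding is_sol_def
proof (intro conjI)
  have "continuous_on ({-h..} \<times> UNIV) ((\<lambda>p. case p of (t, x) \<Rightarrow> u t x) \<circ> (\<lambda>p. (fst p, snd p + a)))"
    by (intro continuous_on_compose continuous_intros continuous_on_subset[OF is_solD(1)[OF u]]) auto
  then show "continuous_on ({-h..} \<times> UNIV) (\<lambda>(t, x). u t (x + a))" by (simp add: o_def case_prod_unfold)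
  show "\<forall>t\<ge>-h. \<forall>x. 0 \<le> u t (x + a) \<and> u t (x + a) \<le> \<kappa>" using is_solD(2,3)[OF u] by blast
  show "pde_sol_on g h {0<..} (\<lambda>t x. u t (x + a))"
    unfolding pde_sol_on_def
  proof (intro ballI allI)
    fix t x :: real assume "t \<in> {0<..}"
    then have "t > 0" by simp
    then have "\<forall>y. \<exists>r. heat_jet u t y (r - u t y + g (u (t - h) y)) r"
      using is_sol_jet[OF u] by blast
    then obtain r where r: "\<And>y. heat_jet u t y (r y - u t y + g (u (t - h) y)) (r y)" by metis
    define p where "p y = r y - u t y + g (u (t - h) y)" for y
    have pr: "heat_jet u t y (p y) (r y)" "p y = r y - u t y + g (u (t - h) y)" for y
      using r unfolding p_def by auto
    have t: "((\<lambda>s. u s y) has_real_derivative p y) (at t)" for y using pr(1)[of y] unfolding heat_jet_def by blast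
    have x1: "(u t has_real_derivative deriv (u t) y) (at y)" for y
      using pr(1)[of y] unfolding heat_jet_def by (metis DERIV_imp_deriv)
    have x2: "(deriv (u t) has_real_derivative r y) (at y)" for y
    proof -
      obtain d where d: "\<And>z. (u t has_real_derivative d z) (at z)" "(d has_real_derivative r y) (at y)"
        using pr(1)[of y] unfolding heat_jet_def by blast
      have "d = deriv (u t)" using d(1) x1 DERIV_unique by blast
      then show ?thesis using d by simp
    qed
    have y1: "((\<lambda>y. u t (y + a)) has_real_derivative deriv (u t) (y + a)) (at y)" for y
      using x1[of "y + a"] by (rule DERIV_shift[THEN iffD1])
    then have dy: "deriv (\<lambda>y. u t (y + a)) = (\<lambda>y. deriv (u t) (y + a))" by (intro ext DERIV_imp_deriv)
    have y2: "((\<lambda>y. deriv (u t) (y + a)) has_real_derivative r (x + a)) (at x)"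
      using x2[of "x + a"] by (rule DERIV_shift[THEN iffD1])
    show "(\<lambda>s. u s (x + a)) differentiable at t \<and> (\<lambda>y. u t (y + a)) differentiable at x \<and>
      deriv (\<lambda>y. u t (y + a)) differentiable at x \<and>
      deriv (\<lambda>s. u s (x + a)) t = deriv (deriv (\<lambda>y. u t (y + a))) x - u t (x + a) + g (u (t - h) (x + a))"
      unfolding dy DERIV_imp_deriv[OF t] DERIV_imp_deriv[OF y2]
      using t[of "x + a"] y1[of x] y2 pr(2)[of "x + a"] by (auto simp: real_differentiable_def)
  qed
qed

text \<open>Monotonicity discards correctly ordered arguments and the Lipschitz bound handles the
  others; this is the delayed term in the form used by \<open>parabolic_comparison\<close>.\<close>

lemma g_signed:
  assumes L: "\<And>x y. \<bar>g x - g y\<bar> \<le> L * \<bar>x - y\<bar>" and s: "s = 1 \<or> s = - 1"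
  shows "- L * max 0 (- (s * (a - b))) \<le> s * (g a - g b)"
proof (cases "s * (a - b) \<ge> 0")
  case True
  then have "0 \<le> s * (g a - g b)"
    using s monoD[OF mono, of b a] monoD[OF mono, of a b] by auto
  then show ?thesis using True by simp
next
  case False
  then have "max 0 (- (s * (a - b))) = \<bar>a - b\<bar>" using s by auto
  moreover have "- \<bar>g a - g b\<bar> \<le> s * (g a - g b)" using s by auto
  ultimately show ?thesis using L[of a b] by simp
qed

text \<open>With sign \<open>s = 1\<close> the function \<open>U\<close> is a supersolution, with \<open>s = - 1\<close> a subsolution.\<close>

lemma signed_comparison:
  assumes u: "is_sol h u" and h: "h \<ge> 0" and s: "s = 1 \<or> s = - 1" and T: "T \<ge> 0"
    and cont: "continuous_on ({T-h..T'} \<times> UNIV) (\<lambda>(t, x). U t x)"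
    and bdd: "\<And>t x. t \<in> {T-h..T'} \<Longrightarrow> - B \<le> s * U t x"
    and init: "\<And>t x. t \<in> {T-h..T} \<Longrightarrow> 0 \<le> s * (U t x - u t x)"
    and jet: "\<And>t x. T < t \<Longrightarrow> t \<le> T' \<Longrightarrow> \<exists>p r. heat_jet U t x p r \<and> 0 \<le> s * (p - r + U t x - g (U (t - h) x))"
    and t: "t \<in> {T-h..T'}"
  shows "0 \<le> s * (U t x - u t x)"
proof -
  obtain L where L: "L \<ge> 1" "\<And>x y. \<bar>g x - g y\<bar> \<le> L * \<bar>x - y\<bar>" using lipschitz by blast
  show ?thesis
  proof (rule parabolic_comparison[where w = "\<lambda>t x. s * (U t x - u t x)" and L = L and N = "B + \<kappa>", OF h _ _ _ _ _ t])
    have "continuous_on ({T-h..T'} \<times> UNIV) (\<lambda>(t, x). u t x)"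
      by (rule continuous_on_subset[OF is_solD(1)[OF u]]) (use T in auto)
    then show "continuous_on ({T-h..T'} \<times> UNIV) (\<lambda>(t, x). s * (U t x - u t x))"
      using cont unfolding case_prod_unfold by (intro continuous_intros)
    show "- (B + \<kappa>) \<le> s * (U t x - u t x)" if "t \<in> {T-h..T'}" for t x
      using bdd[OF that, of x] is_solD(2,3)[OF u, of t x] that T s by (auto simp: algebra_simps)
    show "\<exists>p r. heat_jet (\<lambda>t x. s * (U t x - u t x)) t x p r \<and>
       r - s * (U t x - u t x) - L * max 0 (- (s * (U (t - h) x - u (t - h) x))) \<le> p"
      if tt: "T < t" "t \<le> T'" for t x
    proof -
      obtain p r where 1: "heat_jet U t x p r" "0 \<le> s * (p - r + U t x - g (U (t - h) x))"
        using jet[OF tt] by blast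
      obtain p' r' where 2: "heat_jet u t x p' r'" "p' = r' - u t x + g (u (t - h) x)"
        using is_sol_jet[OF u, of t x] tt T by auto
      have le: "r * s - r' * s - s * (U t x - u t x) - L * max 0 (- (s * (U (t - h) x - u (t - h) x))) \<le> s * (p - p')"
        using 1(2) g_signed[OF L(2) s, of "U (t - h) x" "u (t - h) x"] unfolding 2(2) by (simp add: algebra_simps)
      show ?thesis
        by (intro exI conjI, rule heat_jet_cmult[OF heat_jet_diff[OF 1(1) 2(1)]])
           (use le in \<open>simp add: algebra_simps\<close>)
    qed
  qed (use L init in auto)
qed

text \<open>The reaction term has modulus at most \<kappa>, so smoothing applies with K1 = 1, whence
  9 = 8 + 1.\<close>

lemma sol_lipschitz:
  assumes u: "is_sol h u" and h: "h \<ge> 0" and T: "T \<ge> 1"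
  shows "\<bar>u T x - u T y\<bar> \<le> 9 * \<kappa> * \<bar>x - y\<bar>"
proof -
  have "\<bar>u ((T - 1) + 1) x - u ((T - 1) + 1) y\<bar> \<le> (8 + 1) * \<kappa> * \<bar>x - y\<bar>"
  proof (rule lipschitz_smoothing[OF kappa_pos])
    show "continuous_on ({T - 1..T - 1 + 1} \<times> UNIV) (\<lambda>(t, x). u t x)"
      by (rule continuous_on_subset[OF is_solD(1)[OF u]]) (use T h in auto)
    show "\<bar>u t x\<bar> \<le> \<kappa>" if "t \<in> {T - 1..T - 1 + 1}" for t x
      using is_solD(2,3)[OF u, of t x] that T h by auto
    show "\<exists>p r. heat_jet u t x p r \<and> \<bar>p - r\<bar> \<le> 1 * \<kappa>" if "T - 1 < t" "t \<le> T - 1 + 1" for t x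
    proof -
      have "t > 0" using that T by linarith
      then obtain p r where pr: "heat_jet u t x p r" "p = r - u t x + g (u (t - h) x)"
        using is_sol_jet[OF u, of t x] by blast
      have "0 \<le> u t x" "u t x \<le> \<kappa>" "0 \<le> u (t - h) x" "u (t - h) x \<le> \<kappa>"
        using is_solD(2,3)[OF u] that T h by auto
      then have "\<bar>p - r\<bar> \<le> \<kappa>" using g_nonneg[of "u (t - h) x"] g_le_kappa[of "u (t - h) x"] unfolding pr(2) by auto
      then show ?thesis using pr(1) by auto
    qed
  qed simp
  then show ?thesis by simp
qed

text \<open>The lower barrier is a spatially constant ramp in time minus \<open>exp (K t - x)\<close>.\<close>

lemma invasion:
  assumes u: "is_sol h u" and h: "h \<ge> 0" and \<sigma>: "0 < \<sigma>" "\<sigma> < \<kappa>"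
    and init: "\<And>s x. s \<in> {-h..0} \<Longrightarrow> x \<ge> B \<Longrightarrow> u s x > \<kappa> - \<sigma>" and q: "q > 0"
  shows "\<exists>T\<ge>0. \<exists>B'. \<forall>t\<in>{T-h..T}. \<forall>x\<ge>B'. u t x \<ge> \<kappa> - q"
proof -
  obtain L where L: "L \<ge> 1" "\<And>x y. \<bar>g x - g y\<bar> \<le> L * \<bar>x - y\<bar>" using lipschitz by blast
  define a where "a = \<kappa> - \<sigma>"
  define b where "b = \<kappa> - min q \<sigma> / 2"
  have ab: "0 < a" "a < b" "b < \<kappa>" "b \<ge> \<kappa> - q / 2" using \<sigma> q by (auto simp: a_def b_def min_def)
  have "\<exists>y\<in>{a..b}. \<forall>x\<in>{a..b}. g y - y \<le> g x - x"
    using ab by (intro continuous_attains_inf continuous_intros continuous_g) auto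
  then obtain y where y: "y \<in> {a..b}" "\<And>x. x \<in> {a..b} \<Longrightarrow> g y - y \<le> g x - x" by blast
  define m where "m = g y - y"
  have m: "m > 0" using g_gt[of y] y(1) ab by (simp add: m_def)
  \<comment> \<open>A ramp of slope \<epsilon> changes by at most \<epsilon> h over the delay, so
    \<epsilon> + \<epsilon> h = m is the fastest growth that the excess g(y) - y \<ge> m on [a, b]
    is guaranteed to sustain.\<close>
  define \<epsilon> where "\<epsilon> = m / (1 + h)"
  have "\<epsilon> * (1 + h) = m" using h by (simp add: \<epsilon>_def)
  moreover have "\<epsilon> > 0" using m h by (simp add: \<epsilon>_def)
  ultimately have \<epsilon>: "\<epsilon> > 0" "\<epsilon> + \<epsilon> * h = m" by (auto simp: distrib_left)
  \<comment> \<open>The ramp reaches b at time T - h, so the bound holds on a full delay interval.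
    The inequality for g is used at time t - h only, while the ramp is still within [a, b].\<close>
  define T where "T = (b - a) / \<epsilon> + h"
  have T: "T \<ge> h" "\<epsilon> * (T - h) = b - a" using ab \<epsilon> by (auto simp: T_def)
  define v where "v t = a + \<epsilon> * max 0 t" for t
  \<comment> \<open>The growth rate L pays for the Lipschitz loss of the delayed term; the prefactor
    makes the lower barrier nonpositive to the left of B initially.\<close>
  define E where "E t x = a * exp (L * (t + h) + (B - x))" for t x
  have E0: "E t x > 0" for t x unfolding E_def using ab by simp
  have vd: "v t \<le> v (t - h) + \<epsilon> * h" for t
  proof -
    have "max 0 t \<le> max 0 (t - h) + h" using h by auto
    then have "\<epsilon> * max 0 t \<le> \<epsilon> * (max 0 (t - h) + h)" using \<epsilon> by (intro mult_left_mono) auto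
    then show ?thesis unfolding v_def by (simp add: distrib_left)
  qed
  have va: "v t \<ge> a" for t unfolding v_def using \<epsilon> by simp
  have vb: "v t \<le> b" if "t \<le> T - h" for t
  proof -
    have "\<epsilon> * max 0 t \<le> \<epsilon> * (T - h)" using that \<epsilon> T by (intro mult_left_mono) auto
    then show ?thesis using T unfolding v_def by simp
  qed
  have main: "0 \<le> (- 1) * ((v t - E t x) - u t x)" if "t \<in> {0-h..T}" for t x
  proof (rule signed_comparison[OF u h _ order_refl _ _ _ _ that, where B = "\<kappa> + \<epsilon> * \<bar>T\<bar>"])
    show "continuous_on ({0-h..T} \<times> UNIV) (\<lambda>(t, x). v t - E t x)"
      unfolding v_def E_def case_prod_unfold by (intro continuous_intros)
    show "- (\<kappa> + \<epsilon> * \<bar>T\<bar>) \<le> (- 1) * (v t - E t x)" if "t \<in> {0-h..T}" for t x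
    proof -
      have "\<epsilon> * max 0 t \<le> \<epsilon> * \<bar>T\<bar>" using that \<epsilon> by (intro mult_left_mono) auto
      then show ?thesis using E0[of t x] ab unfolding v_def by simp
    qed
    show "0 \<le> (- 1) * ((v t - E t x) - u t x)" if t: "t \<in> {0-h..0}" for t x
    proof (cases "x \<ge> B")
      case True
      then show ?thesis using init[of t x] t E0[of t x] by (simp add: v_def a_def)
    next
      case False
      have "L * (t + h) \<ge> 0" using L t by simp
      then have "exp 0 \<le> exp (L * (t + h) + (B - x))" using False by (subst exp_le_cancel_iff) linarith
      then have "a * 1 \<le> E t x" unfolding E_def using ab by (intro mult_left_mono) auto
      then show ?thesis using is_solD(2)[OF u, of t x] t by (simp add: v_def)
    qed
    show "\<exists>p r. heat_jet (\<lambda>t x. v t - E t x) t x p r \<and>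
        0 \<le> (- 1) * (p - r + (v t - E t x) - g (v (t - h) - E (t - h) x))" if t: "0 < t" "t \<le> T" for t x
    proof -
      have jv: "heat_jet (\<lambda>t x. v t) t x \<epsilon> 0"
      proof (rule heat_jet_time)
        have "((\<lambda>t. a + \<epsilon> * t) has_real_derivative \<epsilon>) (at t)" by (auto intro!: derivative_eq_intros)
        then show "(v has_real_derivative \<epsilon>) (at t)"
          by (rule has_field_derivative_transform_within_open[where S = "{0<..}"]) (use t in \<open>auto simp: v_def\<close>)
      qed
      have jE: "heat_jet E t x (L * E t x) (E t x)"
        by (rule heat_jetI[where d = "\<lambda>y. - E t y"])
           (auto intro!: derivative_eq_intros simp: E_def[abs_def])
      have vth: "v (t - h) \<in> {a..b}" using va vb t by auto
      have "g (v (t - h)) \<ge> v (t - h) + m" using y(2)[OF vth] unfolding m_def by simp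
      then have 1: "g (v (t - h)) \<ge> v t + \<epsilon>" using vd[of t] \<epsilon> by linarith
      have "g (v (t - h)) - g (v (t - h) - E (t - h) x) \<le> L * E (t - h) x"
        using L(2)[of "v (t - h)" "v (t - h) - E (t - h) x"] E0[of "t - h" x] by simp
      moreover have "E (t - h) x \<le> E t x"
        unfolding E_def using ab L h by (intro mult_left_mono) (auto simp: algebra_simps)
      then have "L * E (t - h) x \<le> L * E t x" using L by (intro mult_left_mono) auto
      ultimately have le: "0 \<le> (- 1) * ((\<epsilon> - L * E t x) - (0 - E t x) + (v t - E t x) - g (v (t - h) - E (t - h) x))"
        using 1 by simp
      show ?thesis by (intro exI conjI, rule heat_jet_diff[OF jv jE], rule le)
    qed
  qed simp
  define B' where "B' = B + L * (T + h) - ln (q / (2 * a))"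
  show ?thesis
  proof (rule exI[of _ T], intro conjI exI[of _ B'] ballI allI impI)
    show "0 \<le> T" using T h by simp
    fix t x assume t: "t \<in> {T-h..T}" and x: "B' \<le> x"
    have "\<epsilon> * (T - h) \<le> \<epsilon> * max 0 t" using t \<epsilon> by (intro mult_left_mono) auto
    then have 1: "v t \<ge> b" using T unfolding v_def by simp
    have "L * (t + h) \<le> L * (T + h)" using L t by (intro mult_left_mono) auto
    then have "L * (t + h) + (B - x) \<le> ln (q / (2 * a))" using x unfolding B'_def by linarith
    then have "exp (L * (t + h) + (B - x)) \<le> exp (ln (q / (2 * a)))" by simp
    also have "\<dots> = q / (2 * a)" using q ab by simp
    finally have "E t x \<le> a * (q / (2 * a))" unfolding E_def using ab by (intro mult_left_mono) auto
    then have 2: "E t x \<le> q / 2" using ab by simp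
    have "t \<in> {0-h..T}" using t T h by auto
    from main[OF this, of x] show "u t x \<ge> \<kappa> - q" using 1 2 ab by simp
  qed
qed

end

section \<open>The smoothed weight and barriers around the front\<close>

lemma heat_jet_travelling:
  assumes F: "\<And>z. (F has_real_derivative F1 z) (at z)" "(F1 has_real_derivative F2) (at (x + c * t + s t))"
    and s: "(s has_real_derivative s1) (at t)"
  shows "heat_jet (\<lambda>t x. F (x + c * t + s t)) t x (F1 (x + c * t + s t) * (c + s1)) F2"
proof (rule heat_jetI[where d = "\<lambda>y. F1 (y + c * t + s t)"])
  show "((\<lambda>t. F (x + c * t + s t)) has_real_derivative F1 (x + c * t + s t) * (c + s1)) (at t)"
    by (rule DERIV_chain2[OF F(1)]) (auto intro!: derivative_eq_intros s)
  have "((\<lambda>y. F (y + (c * t + s t))) has_real_derivative F1 (y + (c * t + s t))) (at y)" for y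
    using F(1)[of "y + (c * t + s t)"] by (rule DERIV_shift[THEN iffD1])
  then show "((\<lambda>y. F (y + c * t + s t)) has_real_derivative F1 (y + c * t + s t)) (at y)" for y
    by (simp add: add.assoc)
  have "((\<lambda>y. F1 (y + (c * t + s t))) has_real_derivative F2) (at x)"
    using F(2) unfolding add.assoc by (rule DERIV_shift[THEN iffD1])
  then show "((\<lambda>y. F1 (y + c * t + s t)) has_real_derivative F2) (at x)"
    by (simp add: add.assoc)
qed

lemma eta_shift: assumes "l \<ge> 0" shows "eta l z \<le> exp (l * \<bar>s\<bar>) * eta l (z + s)"
proof (rule le_eta[where C = "exp (l * \<bar>s\<bar>)" and C' = 1])
  have "l * z \<le> l * (\<bar>s\<bar> + (z + s))" using assms by (intro mult_left_mono) auto
  then have "exp (l * z) \<le> exp (l * \<bar>s\<bar>) * exp (l * (z + s))" by (simp add: exp_add[symmetric] distrib_left)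
  then show "eta l z \<le> exp (l * \<bar>s\<bar>) * exp (l * (z + s))" using eta_le_exp[of l z] by linarith
qed (use assms eta_le_1 in auto)

locale stable_front = pushed_front +
  fixes lam :: real
  assumes lam: "l1 < lam" "lam < l2"
begin

text \<open>A smooth stand-in for \<open>eta lam\<close> with \<omega>'' - c \<omega>' - \<omega> =
  - \<open>eta lam\<close>. It depends on c and lam but not on \<phi>, so it is unchanged when the
  front is translated.\<close>

abbreviation "\<omega> \<equiv> Kop c (eta lam)"

definition "k0 = rate_p c / (rate_p c + lam)"
definition "D0 = 1 + c * lam - lam\<^sup>2"

lemma lam_pos: "lam > 0" using lam l12 by simp
lemma D0_pos: "D0 > 0" unfolding D0_def by (rule chi_margin(2)[OF lam])
lemma k0_pos: "k0 > 0" unfolding k0_def using rates(1)[of c] lam_pos by simp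

lemma omega_le_1: "\<omega> z \<le> 1" by (rule Kop_le[OF bcont_eta eta_le_1])

lemma omega_le_exp: "\<omega> z \<le> exp (lam * z) / D0"
  using Kop_exp_bound[of lam c "eta lam" 1 z] lam_pos D0_pos bcont_eta eta_le_exp unfolding D0_def by simp

text \<open>For a nondecreasing weight the right mean only gains. The left mean loses exactly the
  factor k0 on the exponential part, and monotonicity extends this to z > 0.\<close>

lemma omega_lower: "k0 * eta lam z \<le> \<omega> z"
proof -
  have inc: "eta lam x \<le> eta lam y" if "x \<le> y" for x y using eta_mono lam_pos that by simp
  have Em: "eta lam x \<le> Em (rate_m c) (eta lam) x" for x
    using Ep_mono[OF rates(2) bcont_const bcont_reflect[OF bcont_eta], of "- x" "eta lam x" lam c] inc
      Ep_const[OF rates(2), of c "eta lam x" "- x"] unfolding Em_def by simp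
  have Ep: "k0 * eta lam x \<le> Ep (rate_p c) (eta lam) x" if x: "x \<le> 0" for x
  proof -
    have "Ep (rate_p c) (\<lambda>y. (-1) * eta lam y) x \<le> (-1) * (rate_p c / (rate_p c + lam)) * exp (lam * x)"
    proof (rule Ep_exp_bound[OF rates(1) _ bcont_cmult[OF bcont_eta]])
      show "(-1) * eta lam y \<le> (-1) * exp (lam * y)" if "y \<le> x" for y
        using eta_eq_exp[of lam y] lam_pos that x by simp
    qed (use rates(1)[of c] lam_pos in auto)
    then show ?thesis using Ep_cmult[of "rate_p c" "-1" "eta lam" x] eta_eq_exp[of lam x] lam_pos x unfolding k0_def by simp
  qed
  have Ep': "k0 * eta lam z \<le> Ep (rate_p c) (eta lam) z"
  proof (cases "z \<le> 0")
    case False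
    have "k0 * eta lam z = k0 * eta lam 0" using eta_eq_1[of lam] lam_pos False by simp
    also have "\<dots> \<le> Ep (rate_p c) (eta lam) 0" by (rule Ep) simp
    also have "\<dots> \<le> Ep (rate_p c) (\<lambda>x. eta lam (x + z)) 0"
      using False inc by (intro Ep_mono rates bcont_eta bcont_translate) auto
    also have "\<dots> = Ep (rate_p c) (eta lam) z" using Ep_translate[of "rate_p c" "eta lam" z 0] by simp
    finally show ?thesis .
  qed (rule Ep)
  also have "\<dots> \<le> \<omega> z"
    unfolding Kop_def by (rule Ep_mono) (use rates bcont_eta bcont_Em Em in auto)
  finally show ?thesis .
qed

lemma omega_pos: "\<omega> z > 0"
proof -
  have "0 < k0 * eta lam z" using k0_pos eta_pos by simp
  then show ?thesis using omega_lower[of z] by linarith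
qed

text \<open>A Harnack inequality: a bounded change of position alters the weight by a bounded
  factor.\<close>

lemma omega_shift: "\<omega> z \<le> exp (lam * \<bar>s\<bar>) * \<omega> (z + s)"
proof -
  have "\<omega> z \<le> Kop c (\<lambda>x. exp (lam * \<bar>s\<bar>) * eta lam (x + s)) z"
    using lam_pos by (intro Kop_mono bcont_eta bcont_cmult bcont_translate eta_shift) auto
  also have "\<dots> = exp (lam * \<bar>s\<bar>) * \<omega> (z + s)"
    using Kop_cmult[of c "exp (lam * \<bar>s\<bar>)" "\<lambda>x. eta lam (x + s)" z] Kop_translate[of c "eta lam" s z] by simp
  finally show ?thesis .
qed

lemma phi_increment_far:
  assumes \<delta>: "\<delta> > 0"
  shows "\<exists>M>0. \<forall>z k. \<bar>z\<bar> \<ge> M \<longrightarrow> \<bar>k\<bar> \<le> 1 \<longrightarrow> \<bar>\<phi> (z + k) - \<phi> z\<bar> \<le> \<delta> * \<bar>k\<bar> * \<omega> z"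
proof -
  define \<delta>1 where "\<delta>1 = \<delta> * k0 / exp lam"
  have \<delta>1: "\<delta>1 > 0" unfolding \<delta>1_def using \<delta> k0_pos by simp
  obtain M where M: "M > 0" "\<And>z. \<bar>z\<bar> \<ge> M \<Longrightarrow> deriv \<phi> z \<le> \<delta>1 * eta lam z"
    using phi_deriv_small[OF lam \<delta>1] by blast
  have "\<bar>\<phi> (z + k) - \<phi> z\<bar> \<le> \<delta> * \<bar>k\<bar> * \<omega> z" if z: "\<bar>z\<bar> \<ge> M + 1" and k: "\<bar>k\<bar> \<le> 1" for z k
  proof -
    have "norm (\<phi> (z + k) - \<phi> z) \<le> (\<delta> * \<omega> z) * norm ((z + k) - z)"
    proof (rule field_differentiable_bound[of "closed_segment z (z + k)" \<phi> "deriv \<phi>"])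
      show "(\<phi> has_field_derivative deriv \<phi> y) (at y within closed_segment z (z + k))" for y
        by (rule DERIV_subset[OF wavefront_derivs(1)[OF front]]) auto
      fix y assume "y \<in> closed_segment z (z + k)"
      then have y: "\<bar>y - z\<bar> \<le> 1" using k by (auto simp: closed_segment_eq_real_ivl split: if_splits)
      then have "\<bar>y\<bar> \<ge> M" using z by linarith
      then have "deriv \<phi> y \<le> \<delta>1 * eta lam y" by (rule M(2))
      also have "\<dots> \<le> \<delta>1 * (exp lam * eta lam z)"
      proof (intro mult_left_mono)
        have "eta lam y \<le> exp (lam * \<bar>z - y\<bar>) * eta lam (y + (z - y))" using lam_pos by (intro eta_shift) simp
        also have "\<dots> \<le> exp lam * eta lam z"
          using y lam_pos by (intro mult_mono) (auto simp: eta_nonneg abs_minus_commute mult_left_le)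
        finally show "eta lam y \<le> exp lam * eta lam z" .
      qed (use \<delta>1 in simp)
      also have "\<dots> = \<delta> * (k0 * eta lam z)" unfolding \<delta>1_def by simp
      also have "\<dots> \<le> \<delta> * \<omega> z" using \<delta> omega_lower by (intro mult_left_mono) auto
      finally show "norm (deriv \<phi> y) \<le> \<delta> * \<omega> z" using phi_deriv_pos[of y] by simp
    qed auto
    then show ?thesis by (simp add: mult_ac)
  qed
  then show ?thesis using M(1) by (intro exI[of _ "M + 1"]) auto
qed

lemma phi_increment:
  "\<exists>C>0. \<forall>z k. \<bar>k\<bar> \<le> R \<longrightarrow> \<bar>\<phi> (z + k) - \<phi> z\<bar> \<le> C * \<bar>k\<bar> * \<omega> z"
proof -
  obtain M where M: "M \<ge> 0" "\<And>z. deriv \<phi> z \<le> M * eta lam z" using phi_deriv_weight[OF lam] by blast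
  define C where "C = (M + 1) * exp (lam * \<bar>R\<bar>) / k0"
  have C: "C > 0" unfolding C_def using M k0_pos by simp
  have "\<bar>\<phi> (z + k) - \<phi> z\<bar> \<le> C * \<bar>k\<bar> * \<omega> z" if k: "\<bar>k\<bar> \<le> R" for z k
  proof -
    have "norm (\<phi> (z + k) - \<phi> z) \<le> (C * \<omega> z) * norm ((z + k) - z)"
    proof (rule field_differentiable_bound[of "closed_segment z (z + k)" \<phi> "deriv \<phi>"])
      show "(\<phi> has_field_derivative deriv \<phi> y) (at y within closed_segment z (z + k))" for y
        by (rule DERIV_subset[OF wavefront_derivs(1)[OF front]]) auto
      fix y assume "y \<in> closed_segment z (z + k)"
      then have y: "\<bar>y - z\<bar> \<le> \<bar>R\<bar>" using k by (auto simp: closed_segment_eq_real_ivl split: if_splits)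
      have "deriv \<phi> y \<le> M * eta lam y" by (rule M(2))
      also have "\<dots> \<le> (M + 1) * (exp (lam * \<bar>R\<bar>) * eta lam z)"
      proof (intro mult_mono)
        have "eta lam y \<le> exp (lam * \<bar>z - y\<bar>) * eta lam (y + (z - y))" using lam_pos by (intro eta_shift) simp
        also have "\<dots> \<le> exp (lam * \<bar>R\<bar>) * eta lam z"
          using y lam_pos by (intro mult_mono) (auto simp: eta_nonneg abs_minus_commute)
        finally show "eta lam y \<le> exp (lam * \<bar>R\<bar>) * eta lam z" .
      qed (use M eta_nonneg in auto)
      also have "\<dots> = C * (k0 * eta lam z)" unfolding C_def using k0_pos by simp
      also have "\<dots> \<le> C * \<omega> z" using C omega_lower by (intro mult_left_mono) auto
      finally show "norm (deriv \<phi> y) \<le> C * \<omega> z" using phi_deriv_pos[of y] by simp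
    qed auto
    then show ?thesis by (simp add: mult_ac)
  qed
  then show ?thesis using C by blast
qed

text \<open>Decay at rate \<gamma> amplifies delayed values by exp(\<gamma> h) and costs \<gamma>;
  the strict margins at both ends tolerate this for small \<gamma>.\<close>

lemma exists_decay_rate:
  assumes "(deriv g 0 + \<epsilon>) * exp (- lam * c * h) < D0" "deriv g \<kappa> + \<epsilon> < 1"
  shows "\<exists>\<gamma>>0. (deriv g 0 + \<epsilon>) * exp (\<gamma> * h) * exp (- lam * c * h) < D0 - \<gamma> \<and> (deriv g \<kappa> + \<epsilon>) * exp (\<gamma> * h) < 1 - \<gamma>"
proof -
  have t: "(f \<longlongrightarrow> f 0) (at_right 0)" if "isCont f 0" for f :: "real \<Rightarrow> real"
    using that unfolding isCont_def by (rule filterlim_mono) (auto simp: at_le)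
  have "((\<lambda>\<gamma>. D0 - \<gamma> - (deriv g 0 + \<epsilon>) * exp (\<gamma> * h) * exp (- lam * c * h)) \<longlongrightarrow>
     D0 - 0 - (deriv g 0 + \<epsilon>) * exp (0 * h) * exp (- lam * c * h)) (at_right 0)"
    by (rule t) (intro continuous_intros)
  then have 1: "\<forall>\<^sub>F \<gamma> in at_right 0. D0 - \<gamma> - (deriv g 0 + \<epsilon>) * exp (\<gamma> * h) * exp (- lam * c * h) > 0"
    using assms by (intro order_tendstoD(1)) auto
  have "((\<lambda>\<gamma>. 1 - \<gamma> - (deriv g \<kappa> + \<epsilon>) * exp (\<gamma> * h)) \<longlongrightarrow> 1 - 0 - (deriv g \<kappa> + \<epsilon>) * exp (0 * h)) (at_right 0)"
    by (rule t) (intro continuous_intros)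
  then have 2: "\<forall>\<^sub>F \<gamma> in at_right 0. 1 - \<gamma> - (deriv g \<kappa> + \<epsilon>) * exp (\<gamma> * h) > 0"
    using assms by (intro order_tendstoD(1)) auto
  have 3: "\<forall>\<^sub>F \<gamma> in at_right (0::real). \<gamma> \<in> {0<..<1}" by (rule eventually_at_right_real) simp
  from 1 2 3 have "\<forall>\<^sub>F \<gamma> in at_right 0. \<gamma> > 0 \<and>
     (deriv g 0 + \<epsilon>) * exp (\<gamma> * h) * exp (- lam * c * h) < D0 - \<gamma> \<and> (deriv g \<kappa> + \<epsilon>) * exp (\<gamma> * h) < 1 - \<gamma>"
    by eventually_elim auto
  then show ?thesis using eventually_happens'[OF trivial_limit_at_right_real] by blast
qed

text \<open>Fife--McLeod barriers: where \<open>\<phi>\<close> is close to \<open>0\<close> or \<open>\<kappa>\<close> the perturbation \<open>q * \<omega>\<close> decays by itself,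
  in between the drift of the shift dominates since \<open>\<phi>' > 0\<close> there.\<close>

lemma barrier:
  "\<exists>q0>0. \<exists>\<beta>>0. \<exists>\<gamma>>0. \<forall>u s q T. is_sol h u \<longrightarrow> s = 1 \<or> s = - 1 \<longrightarrow> 0 < q \<longrightarrow> q \<le> q0 \<longrightarrow> 0 \<le> T \<longrightarrow>
     (\<forall>t\<in>{T-h..T}. \<forall>x. s * (u t x - \<phi> (x + c * t)) \<le> q * \<omega> (x + c * t)) \<longrightarrow>
     (\<forall>t\<ge>T. \<forall>x. s * (u t x - \<phi> (x + c * t + s * (\<beta> * q))) \<le> q * exp (- \<gamma> * (t - T)) * \<omega> (x + c * t))"
proof -
  obtain \<epsilon> where \<epsilon>: "0 < \<epsilon>" "\<epsilon> < 1" "(deriv g 0 + \<epsilon>) * exp (- lam * c * h) < (1 - \<epsilon>) * D0" "deriv g \<kappa> + \<epsilon> < 1 - \<epsilon>"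
    using exists_margin[OF chi_margin(1)[OF lam]] unfolding D0_def by blast
  have "(1 - \<epsilon>) * D0 \<le> 1 * D0" using \<epsilon> D0_pos by (intro mult_right_mono) auto
  then obtain \<gamma> where \<gamma>: "\<gamma> > 0" "(deriv g 0 + \<epsilon>) * exp (\<gamma> * h) * exp (- lam * c * h) < D0 - \<gamma>"
    "(deriv g \<kappa> + \<epsilon>) * exp (\<gamma> * h) < 1 - \<gamma>"
    using exists_decay_rate[of \<epsilon>] \<epsilon> by auto
  define K where "K = exp (\<gamma> * h)"
  have K: "K \<ge> 1" unfolding K_def using \<gamma> h by simp
  obtain ra where ra: "ra > 0" "\<And>x y. \<bar>x\<bar> \<le> ra \<Longrightarrow> \<bar>y\<bar> \<le> ra \<Longrightarrow> x \<le> y \<Longrightarrow>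
    g y - g x \<le> (deriv g 0 + \<epsilon>) * (y - x) \<and> (deriv g 0 - \<epsilon>) * (y - x) \<le> g y - g x"
    using slope_near_0[OF \<epsilon>(1)] by metis
  obtain rb where rb: "rb > 0" "\<And>x y. \<bar>x - \<kappa>\<bar> \<le> rb \<Longrightarrow> \<bar>y - \<kappa>\<bar> \<le> rb \<Longrightarrow> x \<le> y \<Longrightarrow>
    g y - g x \<le> (deriv g \<kappa> + \<epsilon>) * (y - x)"
    using slope_near_kappa[OF \<epsilon>(1)] by metis
  obtain L where L: "L \<ge> 1" "\<And>x y. \<bar>g x - g y\<bar> \<le> L * \<bar>x - y\<bar>" using lipschitz by blast
  obtain Y0 where Y0: "\<And>y. y \<le> Y0 \<Longrightarrow> \<bar>\<phi> y - 0\<bar> < ra / 2" using tendsto_at_botD[OF phi(5), of "ra / 2"] ra(1) by auto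
  obtain Y1 where Y1: "\<And>y. y \<ge> Y1 \<Longrightarrow> \<bar>\<phi> y - \<kappa>\<bar> < rb / 2" using tendsto_at_topD[OF phi(6), of "rb / 2"] rb(1) by auto
  \<comment> \<open>The nonlinearity is evaluated near \<phi> at w - c h with w within 1 of z; the
    extra 1 and c h put this point into the linearisation zones when |z| \<ge> M.\<close>
  define M where "M = max 0 (max (1 - Y0) (Y1 + 1 + c * h))"
  have M: "M \<ge> 0" "1 - M \<le> Y0" "M - 1 - c * h \<ge> Y1" by (auto simp: M_def)
  have "continuous_on {-M-1..M+1} (deriv \<phi>)"
    by (rule DERIV_continuous_on) (use wavefront_derivs(2)[OF front] in \<open>auto intro: DERIV_subset\<close>)
  then have "\<exists>y\<in>{-M-1..M+1}. \<forall>x\<in>{-M-1..M+1}. deriv \<phi> y \<le> deriv \<phi> x"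
    using M(1) by (intro continuous_attains_inf) auto
  then obtain y where y: "\<And>x. x \<in> {-M-1..M+1} \<Longrightarrow> deriv \<phi> y \<le> deriv \<phi> x" by blast
  define \<rho> where "\<rho> = deriv \<phi> y"
  have \<rho>: "\<rho> > 0" "\<And>x. \<bar>x\<bar> \<le> M + 1 \<Longrightarrow> \<rho> \<le> deriv \<phi> x" using phi_deriv_pos y by (auto simp: \<rho>_def abs_le_iff)
  \<comment> \<open>In the middle region the drift b \<gamma> \<phi>' \<ge> b \<gamma> \<rho> then
    pays for the Lipschitz growth L K and the decay loss \<gamma> \<omega> \<le> \<gamma>.\<close>
  define b where "b = (L * K + \<gamma>) / (\<gamma> * \<rho>)"
  have LK: "L * K + \<gamma> > 0" using L K \<gamma> by (intro add_nonneg_pos) auto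
  have b: "b > 0" "b * \<gamma> * \<rho> = L * K + \<gamma>" unfolding b_def using LK \<gamma> \<rho> by auto
  have bK: "b * K > 0" using b(1) K by simp
  \<comment> \<open>Keeps the delayed perturbation within half of each linearisation radius and the
    total shift at most 1.\<close>
  define q0 where "q0 = min (ra / (2 * K)) (min (rb / (2 * K)) (1 / (b * K)))"
  have q0: "q0 > 0" "q0 * K \<le> ra / 2" "q0 * K \<le> rb / 2" "b * (q0 * K) \<le> 1"
  proof -
    show "q0 > 0" unfolding q0_def using ra rb b K by simp
    have "q0 \<le> ra / (2 * K)" "q0 \<le> rb / (2 * K)" "q0 \<le> 1 / (b * K)" unfolding q0_def by auto
    then show "q0 * K \<le> ra / 2" "q0 * K \<le> rb / 2" "b * (q0 * K) \<le> 1" using K b(1) by (auto simp: field_simps)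
  qed
  show ?thesis
  proof (rule exI[of _ q0], rule conjI[OF q0(1)], rule exI[of _ "b * K"], rule conjI[OF bK],
      rule exI[of _ \<gamma>], rule conjI[OF \<gamma>(1)], intro allI impI)
    fix u :: "real \<Rightarrow> real \<Rightarrow> real" and s q T t0 x0 :: real
    assume u: "is_sol h u" and s: "s = 1 \<or> s = - 1" and q: "0 < q" "q \<le> q0" and T: "0 \<le> T"
      and hist: "\<forall>t\<in>{T-h..T}. \<forall>x. s * (u t x - \<phi> (x + c * t)) \<le> q * \<omega> (x + c * t)" and t0: "t0 \<ge> T"
    have ss: "s * s = 1" using s by auto
    define E where "E t = exp (- \<gamma> * (t - T))" for t
    \<comment> \<open>The shift vanishes at T - h, where E = K, has the favourable sign afterwards
      and stays below b K q in modulus; hence the lemma's \<beta> = b K.\<close>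
    define S where "S t = s * (b * q * (K - E t))" for t
    define U where "U t x = \<phi> (x + c * t + S t) + s * q * E t * \<omega> (x + c * t)" for t x
    have E0: "E t > 0" for t by (simp add: E_def)
    have EK: "E t \<le> K" if "t \<ge> T - h" for t
    proof -
      have "\<gamma> * (T - h) \<le> \<gamma> * t" using that \<gamma> by (intro mult_left_mono) auto
      then show ?thesis unfolding E_def K_def by (simp add: algebra_simps)
    qed
    have E1: "E t \<le> 1" if "t \<ge> T" for t
      using that \<gamma> unfolding E_def by simp
    have E1': "E t \<ge> 1" if "t \<le> T" for t
      using that \<gamma> unfolding E_def by (simp add: mult_le_0_iff)
    have Eh: "E (t - h) = K * E t" for t
      unfolding E_def K_def by (simp add: exp_add[symmetric] algebra_simps)
    have sS: "s * S t = b * q * (K - E t)" for t unfolding S_def using ss by (simp add: mult.assoc[symmetric])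
    have sS0: "0 \<le> s * S t" if "t \<ge> T - h" for t unfolding sS using EK[OF that] b q by simp
    have S1: "\<bar>S t\<bar> \<le> 1" if "t \<ge> T - h" for t
    proof -
      have "\<bar>S t\<bar> = s * S t" using sS0[OF that] s by auto
      also have "\<dots> \<le> b * q * K" unfolding sS using b q E0[of t] by (intro mult_left_mono) auto
      also have "\<dots> \<le> b * (q0 * K)" using b q K by (simp add: mult_right_mono)
      finally show ?thesis using q0 by simp
    qed
    have sphi: "s * \<phi> x \<le> s * \<phi> y" if "s * x \<le> s * y" for x y
      using that s phi_mono[of x y] phi_mono[of y x] by auto
    have Tt: "t0 \<in> {T-h..t0}" using t0 h by auto
    have main: "0 \<le> s * (U t0 x0 - u t0 x0)"
    proof (rule signed_comparison[OF u h s T _ _ _ _ Tt, where B = \<kappa>])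
      have cE: "continuous_on A E" for A unfolding E_def by (intro continuous_intros)
      have c1: "continuous_on ({T-h..t0} \<times> UNIV) (\<lambda>p. \<phi> (snd p + c * fst p + S (fst p)))"
        unfolding S_def E_def by (intro continuous_on_compose2[OF phi_continuous[of UNIV]] continuous_intros) auto
      have c2: "continuous_on ({T-h..t0} \<times> UNIV) (\<lambda>p. \<omega> (snd p + c * fst p))"
        by (intro continuous_on_compose2[OF bcont_continuous[OF bcont_Kop[OF bcont_eta]]] continuous_intros) auto
      show "continuous_on ({T-h..t0} \<times> UNIV) (\<lambda>(t, x). U t x)"
        unfolding U_def E_def case_prod_unfold by (intro continuous_intros c1 c2)
    next
      fix t x assume t: "t \<in> {T-h..t0}"
      have "q * E t * \<omega> (x + c * t) \<ge> 0" using q E0[of t] omega_pos[of "x + c * t"] by simp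
      moreover have "s * \<phi> (x + c * t + S t) \<ge> - \<kappa>" using s phi(3,4)[of "x + c * t + S t"] kappa_pos by auto
      moreover have "s * U t x = s * \<phi> (x + c * t + S t) + (s * s) * (q * E t * \<omega> (x + c * t))"
        unfolding U_def by (simp add: algebra_simps)
      ultimately show "- \<kappa> \<le> s * U t x" using ss by simp
    next
      fix t x assume t: "t \<in> {T-h..T}"
      have "s * (u t x - \<phi> (x + c * t)) \<le> q * \<omega> (x + c * t)" using hist t by blast
      moreover have "q * \<omega> (x + c * t) * 1 \<le> q * \<omega> (x + c * t) * E t"
        using E1'[of t] t q omega_pos[of "x + c * t"] by (intro mult_left_mono) auto
      moreover have "s * \<phi> (x + c * t) \<le> s * \<phi> (x + c * t + S t)"
        using sS0[of t] t by (intro sphi) (auto simp: algebra_simps)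
      moreover have "s * (U t x - u t x) = s * \<phi> (x + c * t + S t) + (s * s) * (q * \<omega> (x + c * t) * E t) - s * u t x"
        unfolding U_def by (simp add: algebra_simps)
      ultimately show "0 \<le> s * (U t x - u t x)" using ss by (simp add: algebra_simps)
    next
      fix t x assume t: "T < t" "t \<le> t0"
      define z where "z = x + c * t"
      define w where "w = z + S t"
      define A where "A = q * E t"
      have A: "A > 0" "A \<le> q0" unfolding A_def using q E0[of t] E1[of t] t mult_mono[of q q0 "E t" 1] by auto
      define S1 where "S1 = s * (b * \<gamma> * A)"
      define p where "p = deriv \<phi> w * (c + S1) + s * (A * (Kop' c (eta lam) z * c - \<gamma> * \<omega> z))"
      define r where "r = (c * deriv \<phi> w + \<phi> w - g (\<phi> (w - c * h))) + s * (A * (c * Kop' c (eta lam) z + \<omega> z - eta lam z))"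
      have dE: "(E has_real_derivative - \<gamma> * E t) (at t)"
        unfolding E_def[abs_def] by (auto intro!: derivative_eq_intros)
      have dS: "(S has_real_derivative S1) (at t)"
        unfolding S_def[abs_def] S1_def A_def by (auto intro!: derivative_eq_intros dE)
      have j1: "heat_jet (\<lambda>t x. \<phi> (x + c * t + S t)) t x (deriv \<phi> w * (c + S1)) (c * deriv \<phi> w + \<phi> w - g (\<phi> (w - c * h)))"
        unfolding w_def z_def by (rule heat_jet_travelling[OF wavefront_derivs(1)[OF front] wavefront_derivs(2)[OF front] dS])
      have dw: "(\<omega> has_real_derivative Kop' c (eta lam) y) (at y)"
        "(Kop' c (eta lam) has_real_derivative c * Kop' c (eta lam) y + \<omega> y - eta lam y) (at y)" for y
        by (rule Kop_deriv[OF bcont_eta], rule Kop'_deriv[OF bcont_eta])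
      have j2: "heat_jet (\<lambda>t x. E t * \<omega> (x + c * t)) t x (E t * (Kop' c (eta lam) z * c - \<gamma> * \<omega> z))
         (E t * (c * Kop' c (eta lam) z + \<omega> z - eta lam z))"
      proof (rule heat_jetI[where d = "\<lambda>y. E t * Kop' c (eta lam) (y + c * t)"])
        have "((\<lambda>t. \<omega> (x + c * t)) has_real_derivative Kop' c (eta lam) (x + c * t) * c) (at t)"
          by (rule DERIV_chain2[OF dw(1)]) (auto intro!: derivative_eq_intros)
        from DERIV_mult[OF dE this]
        show "((\<lambda>t. E t * \<omega> (x + c * t)) has_real_derivative E t * (Kop' c (eta lam) z * c - \<gamma> * \<omega> z)) (at t)"
          unfolding z_def by (simp add: algebra_simps)
        show "((\<lambda>x. E t * \<omega> (x + c * t)) has_real_derivative E t * Kop' c (eta lam) (y + c * t)) (at y)" for y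
          using dw(1)[of "y + c * t"] by (intro DERIV_cmult) (rule DERIV_shift[THEN iffD1])
        show "((\<lambda>y. E t * Kop' c (eta lam) (y + c * t)) has_real_derivative
            E t * (c * Kop' c (eta lam) z + \<omega> z - eta lam z)) (at x)"
          using dw(2)[of z] unfolding z_def by (intro DERIV_cmult) (rule DERIV_shift[THEN iffD1])
      qed
      have jU: "heat_jet U t x p r"
        using heat_jet_add[OF j1 heat_jet_cmult[OF j2, of "s * q"]]
        unfolding U_def[abs_def] p_def r_def A_def by (simp add: mult.assoc)
      define P where "P = \<phi> (w - c * h)"
      define Q where "Q = K * A * \<omega> (z - c * h)"
      have om1: "\<omega> (z - c * h) \<le> 1" "\<omega> (z - c * h) > 0" by (rule omega_le_1, rule omega_pos)
      have Q: "0 \<le> Q" "Q \<le> K * A" "Q \<le> q0 * K"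
      proof -
        show "0 \<le> Q" unfolding Q_def using K A om1 by simp
        have "K * A * \<omega> (z - c * h) \<le> K * A * 1" using K A om1 by (intro mult_left_mono) auto
        then show QA: "Q \<le> K * A" unfolding Q_def by simp
        have "K * A \<le> K * q0" using K A by (intro mult_left_mono) auto
        then show "Q \<le> q0 * K" using QA by (simp add: mult.commute)
      qed
      have Ps: "P > 0" "P \<le> \<kappa>" unfolding P_def using phi by auto
      have wz: "\<bar>w - z\<bar> \<le> 1" using S1[of t] t h unfolding w_def by auto
      \<comment> \<open>The right side collects what the other terms of the barrier leave: drift of
        the shift, defect of \<omega>, and loss by decay in time. The factor A is common to all
        three.\<close>
      have key: "s * (g (P + s * Q) - g P) \<le> A * (b * \<gamma> * deriv \<phi> w + eta lam z - \<gamma> * \<omega> z)"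
      proof -
        have slope: "s * (g (P + s * Q) - g P) \<le> k * Q"
          if "\<And>x y. \<bar>x - a\<bar> \<le> r \<Longrightarrow> \<bar>y - a\<bar> \<le> r \<Longrightarrow> x \<le> y \<Longrightarrow> g y - g x \<le> k * (y - x)"
            "\<bar>P - a\<bar> + Q \<le> r" for k a r
        proof -
          have "\<bar>P - a\<bar> \<le> r" "\<bar>P + Q - a\<bar> \<le> r" "\<bar>P - Q - a\<bar> \<le> r" using that(2) Q(1) by auto
          then show ?thesis using that(1)[of P "P + Q"] that(1)[of "P - Q" P] Q(1) s by auto
        qed
        have dpos: "0 \<le> b * \<gamma> * deriv \<phi> w" using b \<gamma> phi_deriv_pos[of w] by simp
        consider "z \<le> - M" | "z \<ge> M" | "\<bar>z\<bar> \<le> M" by linarith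
        then show ?thesis
        proof cases
          case 1
          have "\<bar>P - 0\<bar> < ra / 2" unfolding P_def by (rule Y0) (use 1 wz ch M(2) in linarith)
          then have "s * (g (P + s * Q) - g P) \<le> (deriv g 0 + \<epsilon>) * Q"
            using Q(3) q0(2) ra(2) by (intro slope[of 0 ra]) auto
          also have "\<dots> \<le> (deriv g 0 + \<epsilon>) * (K * A * (exp (lam * (z - c * h)) / D0))"
            unfolding Q_def using K A slope_0 \<epsilon>(1) omega_le_exp by (intro mult_left_mono) auto
          also have "exp (lam * (z - c * h)) = exp (- lam * c * h) * exp (lam * z)"
            by (simp add: exp_add[symmetric] algebra_simps)
          also have "(deriv g 0 + \<epsilon>) * (K * A * (exp (- lam * c * h) * exp (lam * z) / D0))
             = A * (((deriv g 0 + \<epsilon>) * K * exp (- lam * c * h)) * (exp (lam * z) / D0))" by simp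
          also have "\<dots> \<le> A * ((D0 - \<gamma>) * (exp (lam * z) / D0))"
            using \<gamma>(2) A D0_pos unfolding K_def by (intro mult_left_mono mult_right_mono) auto
          also have "\<dots> = A * (exp (lam * z) - \<gamma> * (exp (lam * z) / D0))" using D0_pos by (simp add: field_simps)
          also have "\<dots> \<le> A * (b * \<gamma> * deriv \<phi> w + eta lam z - \<gamma> * \<omega> z)"
          proof (intro mult_left_mono)
            have "\<gamma> * \<omega> z \<le> \<gamma> * (exp (lam * z) / D0)" using \<gamma> omega_le_exp by (intro mult_left_mono) auto
            moreover have "eta lam z = exp (lam * z)" using 1 M(1) lam_pos by (intro eta_eq_exp) auto
            ultimately show "exp (lam * z) - \<gamma> * (exp (lam * z) / D0) \<le> b * \<gamma> * deriv \<phi> w + eta lam z - \<gamma> * \<omega> z"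
              using dpos by linarith
          qed (use A in simp)
          finally show ?thesis .
        next
          case 2
          have "\<bar>P - \<kappa>\<bar> < rb / 2" unfolding P_def by (rule Y1) (use 2 wz M(3) in linarith)
          then have "s * (g (P + s * Q) - g P) \<le> (deriv g \<kappa> + \<epsilon>) * Q"
            using Q(3) q0(3) rb(2) by (intro slope[of \<kappa> rb]) auto
          also have "\<dots> \<le> (deriv g \<kappa> + \<epsilon>) * (K * A)"
            using Q(2) slope_kappa_nonneg \<epsilon>(1) by (intro mult_left_mono) auto
          also have "\<dots> = A * ((deriv g \<kappa> + \<epsilon>) * K)" by simp
          also have "\<dots> \<le> A * (b * \<gamma> * deriv \<phi> w + eta lam z - \<gamma> * \<omega> z)"
          proof (intro mult_left_mono)
            have "\<gamma> * \<omega> z \<le> \<gamma> * 1" using \<gamma> omega_le_1 by (intro mult_left_mono) auto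
            moreover have "eta lam z = 1" using 2 M(1) lam_pos by (intro eta_eq_1) auto
            ultimately show "(deriv g \<kappa> + \<epsilon>) * K \<le> b * \<gamma> * deriv \<phi> w + eta lam z - \<gamma> * \<omega> z"
              using dpos \<gamma>(3) unfolding K_def by linarith
          qed (use A in simp)
          finally show ?thesis .
        next
          case 3
          have "s * (g (P + s * Q) - g P) \<le> \<bar>g (P + s * Q) - g P\<bar>" using s by auto
          also have "\<dots> \<le> L * \<bar>s * Q\<bar>" using L(2)[of "P + s * Q" P] by simp
          also have "\<bar>s * Q\<bar> = Q" using s Q(1) by auto
          also have "L * Q \<le> L * (K * A)" using L(1) Q(2) by (intro mult_left_mono) auto
          also have "\<dots> = A * (L * K)" by simp
          also have "\<dots> \<le> A * (b * \<gamma> * deriv \<phi> w + eta lam z - \<gamma> * \<omega> z)"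
          proof (intro mult_left_mono)
            have "b * \<gamma> * \<rho> \<le> b * \<gamma> * deriv \<phi> w"
              using b(1) \<gamma>(1) 3 wz by (intro mult_left_mono \<rho>(2)) auto
            moreover have "\<gamma> * \<omega> z \<le> \<gamma> * 1" using \<gamma> omega_le_1 by (intro mult_left_mono) auto
            ultimately show "L * K \<le> b * \<gamma> * deriv \<phi> w + eta lam z - \<gamma> * \<omega> z"
              using b(2) eta_nonneg[of lam z] by linarith
          qed (use A in simp)
          finally show ?thesis .
        qed
      qed
      \<comment> \<open>The shift was smaller at the delayed time, so replacing it by the current
        one only enlarges the barrier in the direction of s.\<close>
      have Uth: "s * U (t - h) x \<le> s * (P + s * Q)"
      proof -
        have e: "x + c * (t - h) = z - c * h" unfolding z_def by (simp add: algebra_simps)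
        have "s * \<phi> (z - c * h + S (t - h)) \<le> s * P"
          unfolding P_def
        proof (rule sphi)
          have "b * q * (K - E (t - h)) \<le> b * q * (K - E t)"
            using b q K E0[of t] unfolding Eh by (intro mult_left_mono) auto
          then show "s * (z - c * h + S (t - h)) \<le> s * (w - c * h)"
            using sS[of t] sS[of "t - h"] unfolding w_def by (simp add: algebra_simps)
        qed
        moreover have "U (t - h) x = \<phi> (z - c * h + S (t - h)) + s * Q"
          unfolding U_def e Eh Q_def A_def by (simp add: algebra_simps)
        ultimately show ?thesis by (simp add: distrib_left)
      qed
      have gU: "s * g (U (t - h) x) \<le> s * g (P + s * Q)"
        using Uth s monoD[OF mono, of "U (t - h) x" "P + s * Q"] monoD[OF mono, of "P + s * Q" "U (t - h) x"] by auto
      have "s * (p - r + U t x - g (U (t - h) x))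
        = (s * s) * (A * (b * \<gamma> * deriv \<phi> w + eta lam z - \<gamma> * \<omega> z)) + s * g P - s * g (U (t - h) x)"
        unfolding p_def r_def U_def S1_def P_def z_def[symmetric] w_def[symmetric] A_def[symmetric]
        by (simp add: algebra_simps A_def)
      also have "\<dots> \<ge> 0" using key gU ss by (simp add: algebra_simps)
      finally show "\<exists>p r. heat_jet U t x p r \<and> 0 \<le> s * (p - r + U t x - g (U (t - h) x))" using jU by blast
    qed
    have "s * S t0 \<le> s * (s * (b * K * q))"
      unfolding sS mult.assoc[symmetric] ss using b q E0[of t0] by (simp add: algebra_simps)
    then have "s * \<phi> (x0 + c * t0 + S t0) \<le> s * \<phi> (x0 + c * t0 + s * (b * K * q))"
      by (intro sphi) (simp add: algebra_simps)
    moreover have "s * U t0 x0 = s * \<phi> (x0 + c * t0 + S t0) + (s * s) * (q * E t0 * \<omega> (x0 + c * t0))"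
      unfolding U_def by (simp add: algebra_simps)
    ultimately show "s * (u t0 x0 - \<phi> (x0 + c * t0 + s * (b * K * q))) \<le> q * exp (- \<gamma> * (t0 - T)) * \<omega> (x0 + c * t0)"
      using main ss unfolding E_def by (simp add: algebra_simps)
  qed
qed

end

section \<open>Convergence\<close>

lemma signed_bounds:
  fixes s x :: real
  assumes "s = 1 \<or> s = - 1" shows "s * x \<le> \<bar>x\<bar>" "- \<bar>x\<bar> \<le> s * x"
  using assms by auto

lemma (in mono_H) wavefront_translate:
  assumes w: "wavefront g h \<kappa> c \<phi>"
  shows "wavefront g h \<kappa> c (\<lambda>x. \<phi> (x + a))"
proof (rule fixed_point_wavefront)
  note P = wavefront_is_profile[OF w]
  show "is_profile (\<lambda>x. \<phi> (x + a))" by (rule is_profile_translate[OF P(1)])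
  show "\<phi> (z + a) = profile_op c h (\<lambda>x. \<phi> (x + a)) z" for z
    using profile_op_translate[of c h \<phi> a z] P(2) by simp
  show "\<phi> (z + a) > 0" for z using w unfolding wavefront_def by blast
  have "(\<phi> \<longlongrightarrow> 0) at_bot" "(\<phi> \<longlongrightarrow> \<kappa>) at_top" using w unfolding wavefront_def by auto
  then show "((\<lambda>x. \<phi> (x + a)) \<longlongrightarrow> 0) at_bot" "((\<lambda>x. \<phi> (x + a)) \<longlongrightarrow> \<kappa>) at_top"
    using tendsto_shift_at_bot[of \<phi> 0 "- a"] tendsto_shift_at_top[of \<phi> \<kappa> "- a"] by auto
qed

context stable_front
begin

lemma stable_front_translate: "stable_front g \<kappa> h c (\<lambda>x. \<phi> (x + a)) lam"
proof unfold_locales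
  show "wavefront g h \<kappa> c (\<lambda>x. \<phi> (x + a))" by (rule wavefront_translate[OF front])
qed (use h minimal pushed lam in auto)

text \<open>For \<open>s = 1\<close> the solution is eventually below \<open>\<phi> (\<cdot> + \<xi>)\<close> up to a small multiple of the weight,
  for \<open>s = - 1\<close> eventually above \<open>\<phi> (\<cdot> - \<xi>)\<close>.\<close>

definition squeezed :: "(real \<Rightarrow> real \<Rightarrow> real) \<Rightarrow> real \<Rightarrow> real \<Rightarrow> bool" where
  "squeezed u s \<xi> \<longleftrightarrow>
     (\<forall>q>0. \<exists>T. \<forall>t\<ge>T. \<forall>x. s * (u t x - \<phi> (x + c * t + s * \<xi>)) \<le> q * \<omega> (x + c * t))"

text \<open>Applying the barrier to a translated solution puts the weight at the wrong place by a;
  the factor exp(lam |a|) is fixed and is beaten by the decay in time.\<close>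

lemma barrier_squeezed:
  "\<exists>q0>0. \<exists>\<beta>>0. \<forall>u s q T a. is_sol h u \<longrightarrow> s = 1 \<or> s = - 1 \<longrightarrow> 0 < q \<longrightarrow> q \<le> q0 \<longrightarrow> 0 \<le> T \<longrightarrow>
     (\<forall>t\<in>{T-h..T}. \<forall>x. s * (u t x - \<phi> (x + c * t + a)) \<le> q * \<omega> (x + c * t + a)) \<longrightarrow>
     squeezed u s (s * a + \<beta> * q)"
proof -
  from barrier obtain q0 \<beta> \<gamma> where q0: "q0 > 0" and \<beta>: "\<beta> > 0" and \<gamma>: "\<gamma> > 0"
    and "\<forall>u s q T. is_sol h u \<longrightarrow> s = 1 \<or> s = - 1 \<longrightarrow> 0 < q \<longrightarrow> q \<le> q0 \<longrightarrow> 0 \<le> T \<longrightarrow>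
     (\<forall>t\<in>{T-h..T}. \<forall>x. s * (u t x - \<phi> (x + c * t)) \<le> q * \<omega> (x + c * t)) \<longrightarrow>
     (\<forall>t\<ge>T. \<forall>x. s * (u t x - \<phi> (x + c * t + s * (\<beta> * q))) \<le> q * exp (- \<gamma> * (t - T)) * \<omega> (x + c * t))"
    by (elim exE conjE) (rule that)
  note bar = this(4)[THEN spec, THEN spec, THEN spec, THEN spec, THEN mp, THEN mp, THEN mp, THEN mp, THEN mp, THEN mp]
  show ?thesis
  proof (rule exI[of _ q0], rule conjI[OF q0], rule exI[of _ \<beta>], rule conjI[OF \<beta>], intro allI impI)
    fix u :: "real \<Rightarrow> real \<Rightarrow> real" and s q T a :: real
    assume u: "is_sol h u" and s: "s = 1 \<or> s = - 1" and q: "0 < q" "q \<le> q0" and T: "0 \<le> T"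
      and hist: "\<forall>t\<in>{T-h..T}. \<forall>x. s * (u t x - \<phi> (x + c * t + a)) \<le> q * \<omega> (x + c * t + a)"
    have "\<forall>t\<in>{T-h..T}. \<forall>x. s * (u t (x + (- a)) - \<phi> (x + c * t)) \<le> q * \<omega> (x + c * t)"
    proof (intro ballI allI)
      fix t x assume "t \<in> {T-h..T}"
      then have "s * (u t (x + (- a)) - \<phi> ((x + (- a)) + c * t + a)) \<le> q * \<omega> ((x + (- a)) + c * t + a)"
        using hist by blast
      then show "s * (u t (x + (- a)) - \<phi> (x + c * t)) \<le> q * \<omega> (x + c * t)" by (simp add: algebra_simps)
    qed
    from bar[OF is_sol_translate[OF u] s q T this]
    have res: "s * (u t (x + (- a)) - \<phi> (x + c * t + s * (\<beta> * q))) \<le> q * exp (- \<gamma> * (t - T)) * \<omega> (x + c * t)"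
      if "t \<ge> T" for t x using that by blast
    show "squeezed u s (s * a + \<beta> * q)"
      unfolding squeezed_def
    proof (intro allI impI)
      fix q' :: real assume q': "q' > 0"
      have "((\<lambda>t. q * exp (- \<gamma> * (t - T)) * exp (lam * \<bar>a\<bar>)) \<longlongrightarrow> 0) at_top" using \<gamma> by real_asymp
      then obtain T1 where T1: "\<And>t. t \<ge> T1 \<Longrightarrow> \<bar>q * exp (- \<gamma> * (t - T)) * exp (lam * \<bar>a\<bar>) - 0\<bar> < q'"
        using tendsto_at_topD[OF _ q'] by blast
      show "\<exists>T. \<forall>t\<ge>T. \<forall>x. s * (u t x - \<phi> (x + c * t + s * (s * a + \<beta> * q))) \<le> q' * \<omega> (x + c * t)"
      proof (intro exI[of _ "max T T1"] allI impI)
        fix t x assume t: "max T T1 \<le> t"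
        have ss: "s * (s * a) = a" using s by auto
        have "s * (u t ((x + a) + (- a)) - \<phi> ((x + a) + c * t + s * (\<beta> * q)))
            \<le> q * exp (- \<gamma> * (t - T)) * \<omega> ((x + a) + c * t)" by (rule res) (use t in simp)
        also have "\<dots> \<le> q * exp (- \<gamma> * (t - T)) * (exp (lam * \<bar>- a\<bar>) * \<omega> (((x + a) + c * t) + (- a)))"
          using q by (intro mult_left_mono omega_shift) auto
        also have "\<dots> = (q * exp (- \<gamma> * (t - T)) * exp (lam * \<bar>a\<bar>)) * \<omega> (x + c * t)" by simp
        also have "\<dots> \<le> q' * \<omega> (x + c * t)"
          using T1[of t] t omega_pos[of "x + c * t"] by (intro mult_right_mono) auto
        finally show "s * (u t x - \<phi> (x + c * t + s * (s * a + \<beta> * q))) \<le> q' * \<omega> (x + c * t)"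
          unfolding distrib_left[of s] ss by (simp add: algebra_simps)
      qed
    qed
  qed
qed

text \<open>A gap at the centre of the front spreads over any compact range within unit time; there it pays
  for a small shift, and outside that range the shift costs only \<open>\<delta> * k * \<omega>\<close> with \<open>\<delta>\<close> small.\<close>

lemma improve:
  assumes u: "is_sol h u" and s: "s = 1 \<or> s = - 1" and sq: "squeezed u s 0" and d: "d > 0"
    and gap: "\<And>T0. \<exists>T\<ge>T0. d \<le> s * (\<phi> 0 - u T (- c * T))"
  shows "\<exists>\<xi><0. squeezed u s \<xi>"
proof -
  from barrier_squeezed obtain q0 \<beta> where q0: "q0 > 0" and \<beta>: "\<beta> > 0"
    and "\<forall>u s q T a. is_sol h u \<longrightarrow> s = 1 \<or> s = - 1 \<longrightarrow> 0 < q \<longrightarrow> q \<le> q0 \<longrightarrow> 0 \<le> T \<longrightarrow>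
     (\<forall>t\<in>{T-h..T}. \<forall>x. s * (u t x - \<phi> (x + c * t + a)) \<le> q * \<omega> (x + c * t + a)) \<longrightarrow>
     squeezed u s (s * a + \<beta> * q)"
    by (elim exE conjE) (rule that)
  note bar = this(3)[THEN spec, THEN spec, THEN spec, THEN spec, THEN spec,
      THEN mp, THEN mp, THEN mp, THEN mp, THEN mp, THEN mp]
  obtain L where L: "L \<ge> 1" "\<And>x y. \<bar>g x - g y\<bar> \<le> L * \<bar>x - y\<bar>" using lipschitz by blast
  define e where "e = exp lam"
  have e: "e > 0" by (simp add: e_def)
  \<comment> \<open>A shift by k is bought back at the price \<beta> (\<delta> k + q) e. This
    \<delta> limits the first part to k / 4, and the later choice of q limits the second to k / 8,
    so a net gain remains.\<close>
  define \<delta> where "\<delta> = 1 / (4 * \<beta> * e)"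
  have \<delta>: "\<delta> > 0" "\<beta> * e * \<delta> = 1 / 4" unfolding \<delta>_def using \<beta> e by auto
  obtain M where M: "M > 0" "\<And>z k. \<bar>z\<bar> \<ge> M \<Longrightarrow> \<bar>k\<bar> \<le> 1 \<Longrightarrow> \<bar>\<phi> (z + k) - \<phi> z\<bar> \<le> \<delta> * \<bar>k\<bar> * \<omega> z"
    using phi_increment_far[OF \<delta>(1)] by blast
  define K3 where "K3 = rate_p c * \<kappa>"
  have K3: "K3 > 0" "\<And>x y. \<bar>\<phi> x - \<phi> y\<bar> \<le> K3 * \<bar>x - y\<bar>"
    using rates(1) kappa_pos phi_lipschitz by (auto simp: K3_def)
  define K where "K = 9 * \<kappa> + K3"
  have K: "K > 0" using K3 kappa_pos by (simp add: K_def)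
  \<comment> \<open>K adds the Lipschitz constants of the solution and of \<phi>, so half of the gap
    d persists on a ball of radius r.\<close>
  define r where "r = d / (2 * K)"
  have r: "r > 0" "K * r = d / 2" unfolding r_def using d K by auto
  \<comment> \<open>Covers |z| \<le> M in the moving frame during the whole time 1 + h.\<close>
  define R where "R = M + c * (1 + h)"
  have R: "R > 0" unfolding R_def using M c_pos h by (intro add_pos_nonneg) auto
  from positivity_spreads[OF r(1) R h] obtain \<epsilon>0 where \<epsilon>0: "\<epsilon>0 > 0" and "\<forall>w T x0 m. 0 \<le> m \<longrightarrow>
     continuous_on ({T..T+1+h} \<times> UNIV) (\<lambda>(t,x). w t x) \<longrightarrow>
     (\<forall>t\<in>{T..T+1+h}. \<forall>x. 0 \<le> w t x) \<longrightarrow>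
     (\<forall>t\<in>{T<..T+1+h}. \<forall>x. \<exists>p r. heat_jet w t x p r \<and> r - w t x \<le> p) \<longrightarrow>
     (\<forall>x. \<bar>x - x0\<bar> \<le> r \<longrightarrow> m \<le> w T x) \<longrightarrow>
     (\<forall>t\<in>{T+1..T+1+h}. \<forall>x. \<bar>x - x0\<bar> \<le> R \<longrightarrow> \<epsilon>0 * m \<le> w t x)"
    by (elim exE conjE) (rule that)
  note spread = this(2)[THEN spec, THEN spec, THEN spec, THEN spec, THEN mp, THEN mp, THEN mp, THEN mp, THEN mp]
  define \<epsilon>1 where "\<epsilon>1 = \<epsilon>0 * (d / 2)"
  have \<epsilon>1: "\<epsilon>1 > 0" unfolding \<epsilon>1_def using \<epsilon>0 d by simp
  define k where "k = min 1 (min (\<epsilon>1 / (2 * K3)) (q0 / (2 * \<delta> * e)))"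
  have k: "k > 0" "k \<le> 1" "K3 * k \<le> \<epsilon>1 / 2" "\<delta> * k * e \<le> q0 / 2"
  proof -
    show "k > 0" "k \<le> 1" unfolding k_def using \<epsilon>1 K3 q0 \<delta> e by auto
    have "k \<le> \<epsilon>1 / (2 * K3)" "k \<le> q0 / (2 * \<delta> * e)" unfolding k_def by auto
    then show "K3 * k \<le> \<epsilon>1 / 2" "\<delta> * k * e \<le> q0 / 2" using K3(1) \<delta>(1) e by (auto simp: field_simps)
  qed
  define Q where "Q = L + 1"
  have Q: "Q \<ge> 1" "Q \<ge> L" using L by (auto simp: Q_def)
  define q where "q = min (\<epsilon>1 / (2 * Q)) (min (q0 / (2 * e)) (k / (8 * \<beta> * e)))"
  have q: "q > 0" "Q * q \<le> \<epsilon>1 / 2" "q * e \<le> q0 / 2" "\<beta> * (q * e) \<le> k / 8"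
  proof -
    show "q > 0" unfolding q_def using \<epsilon>1 Q q0 e k \<beta> by auto
    have "q \<le> \<epsilon>1 / (2 * Q)" "q \<le> q0 / (2 * e)" "q \<le> k / (8 * \<beta> * e)" unfolding q_def by auto
    then show "Q * q \<le> \<epsilon>1 / 2" "q * e \<le> q0 / 2" "\<beta> * (q * e) \<le> k / 8" using Q e \<beta> by (auto simp: field_simps)
  qed
  have "\<exists>T. \<forall>t\<ge>T. \<forall>x. s * (u t x - \<phi> (x + c * t)) \<le> q * \<omega> (x + c * t)"
    using sq q(1) unfolding squeezed_def by simp
  then obtain T1 where T1: "\<And>t x. t \<ge> T1 \<Longrightarrow> s * (u t x - \<phi> (x + c * t)) \<le> q * \<omega> (x + c * t)" by blast
  obtain T where T: "T \<ge> max (T1 + h) (1 + h)" "d \<le> s * (\<phi> 0 - u T (- c * T))" using gap by blast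
  \<comment> \<open>The constant Q q with Q = L + 1 lifts the almost ordered difference to a
    nonnegative function and compensates the term L q left by the delayed nonlinearity.\<close>
  define w where "w t x = s * (\<phi> (x + c * t) - u t x) + Q * q" for t x
  have low: "s * (\<phi> (x + c * t) - u t x) \<ge> - q" if "t \<ge> T - h" for t x
  proof -
    have "q * \<omega> (x + c * t) \<le> q * 1" using q omega_le_1 by (intro mult_left_mono) auto
    then show ?thesis using T1[of t x] that T by (simp add: algebra_simps)
  qed
  have Qq: "q \<le> Q * q" "L * q \<le> Q * q" using Q q by (auto intro: mult_right_mono)
  have spr: "\<forall>t\<in>{T+1..T+1+h}. \<forall>x. \<bar>x - (- c * T)\<bar> \<le> R \<longrightarrow> \<epsilon>0 * (d / 2) \<le> w t x"
  proof (rule spread)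
    show "0 \<le> d / 2" using d by simp
    have "continuous_on ({T..T+1+h} \<times> UNIV) (\<lambda>(t,x). u t x)"
      by (rule continuous_on_subset[OF is_solD(1)[OF u]]) (use T h in auto)
    moreover have "continuous_on ({T..T+1+h} \<times> UNIV) (\<lambda>p. \<phi> (snd p + c * fst p))"
      by (intro continuous_on_compose2[OF phi_continuous[of UNIV]] continuous_intros) auto
    ultimately show "continuous_on ({T..T+1+h} \<times> UNIV) (\<lambda>(t,x). w t x)"
      unfolding w_def case_prod_unfold by (intro continuous_intros)
    show "\<forall>t\<in>{T..T+1+h}. \<forall>x. 0 \<le> w t x"
    proof (intro ballI allI)
      fix t x assume "t \<in> {T..T+1+h}"
      then show "0 \<le> w t x" using low[of t x] Qq(1) h unfolding w_def by simp
    qed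
    show "\<forall>t\<in>{T<..T+1+h}. \<forall>x. \<exists>p r. heat_jet w t x p r \<and> r - w t x \<le> p"
    proof (intro ballI allI)
      fix t x assume t: "t \<in> {T<..T+1+h}"
      define z where "z = x + c * t"
      have "t > 0" using t T h by auto
      then obtain p r where pr: "heat_jet u t x p r" "p = r - u t x + g (u (t - h) x)"
        using is_sol_jet[OF u] by blast
      have jphi: "heat_jet (\<lambda>t x. \<phi> (x + c * t)) t x (deriv \<phi> z * c) (c * deriv \<phi> z + \<phi> z - g (\<phi> (z - c * h)))"
        using heat_jet_travelling[where s = "\<lambda>_. 0" and c = c and x = x and t = t and ?s1.0 = 0,
            OF wavefront_derivs(1)[OF front] wavefront_derivs(2)[OF front] DERIV_const]
        unfolding z_def by simp
      have jw: "heat_jet w t x (s * (deriv \<phi> z * c - p)) (s * ((c * deriv \<phi> z + \<phi> z - g (\<phi> (z - c * h))) - r))"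
        using heat_jet_add[OF heat_jet_cmult[OF heat_jet_diff[OF jphi pr(1)], of s] heat_jet_const[of "Q * q"]]
        unfolding w_def[abs_def] by simp
      have ez: "x + c * (t - h) = z - c * h" unfolding z_def by (simp add: algebra_simps)
      have "- L * max 0 (- (s * (\<phi> (z - c * h) - u (t - h) x))) \<le> s * (g (\<phi> (z - c * h)) - g (u (t - h) x))"
        by (rule g_signed[OF L(2) s])
      moreover have "max 0 (- (s * (\<phi> (z - c * h) - u (t - h) x))) \<le> q"
        using low[of "t - h" x] t q unfolding ez by simp
      then have "L * max 0 (- (s * (\<phi> (z - c * h) - u (t - h) x))) \<le> L * q" using L by (intro mult_left_mono) auto
      ultimately have "- (L * q) \<le> s * (g (\<phi> (z - c * h)) - g (u (t - h) x))" by linarith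
      then have "s * ((c * deriv \<phi> z + \<phi> z - g (\<phi> (z - c * h))) - r) - w t x \<le> s * (deriv \<phi> z * c - p)"
        using Qq(2) unfolding w_def pr(2) z_def[symmetric] by (simp add: algebra_simps)
      then show "\<exists>p r. heat_jet w t x p r \<and> r - w t x \<le> p" using jw by blast
    qed
    show "\<forall>x. \<bar>x - (- c * T)\<bar> \<le> r \<longrightarrow> d / 2 \<le> w T x"
    proof (intro allI impI)
      fix x assume x: "\<bar>x - (- c * T)\<bar> \<le> r"
      have 1: "\<bar>u T x - u T (- c * T)\<bar> \<le> 9 * \<kappa> * \<bar>x - (- c * T)\<bar>"
        by (rule sol_lipschitz[OF u h]) (use T h in auto)
      have 2: "\<bar>\<phi> (x + c * T) - \<phi> 0\<bar> \<le> K3 * \<bar>x - (- c * T)\<bar>" using K3(2)[of "x + c * T" 0] by simp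
      have "9 * \<kappa> * \<bar>x - (- c * T)\<bar> + K3 * \<bar>x - (- c * T)\<bar> = K * \<bar>x - (- c * T)\<bar>"
        unfolding K_def by (simp add: distrib_right)
      also have "\<dots> \<le> K * r" using x K by (intro mult_left_mono) auto
      finally have "9 * \<kappa> * \<bar>x - (- c * T)\<bar> + K3 * \<bar>x - (- c * T)\<bar> \<le> d / 2" using r by simp
      then have "\<bar>u T x - u T (- c * T)\<bar> + \<bar>\<phi> (x + c * T) - \<phi> 0\<bar> \<le> d / 2" using 1 2 by linarith
      moreover have "s * (\<phi> (x + c * T) - u T x)
          = s * (\<phi> 0 - u T (- c * T)) + s * (\<phi> (x + c * T) - \<phi> 0) - s * (u T x - u T (- c * T))"
        by (simp add: algebra_simps)
      ultimately have "s * (\<phi> (x + c * T) - u T x) \<ge> d / 2"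
        using T(2) signed_bounds[OF s, of "\<phi> (x + c * T) - \<phi> 0"] signed_bounds[OF s, of "u T x - u T (- c * T)"]
        by linarith
      moreover have "0 \<le> Q * q" using Q q by simp
      ultimately show "d / 2 \<le> w T x" unfolding w_def by linarith
    qed
  qed
  have hist: "\<forall>t\<in>{(T+1+h)-h..T+1+h}. \<forall>x. s * (u t x - \<phi> (x + c * t + (- (s * k)))) \<le> ((\<delta> * k + q) * e) * \<omega> (x + c * t + (- (s * k)))"
  proof (intro ballI allI)
    fix t x assume t: "t \<in> {(T+1+h)-h..T+1+h}"
    define z where "z = x + c * t"
    have ks: "\<bar>- (s * k)\<bar> = k" using s k by auto
    have om: "\<omega> z \<le> e * \<omega> (z + (- (s * k)))"
    proof -
      have "\<omega> z \<le> exp (lam * \<bar>- (s * k)\<bar>) * \<omega> (z + (- (s * k)))" by (rule omega_shift)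
      also have "\<dots> \<le> e * \<omega> (z + (- (s * k)))"
        unfolding ks e_def using k lam_pos omega_pos by (intro mult_right_mono) (auto simp: less_imp_le mult_left_le)
      finally show ?thesis .
    qed
    have "s * (u t x - \<phi> (z + (- (s * k)))) \<le> (\<delta> * k + q) * \<omega> z"
    proof (cases "\<bar>z\<bar> \<ge> M")
      case True
      have "\<bar>\<phi> (z + (- (s * k))) - \<phi> z\<bar> \<le> \<delta> * \<bar>- (s * k)\<bar> * \<omega> z" by (rule M(2)[OF True]) (use ks k in simp)
      then have "\<bar>\<phi> (z + (- (s * k))) - \<phi> z\<bar> \<le> \<delta> * k * \<omega> z" unfolding ks .
      moreover have "s * (u t x - \<phi> z) \<le> q * \<omega> z" unfolding z_def by (rule T1) (use t T h in auto)
      moreover have "s * (u t x - \<phi> (z + (- (s * k)))) = s * (u t x - \<phi> z) - s * (\<phi> (z + (- (s * k))) - \<phi> z)"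
        by (simp add: algebra_simps)
      ultimately show ?thesis
        unfolding distrib_right using signed_bounds[OF s, of "\<phi> (z + (- (s * k))) - \<phi> z"] by linarith
    next
      case False
      have "\<bar>c * (t - T)\<bar> \<le> c * (1 + h)" using t c_pos h by (simp add: abs_mult)
      moreover have "x - (- c * T) = z - c * (t - T)" unfolding z_def by (simp add: algebra_simps)
      ultimately have "\<bar>x - (- c * T)\<bar> \<le> R" using False unfolding R_def by linarith
      then have "\<epsilon>1 \<le> w t x" using spr t unfolding \<epsilon>1_def by auto
      then have "s * (\<phi> z - u t x) \<ge> \<epsilon>1 / 2" using q(2) unfolding w_def z_def[symmetric] by linarith
      moreover have "\<bar>\<phi> (z + (- (s * k))) - \<phi> z\<bar> \<le> K3 * \<bar>- (s * k)\<bar>" using K3(2)[of "z + (- (s * k))" z] by simp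
      then have "\<bar>\<phi> (z + (- (s * k))) - \<phi> z\<bar> \<le> \<epsilon>1 / 2" unfolding ks using k by linarith
      moreover have "s * (u t x - \<phi> (z + (- (s * k)))) = - (s * (\<phi> z - u t x)) - s * (\<phi> (z + (- (s * k))) - \<phi> z)"
        by (simp add: algebra_simps)
      ultimately have "s * (u t x - \<phi> (z + (- (s * k)))) \<le> 0"
        using signed_bounds[OF s, of "\<phi> (z + (- (s * k))) - \<phi> z"] by linarith
      also have "\<dots> \<le> (\<delta> * k + q) * \<omega> z" using \<delta> k q omega_pos[of z] by simp
      finally show ?thesis .
    qed
    also have "\<dots> \<le> (\<delta> * k + q) * (e * \<omega> (z + (- (s * k))))"
      using om \<delta> k q by (intro mult_left_mono) auto
    finally show "s * (u t x - \<phi> (x + c * t + (- (s * k)))) \<le> ((\<delta> * k + q) * e) * \<omega> (x + c * t + (- (s * k)))"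
      unfolding z_def by (simp add: mult.assoc)
  qed
  have q1: "0 < (\<delta> * k + q) * e" "(\<delta> * k + q) * e \<le> q0"
    using \<delta> k q e by (auto simp: distrib_right add_pos_pos)
  have "0 \<le> T + 1 + h" using T h by auto
  from bar[OF u s q1 this hist] have res: "squeezed u s (s * (- (s * k)) + \<beta> * ((\<delta> * k + q) * e))" .
  have "\<beta> * ((\<delta> * k + q) * e) = (\<beta> * e * \<delta>) * k + \<beta> * (q * e)" by (simp add: algebra_simps)
  also have "\<dots> \<le> k / 4 + k / 8" unfolding \<delta>(2) using q(4) by simp
  finally have "s * (- (s * k)) + \<beta> * ((\<delta> * k + q) * e) < 0" using s k by auto
  then show ?thesis using res by blast
qed

text \<open>Translation of \<phi> is Lipschitz in the \<omega>-weighted norm, so the infimum of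
  admissible shifts is attained.\<close>

lemma squeezed_closed:
  assumes s: "s = 1 \<or> s = - 1" and near: "\<And>e. e > 0 \<Longrightarrow> \<exists>\<xi>. squeezed u s \<xi> \<and> \<bar>\<xi> - m\<bar> < e"
  shows "squeezed u s m"
  unfolding squeezed_def
proof (intro allI impI)
  fix q :: real assume q: "q > 0"
  obtain C where C: "C > 0" "\<And>z k. \<bar>k\<bar> \<le> 1 \<Longrightarrow> \<bar>\<phi> (z + k) - \<phi> z\<bar> \<le> C * \<bar>k\<bar> * \<omega> z"
    using phi_increment[of 1] by blast
  define E where "E = exp (lam * \<bar>m\<bar>)"
  have E: "E > 0" by (simp add: E_def)
  define e where "e = min 1 (q / (2 * C * E))"
  have e: "e > 0" "e \<le> 1" "C * e * E \<le> q / 2"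
  proof -
    show "e > 0" "e \<le> 1" unfolding e_def using q C E by auto
    have "e \<le> q / (2 * C * E)" unfolding e_def by simp
    then show "C * e * E \<le> q / 2" using C E by (simp add: field_simps)
  qed
  obtain \<xi> where \<xi>: "squeezed u s \<xi>" "\<bar>\<xi> - m\<bar> < e" using near[OF e(1)] by blast
  obtain T where T: "\<And>t x. t \<ge> T \<Longrightarrow> s * (u t x - \<phi> (x + c * t + s * \<xi>)) \<le> (q / 2) * \<omega> (x + c * t)"
    using \<xi>(1) q unfolding squeezed_def by (metis half_gt_zero)
  show "\<exists>T. \<forall>t\<ge>T. \<forall>x. s * (u t x - \<phi> (x + c * t + s * m)) \<le> q * \<omega> (x + c * t)"
  proof (intro exI[of _ T] allI impI)
    fix t x assume t: "T \<le> t"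
    define z where "z = x + c * t"
    have abs: "\<bar>s * (\<xi> - m)\<bar> = \<bar>\<xi> - m\<bar>" "\<bar>- (s * m)\<bar> = \<bar>m\<bar>" using s by auto
    have "\<bar>\<phi> ((z + s * m) + s * (\<xi> - m)) - \<phi> (z + s * m)\<bar> \<le> C * \<bar>s * (\<xi> - m)\<bar> * \<omega> (z + s * m)"
      by (rule C(2)) (use abs \<xi> e in simp)
    also have "\<dots> \<le> C * e * (E * \<omega> z)"
    proof (intro mult_mono)
      show "\<omega> (z + s * m) \<le> E * \<omega> z"
        using omega_shift[of "z + s * m" "- (s * m)"] unfolding abs E_def by simp
    qed (use abs \<xi> C e E omega_pos in \<open>auto simp: less_imp_le\<close>)
    also have "\<dots> = (C * e * E) * \<omega> z" by simp
    also have "\<dots> \<le> (q / 2) * \<omega> z" using e omega_pos[of z] by (intro mult_right_mono) auto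
    also have "(z + s * m) + s * (\<xi> - m) = z + s * \<xi>" by (simp add: algebra_simps)
    finally have "\<bar>\<phi> (z + s * \<xi>) - \<phi> (z + s * m)\<bar> \<le> (q / 2) * \<omega> z" .
    moreover have "s * (u t x - \<phi> (z + s * \<xi>)) \<le> (q / 2) * \<omega> z" using T[OF t, of x] unfolding z_def .
    moreover have "q * \<omega> z = (q / 2) * \<omega> z + (q / 2) * \<omega> z" by simp
    moreover have "s * (u t x - \<phi> (z + s * m)) = s * (u t x - \<phi> (z + s * \<xi>)) + s * (\<phi> (z + s * \<xi>) - \<phi> (z + s * m))"
      by (simp add: algebra_simps)
    ultimately show "s * (u t x - \<phi> (x + c * t + s * m)) \<le> q * \<omega> (x + c * t)"
      unfolding z_def[symmetric] using signed_bounds[OF s, of "\<phi> (z + s * \<xi>) - \<phi> (z + s * m)"] by linarith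
  qed
qed

lemma squeezed_order:
  assumes "squeezed u 1 \<xi>" "squeezed u (- 1) \<xi>'"
  shows "- \<xi>' \<le> \<xi>"
proof (rule ccontr)
  assume "\<not> - \<xi>' \<le> \<xi>"
  then have lt: "\<phi> \<xi> < \<phi> (- \<xi>')" by (intro phi_strict_mono) simp
  define q where "q = (\<phi> (- \<xi>') - \<phi> \<xi>) / 4"
  have q: "q > 0" using lt by (simp add: q_def)
  obtain T where T: "\<And>t x. t \<ge> T \<Longrightarrow> 1 * (u t x - \<phi> (x + c * t + 1 * \<xi>)) \<le> q * \<omega> (x + c * t)"
    using assms(1) q unfolding squeezed_def by metis
  obtain T' where T': "\<And>t x. t \<ge> T' \<Longrightarrow> (- 1) * (u t x - \<phi> (x + c * t + (- 1) * \<xi>')) \<le> q * \<omega> (x + c * t)"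
    using assms(2) q unfolding squeezed_def by metis
  define t where "t = max T T'"
  have "q * \<omega> 0 \<le> q * 1" using q omega_le_1 by (intro mult_left_mono) auto
  moreover have "u t (- c * t) - \<phi> \<xi> \<le> q * \<omega> 0" using T[of t "- c * t"] by (simp add: t_def)
  moreover have "\<phi> (- \<xi>') - u t (- c * t) \<le> q * \<omega> 0" using T'[of t "- c * t"] by (simp add: t_def)
  ultimately have "\<phi> (- \<xi>') - \<phi> \<xi> \<le> 2 * q" by linarith
  moreover have "4 * q = \<phi> (- \<xi>') - \<phi> \<xi>" by (simp add: q_def)
  ultimately show False using q by linarith
qed

text \<open>The locale is reinterpreted with the translated front, which moves the shift m to
  0.\<close>

lemma squeezed_improve:
  assumes u: "is_sol h u" and s: "s = 1 \<or> s = - 1" and sq: "squeezed u s m" and d: "d > 0"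
    and gap: "\<And>T0. \<exists>T\<ge>T0. d \<le> s * (\<phi> (s * m) - u T (- c * T))"
  shows "\<exists>\<xi><m. squeezed u s \<xi>"
proof -
  interpret F: stable_front g \<kappa> h c "\<lambda>x. \<phi> (x + s * m)" lam by (rule stable_front_translate)
  have eq: "F.squeezed u s \<xi> \<longleftrightarrow> squeezed u s (\<xi> + m)" for \<xi>
    unfolding F.squeezed_def squeezed_def by (simp add: algebra_simps)
  have "\<exists>\<xi><0. F.squeezed u s \<xi>"
    by (rule F.improve[OF u s _ d]) (use gap sq eq[of 0] in auto)
  then obtain \<xi> where "\<xi> < 0" "F.squeezed u s \<xi>" by blast
  then show ?thesis using eq[of \<xi>] by (intro exI[of _ "\<xi> + m"]) auto
qed

text \<open>The optimal upper and lower shifts exist and, by \<open>squeezed_improve\<close>,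
  neither translate can keep a gap to the solution at x = - c t at arbitrarily large times. So both
  translates have the same value there, and strict monotonicity identifies the shifts.\<close>

lemma convergence:
  assumes u: "is_sol h u" and ex: "\<exists>\<xi>. squeezed u 1 \<xi>" "\<exists>\<xi>. squeezed u (- 1) \<xi>"
  shows "\<exists>s0. \<forall>\<epsilon>>0. \<forall>\<^sub>F t in at_top. \<forall>x. \<bar>u t x - \<phi> (x + c * t + s0)\<bar> / eta lam (x + c * t) \<le> \<epsilon>"
proof -
  define A where "A s = {\<xi>. squeezed u s \<xi>}" for s
  obtain \<xi>1 \<xi>2 where \<xi>: "\<xi>1 \<in> A 1" "\<xi>2 \<in> A (- 1)" using ex unfolding A_def by blast
  have ord: "- \<xi>' \<le> \<xi>" if "\<xi> \<in> A 1" "\<xi>' \<in> A (- 1)" for \<xi> \<xi>' using squeezed_order that unfolding A_def by blast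
  have bdd: "bdd_below (A 1)" "bdd_below (A (- 1))"
  proof -
    show "bdd_below (A 1)" by (rule bdd_belowI[of _ "- \<xi>2"]) (use ord \<xi> in auto)
    show "bdd_below (A (- 1))"
    proof (rule bdd_belowI[of _ "- \<xi>1"])
      fix x assume "x \<in> A (- 1)"
      then show "- \<xi>1 \<le> x" using ord[OF \<xi>(1), of x] by simp
    qed
  qed
  define m where "m s = Inf (A s)" for s
  have low: "m s \<le> \<xi>" if "\<xi> \<in> A s" "s = 1 \<or> s = - 1" for s \<xi>
    unfolding m_def by (rule cInf_lower) (use that bdd in auto)
  have mem: "m s \<in> A s" if s: "s = 1 \<or> s = - 1" for s
  proof -
    have "squeezed u s (m s)"
    proof (rule squeezed_closed[OF s])
      fix e :: real assume e: "e > 0"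
      have "A s \<noteq> {}" using \<xi> s by auto
      moreover have "Inf (A s) < m s + e" unfolding m_def using e by simp
      ultimately obtain \<xi> where "\<xi> \<in> A s" "\<xi> < m s + e" using cInf_lessD by blast
      then show "\<exists>\<xi>. squeezed u s \<xi> \<and> \<bar>\<xi> - m s\<bar> < e"
        using low[of \<xi> s] s unfolding A_def by (intro exI[of _ \<xi>]) auto
    qed
    then show ?thesis by (simp add: A_def)
  qed
  have no_gap: "\<exists>T0. \<forall>T\<ge>T0. s * (\<phi> (s * m s) - u T (- c * T)) < d" if s: "s = 1 \<or> s = - 1" and d: "d > 0" for s d
  proof (rule ccontr)
    assume "\<not> ?thesis"
    then have gap: "\<exists>T\<ge>T0. d \<le> s * (\<phi> (s * m s) - u T (- c * T))" for T0 by (meson not_le)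
    have "squeezed u s (m s)" using mem[OF s] by (simp add: A_def)
    then obtain \<xi> where "\<xi> < m s" "squeezed u s \<xi>" using squeezed_improve[OF u s _ d gap] by blast
    then show False using low[of \<xi> s] s by (simp add: A_def)
  qed
  have m_eq: "m 1 = - m (- 1)"
  proof (rule ccontr)
    assume "m 1 \<noteq> - m (- 1)"
    moreover have "- m (- 1) \<le> m 1" by (rule ord) (use mem in auto)
    ultimately have lt: "\<phi> (- m (- 1)) < \<phi> (m 1)" by (intro phi_strict_mono) simp
    \<comment> \<open>Two gaps below half the difference of the translates cannot bridge that
      difference.\<close>
    define d where "d = (\<phi> (m 1) - \<phi> (- m (- 1))) / 2"
    have d: "d > 0" using lt by (simp add: d_def)
    obtain Ta where Ta: "\<And>T. T \<ge> Ta \<Longrightarrow> 1 * (\<phi> (1 * m 1) - u T (- c * T)) < d" using no_gap[of 1, OF _ d] by blast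
    obtain Tb where Tb: "\<And>T. T \<ge> Tb \<Longrightarrow> (- 1) * (\<phi> ((- 1) * m (- 1)) - u T (- c * T)) < d"
      using no_gap[of "- 1", OF _ d] by blast
    show False using Ta[of "max Ta Tb"] Tb[of "max Ta Tb"] unfolding d_def by (simp add: field_simps)
  qed
  define W where "W = max 1 (1 / D0)"
  have W: "W > 0" "\<And>z. \<omega> z \<le> W * eta lam z"
  proof -
    show "W > 0" by (simp add: W_def)
    show "\<omega> z \<le> W * eta lam z" for z
      by (rule le_eta[where C = "1 / D0" and C' = 1]) (use omega_le_exp[of z] omega_le_1[of z] in \<open>auto simp: W_def\<close>)
  qed
  show ?thesis
  proof (intro exI[of _ "m 1"] allI impI)
    fix \<epsilon> :: real assume \<epsilon>: "\<epsilon> > 0"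
    define q where "q = \<epsilon> / W"
    have q: "q > 0" "q * W = \<epsilon>" using \<epsilon> W(1) by (simp_all add: q_def)
    have sq: "squeezed u 1 (m 1)" "squeezed u (- 1) (m (- 1))"
      using mem[of 1] mem[of "- 1"] unfolding A_def by simp_all
    obtain Ta where Ta: "\<And>t x. t \<ge> Ta \<Longrightarrow> 1 * (u t x - \<phi> (x + c * t + 1 * m 1)) \<le> q * \<omega> (x + c * t)"
      using sq(1) q(1) unfolding squeezed_def by metis
    obtain Tb where Tb: "\<And>t x. t \<ge> Tb \<Longrightarrow> (- 1) * (u t x - \<phi> (x + c * t + (- 1) * m (- 1))) \<le> q * \<omega> (x + c * t)"
      using sq(2) q(1) unfolding squeezed_def by metis
    show "\<forall>\<^sub>F t in at_top. \<forall>x. \<bar>u t x - \<phi> (x + c * t + m 1)\<bar> / eta lam (x + c * t) \<le> \<epsilon>"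
      using eventually_ge_at_top[of "max Ta Tb"]
    proof eventually_elim
      case (elim t)
      show ?case
      proof
        fix x
        have "\<bar>u t x - \<phi> (x + c * t + m 1)\<bar> \<le> q * \<omega> (x + c * t)"
          using Ta[of t x] Tb[of t x] elim m_eq by (simp add: abs_le_iff)
        also have "\<dots> \<le> q * (W * eta lam (x + c * t))" using q W(2) by (intro mult_left_mono) auto
        also have "\<dots> = \<epsilon> * eta lam (x + c * t)" using q(2) by (simp add: mult.assoc[symmetric])
        finally show "\<bar>u t x - \<phi> (x + c * t + m 1)\<bar> / eta lam (x + c * t) \<le> \<epsilon>"
          using eta_pos[of lam "x + c * t"] by (simp add: pos_divide_le_eq)
      qed
    qed
  qed
qed

text \<open>On the left \<mu> > lam makes the initial bound small in the weight after a large
  translation; on the right the bound \<kappa> is already close to the front.\<close>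

lemma initially_below:
  assumes u: "is_sol h u" and A: "A > 0" and \<mu>: "lam < \<mu>"
    and init: "\<And>t x. t \<in> {-h..0} \<Longrightarrow> u t x \<le> A * exp (\<mu> * x)"
  shows "\<exists>\<xi>. squeezed u 1 \<xi>"
proof -
  from barrier_squeezed obtain q0 \<beta> where q0: "q0 > 0" and \<beta>: "\<beta> > 0"
    and "\<forall>u s q T a. is_sol h u \<longrightarrow> s = 1 \<or> s = - 1 \<longrightarrow> 0 < q \<longrightarrow> q \<le> q0 \<longrightarrow> 0 \<le> T \<longrightarrow>
     (\<forall>t\<in>{T-h..T}. \<forall>x. s * (u t x - \<phi> (x + c * t + a)) \<le> q * \<omega> (x + c * t + a)) \<longrightarrow>
     squeezed u s (s * a + \<beta> * q)"
    by (elim exE conjE) (rule that)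
  note bar = this(3)[THEN spec, THEN spec, THEN spec, THEN spec, THEN spec,
      THEN mp, THEN mp, THEN mp, THEN mp, THEN mp, THEN mp]
  have \<mu>0: "\<mu> > 0" using \<mu> lam_pos by simp
  define p where "p = q0 * k0"
  have p: "p > 0" using q0 k0_pos by (simp add: p_def)
  obtain Z1 where Z1: "\<And>y. y \<ge> Z1 \<Longrightarrow> \<bar>\<phi> y - \<kappa>\<bar> < p" using tendsto_at_topD[OF phi(6) p] by blast
  define Z where "Z = max 0 Z1"
  have Z: "Z \<ge> 0" "Z \<ge> Z1" by (auto simp: Z_def)
  \<comment> \<open>Solves A exp(\<mu> x) \<le> p exp(\<mu> (\<zeta> - Z)) at the worst time t = -
    h, which accounts for the summand c h.\<close>
  define a where "a = Z + c * h - ln (p / A) / \<mu>"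
  have hist: "\<forall>t\<in>{0-h..0}. \<forall>x. 1 * (u t x - \<phi> (x + c * t + a)) \<le> q0 * \<omega> (x + c * t + a)"
  proof (intro ballI allI)
    fix t x assume t: "t \<in> {0-h..0}"
    define \<zeta> where "\<zeta> = x + c * t + a"
    have pw: "p * eta lam \<zeta> \<le> q0 * \<omega> \<zeta>"
      using mult_left_mono[OF omega_lower[of \<zeta>] less_imp_le[OF q0]] unfolding p_def by simp
    have "u t x - \<phi> \<zeta> \<le> p * eta lam \<zeta>"
    proof (cases "\<zeta> \<ge> Z")
      case True
      have "eta lam \<zeta> = 1" using True Z lam_pos by (intro eta_eq_1) auto
      then show ?thesis using Z1[of \<zeta>] True Z is_solD(3)[OF u, of t x] t by auto
    next
      case False
      have ct: "- (c * t) \<le> c * h" using t c_pos mult_left_mono[of "- t" h c] by simp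
      have "\<mu> * x \<le> \<mu> * ((\<zeta> - Z) + (Z + c * h - a))" using ct \<mu>0 unfolding \<zeta>_def by (intro mult_left_mono) auto
      also have "\<dots> = \<mu> * (\<zeta> - Z) + ln (p / A)" unfolding a_def using \<mu>0 by (simp add: field_simps)
      also have "\<mu> * (\<zeta> - Z) \<le> lam * (\<zeta> - Z)" using \<mu> False by (intro mult_right_mono_neg) auto
      finally have "A * exp (\<mu> * x) \<le> A * exp (lam * (\<zeta> - Z) + ln (p / A))" using A by simp
      also have "\<dots> = p * exp (lam * (\<zeta> - Z))" using A p by (simp add: exp_add)
      also have "\<dots> \<le> p * eta lam \<zeta>"
      proof (intro mult_left_mono)
        have "lam * (\<zeta> - Z) \<le> lam * \<zeta>" using Z lam_pos by (intro mult_left_mono) auto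
        moreover have "lam * (\<zeta> - Z) \<le> 0" using False lam_pos by (simp add: mult_le_0_iff)
        ultimately show "exp (lam * (\<zeta> - Z)) \<le> eta lam \<zeta>" unfolding eta_def by simp
      qed (use p in simp)
      finally have "A * exp (\<mu> * x) \<le> p * eta lam \<zeta>" .
      then show ?thesis using init[of t x] t phi(3)[of \<zeta>] by simp
    qed
    then show "1 * (u t x - \<phi> (x + c * t + a)) \<le> q0 * \<omega> (x + c * t + a)" using pw unfolding \<zeta>_def by simp
  qed
  have "squeezed u 1 (1 * a + \<beta> * q0)" by (rule bar[OF u _ q0 order_refl order_refl hist]) simp
  then show ?thesis by blast
qed

text \<open>The datum may lie far below \<kappa> on the right, whereas barriers start only from
  small errors; \<open>invasion\<close> first raises the solution close to \<kappa> on a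
  half-line.\<close>

lemma initially_above:
  assumes u: "is_sol h u" and \<sigma>: "0 < \<sigma>" "\<sigma> < \<kappa>"
    and init: "\<And>t x. t \<in> {-h..0} \<Longrightarrow> x \<ge> B \<Longrightarrow> u t x > \<kappa> - \<sigma>"
  shows "\<exists>\<xi>. squeezed u (- 1) \<xi>"
proof -
  from barrier_squeezed obtain q0 \<beta> where q0: "q0 > 0" and \<beta>: "\<beta> > 0"
    and "\<forall>u s q T a. is_sol h u \<longrightarrow> s = 1 \<or> s = - 1 \<longrightarrow> 0 < q \<longrightarrow> q \<le> q0 \<longrightarrow> 0 \<le> T \<longrightarrow>
     (\<forall>t\<in>{T-h..T}. \<forall>x. s * (u t x - \<phi> (x + c * t + a)) \<le> q * \<omega> (x + c * t + a)) \<longrightarrow>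
     squeezed u s (s * a + \<beta> * q)"
    by (elim exE conjE) (rule that)
  note bar = this(3)[THEN spec, THEN spec, THEN spec, THEN spec, THEN spec,
      THEN mp, THEN mp, THEN mp, THEN mp, THEN mp, THEN mp]
  define p where "p = q0 * k0"
  have p: "p > 0" using q0 k0_pos by (simp add: p_def)
  \<comment> \<open>The bound p serves \<zeta> \<ge> 0, where the weight is 1; the bound \<kappa> -
    \<phi> 0 puts the solution above \<phi> itself when \<zeta> < 0 and x \<ge> B'.\<close>
  define q2 where "q2 = min p (\<kappa> - \<phi> 0)"
  have q2: "q2 > 0" "q2 \<le> p" "q2 \<le> \<kappa> - \<phi> 0" using p phi_less_kappa[of 0] by (auto simp: q2_def)
  obtain T B' where T: "T \<ge> 0" "\<And>t x. t \<in> {T-h..T} \<Longrightarrow> x \<ge> B' \<Longrightarrow> u t x \<ge> \<kappa> - q2"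
    using invasion[OF u h \<sigma> init q2(1)] by blast
  define l where "l = (lam + l2) / 2"
  have l: "l1 < l" "l < l2" "lam < l" using lam by (auto simp: l_def)
  obtain C where C: "C > 0" "\<And>z. \<phi> z \<le> C * exp (l * z)" using fast_decay[OF l(1,2)] by blast
  have "((\<lambda>z. C * exp ((l - lam) * z)) \<longlongrightarrow> 0) at_bot" using l by real_asymp
  then obtain Y1 where Y1: "\<And>y. y \<le> Y1 \<Longrightarrow> \<bar>C * exp ((l - lam) * y) - 0\<bar> < p" using tendsto_at_botD[OF _ p] by blast
  define Y where "Y = min 0 Y1"
  have Y: "Y \<le> 0" "Y \<le> Y1" by (auto simp: Y_def)
  \<comment> \<open>Every x < B' lands in \<zeta> \<le> Y, where \<phi> is small relative to the
    weight because it decays at the larger exponent l; there u \<ge> 0 is enough.\<close>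
  define a where "a = Y - B' - c * T"
  have hist: "\<forall>t\<in>{T-h..T}. \<forall>x. (- 1) * (u t x - \<phi> (x + c * t + a)) \<le> q0 * \<omega> (x + c * t + a)"
  proof (intro ballI allI)
    fix t x assume t: "t \<in> {T-h..T}"
    define \<zeta> where "\<zeta> = x + c * t + a"
    have pw: "p * eta lam \<zeta> \<le> q0 * \<omega> \<zeta>"
      using mult_left_mono[OF omega_lower[of \<zeta>] less_imp_le[OF q0]] unfolding p_def by simp
    have pe: "0 \<le> p * eta lam \<zeta>" using p eta_nonneg by simp
    have u0: "0 \<le> u t x" using is_solD(2)[OF u, of t x] t T(1) by auto
    have "\<phi> \<zeta> - u t x \<le> p * eta lam \<zeta>"
    proof (cases "x \<ge> B'")
      case True
      have ub: "u t x \<ge> \<kappa> - q2" by (rule T(2)[OF t True])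
      show ?thesis
      proof (cases "\<zeta> \<ge> 0")
        case True
        then have "eta lam \<zeta> = 1" using lam_pos by (intro eta_eq_1) auto
        then show ?thesis using ub q2 phi(4)[of \<zeta>] by simp
      next
        case False
        then have "\<phi> \<zeta> \<le> \<phi> 0" by (intro phi_mono) simp
        then show ?thesis using ub q2 pe by linarith
      qed
    next
      case False
      have "c * t \<le> c * T" using t c_pos by simp
      then have z: "\<zeta> \<le> Y" using False unfolding \<zeta>_def a_def by simp
      have "C * exp (l * \<zeta>) = (C * exp ((l - lam) * \<zeta>)) * exp (lam * \<zeta>)" by (simp add: exp_add[symmetric] algebra_simps)
      also have "\<dots> \<le> p * exp (lam * \<zeta>)" using Y1[of \<zeta>] z Y by (intro mult_right_mono) auto
      also have "exp (lam * \<zeta>) = eta lam \<zeta>" using z Y lam_pos by (intro eta_eq_exp[symmetric]) auto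
      finally show ?thesis using C(2)[of \<zeta>] u0 by linarith
    qed
    then show "(- 1) * (u t x - \<phi> (x + c * t + a)) \<le> q0 * \<omega> (x + c * t + a)" using pw unfolding \<zeta>_def by simp
  qed
  have "squeezed u (- 1) ((- 1) * a + \<beta> * q0)" by (rule bar[OF u _ q0 order_refl T(1) hist]) simp
  then show ?thesis by blast
qed

end

theorem theorem2:
  fixes g :: "real \<Rightarrow> real" and \<kappa> h cstar :: real and \<phi> :: "real \<Rightarrow> real"
    and w0 u :: "real \<Rightarrow> real \<Rightarrow> real" and A B \<sigma> \<mu> lam :: real
  assumes H: "hyp_H g \<kappa>"
    and mono: "mono g"
    and h: "h \<ge> 0"
    and front: "wavefront g h \<kappa> cstar \<phi>"
    and minimal: "\<forall>c \<psi>. wavefront g h \<kappa> c \<psi> \<longrightarrow> cstar \<le> c"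
    and pushed: "cstar > c_sharp g h"
    and w0_reg: "admissible_initial h w0"
    and A: "A > 0" and B: "B > 0"
    and \<sigma>: "0 < \<sigma>" "\<sigma> < \<kappa>"
    and \<mu>: "\<mu> > lambda1 g h cstar"
    and IC1: "\<forall>s\<in>{-h..0}. \<forall>x. 0 \<le> w0 s x \<and> w0 s x \<le> \<kappa>"
    and IC2: "\<forall>s\<in>{-h..0}. \<forall>x. w0 s x \<le> A * exp (\<mu> * x)"
    and IC3: "\<forall>s\<in>{-h..0}. \<forall>x \<ge> B. w0 s x > \<kappa> - \<sigma>"
    and lam: "lambda1 g h cstar < lam" "lam < lambda2 g h cstar" "lam < \<mu>"
    and sol: "ivp_solution g h \<kappa> w0 u"
  shows "\<exists>s0. \<forall>\<epsilon> > 0. \<forall>\<^sub>F t in at_top. \<forall>x.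
           \<bar>u t x - \<phi> (x + cstar * t + s0)\<bar> / eta lam (x + cstar * t) \<le> \<epsilon>"
proof -
  have lam_mu: "lam < \<mu>" by (rule lam(3))
  interpret stable_front g \<kappa> h cstar \<phi> lam
    by unfold_locales (use H mono h front minimal pushed lam in auto)
  have eq: "u t x = w0 t x" if "t \<in> {-h..0}" for t x
    using sol that unfolding ivp_solution_def by blast
  have u: "is_sol h u" using sol unfolding ivp_solution_def is_sol_def by blast
  have "\<exists>\<xi>. squeezed u 1 \<xi>"
    by (rule initially_below[OF u A lam_mu]) (use IC2 eq in auto)
  moreover have "\<exists>\<xi>. squeezed u (- 1) \<xi>"
    by (rule initially_above[OF u \<sigma>]) (use IC3 eq in auto)
  ultimately show ?thesis by (rule convergence[OF u])
qed

end
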